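(* Let $n\ge 2$. Every $\operatorname{IA}$ automorphism of $PVT_n$ is inner if and only if $n=2$ or $n \ge 5$.
   Context: For $n\ge 2$, the virtual twin group $VT_n$ is the group with generators $s_1,\dots,s_{n-1},\rho_1,\dots,\rho_{n-1}$ and defining relations: $s_i^2=1$ and $\rho_i^2=1$ for $1\le i\le n-1$; $s_is_j=s_js_i$, $\rho_i\rho_j=\rho_j\rho_i$ and $\rho_is_j=s_j\rho_i$ for $|i-j|\ge 2$; $\rho_i\rho_{i+1}\rho_i=\rho_{i+1}\rho_i\rho_{i+1}$ and $\rho_i\rho_{i+1}s_i=s_{i+1}\rho_i\rho_{i+1}$ for $1\le i\le n-2$. The pure virtual twin group $PVT_n$ is the kernel of the surjection $\pi:VT_n\to S_n$, $\pi(s_i)=\pi(\rho_i)=(i,i+1)$. An automorphism of a group is an $\operatorname{IA}$ automorphism if it induces the identity on the abelianisation of the group. *)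

theory Defs
  imports "HOL-Algebra.Sym_Groups" "HOL-Algebra.Bij"
begin

section \<open>Groups given by generators and relations\<close>

text \<open>A letter \<^term>\<open>(x, True)\<close> stands for the generator \<open>x\<close>, and \<^term>\<open>(x, False)\<close> for its
  formal inverse. A defining relation \<open>u = v\<close> is a pair of words.\<close>

type_synonym 'a gword = "('a \<times> bool) list"

definition gwords :: "'a set \<Rightarrow> 'a gword set"
  where "gwords X = lists (X \<times> UNIV)"

inductive_set pres_rel :: "'a set \<Rightarrow> ('a gword \<times> 'a gword) set \<Rightarrow> ('a gword \<times> 'a gword) set"
  for X R where
  refl: "w \<in> gwords X \<Longrightarrow> (w, w) \<in> pres_rel X R"
| sym: "(u, v) \<in> pres_rel X R \<Longrightarrow> (v, u) \<in> pres_rel X R"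
| trans: "(u, v) \<in> pres_rel X R \<Longrightarrow> (v, w) \<in> pres_rel X R \<Longrightarrow> (u, w) \<in> pres_rel X R"
| append: "(u, u') \<in> pres_rel X R \<Longrightarrow> (v, v') \<in> pres_rel X R \<Longrightarrow> (u @ v, u' @ v') \<in> pres_rel X R"
| cancel: "x \<in> X \<Longrightarrow> ([(x, b), (x, \<not> b)], []) \<in> pres_rel X R"
| defining: "(u, v) \<in> R \<Longrightarrow> u \<in> gwords X \<Longrightarrow> v \<in> gwords X \<Longrightarrow> (u, v) \<in> pres_rel X R"

definition presented_group ::
    "'a set \<Rightarrow> ('a gword \<times> 'a gword) set \<Rightarrow> 'a gword set monoid"
  where "presented_group X R =
    \<lparr>carrier = gwords X // pres_rel X R,
     mult = \<lambda>A B. pres_rel X R `` {u @ v | u v. u \<in> A \<and> v \<in> B},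
     one = pres_rel X R `` {[]}\<rparr>"

definition word_eval :: "('b, 'm) monoid_scheme \<Rightarrow> ('a \<Rightarrow> 'b) \<Rightarrow> 'a gword \<Rightarrow> 'b"
  where "word_eval G f w =
    foldr (\<lambda>(x, b) g. (if b then f x else inv\<^bsub>G\<^esub> (f x)) \<otimes>\<^bsub>G\<^esub> g) w \<one>\<^bsub>G\<^esub>"

text \<open>The homomorphism out of a presented group that extends a map \<open>f\<close> of the generators. If \<open>f\<close>
  respects the relations, \<open>word_eval G f\<close> is constant on each class, see \<open>presented_lift_class\<close>.\<close>

definition presented_lift :: "('b, 'm) monoid_scheme \<Rightarrow> ('a \<Rightarrow> 'b) \<Rightarrow> 'a gword set \<Rightarrow> 'b"
  where "presented_lift G f A = the_elem (word_eval G f ` A)"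

lemma pres_rel_gwords: "(u, v) \<in> pres_rel X R \<Longrightarrow> u \<in> gwords X \<and> v \<in> gwords X"
  by (induction rule: pres_rel.induct) (auto simp: gwords_def)

lemma equiv_pres_rel: "equiv (gwords X) (pres_rel X R)"
proof (rule equivI)
  show "pres_rel X R \<subseteq> gwords X \<times> gwords X"
    by (auto dest: pres_rel_gwords)
  show "refl_on (gwords X) (pres_rel X R)"
    by (auto intro: refl_onI pres_rel.refl)
  show "sym (pres_rel X R)"
    by (auto intro: symI pres_rel.sym)
  show "trans (pres_rel X R)"
    by (auto intro: transI pres_rel.trans)
qed

lemma presented_mult_class:
  assumes "u \<in> gwords X" "v \<in> gwords X"
  shows "pres_rel X R `` {u} \<otimes>\<^bsub>presented_group X R\<^esub> pres_rel X R `` {v} = pres_rel X R `` {u @ v}"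
proof -
  let ?c = "\<lambda>u. pres_rel X R `` {u}"
  have "w \<in> pres_rel X R `` {a @ b | a b. a \<in> ?c u \<and> b \<in> ?c v}" if "(u @ v, w) \<in> pres_rel X R" for w
  proof (rule ImageI[OF that])
    show "u @ v \<in> {a @ b | a b. a \<in> ?c u \<and> b \<in> ?c v}"
      using assms by (auto intro: pres_rel.refl)
  qed
  moreover have "(u @ v, w) \<in> pres_rel X R"
    if "w \<in> pres_rel X R `` {a @ b | a b. a \<in> ?c u \<and> b \<in> ?c v}" for w
    using that by (auto intro: pres_rel.append pres_rel.trans)
  ultimately show ?thesis
    unfolding presented_group_def by (simp only: monoid.simps partial_object.simps) blast
qed

lemma presented_carrierE:
  assumes "A \<in> carrier (presented_group X R)"
  obtains u where "u \<in> gwords X" "A = pres_rel X R `` {u}"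
  using assms by (auto simp: presented_group_def quotient_def)

lemma presented_carrierI: "u \<in> gwords X \<Longrightarrow> pres_rel X R `` {u} \<in> carrier (presented_group X R)"
  by (auto simp: presented_group_def quotient_def)

lemma presented_one: "\<one>\<^bsub>presented_group X R\<^esub> = pres_rel X R `` {[]}"
  by (simp add: presented_group_def)

lemma gwords_Nil: "[] \<in> gwords X"
  by (simp add: gwords_def)

lemma gwords_append: "u \<in> gwords X \<Longrightarrow> v \<in> gwords X \<Longrightarrow> u @ v \<in> gwords X"
  by (simp add: gwords_def)

lemma pres_rel_left_inverse:
  "u \<in> gwords X \<Longrightarrow> \<exists>v\<in>gwords X. (v @ u, []) \<in> pres_rel X R"
proof (induction u)
  case Nil
  then show ?case
    by (auto intro!: bexI[of _ "[]"] pres_rel.refl gwords_Nil)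
next
  case (Cons a u)
  obtain x b where a: "a = (x, b)" by fastforce
  have x: "x \<in> X" and u: "u \<in> gwords X"
    using Cons.prems by (auto simp: gwords_def a)
  obtain v where v: "v \<in> gwords X" "(v @ u, []) \<in> pres_rel X R"
    using Cons.IH u by blast
  have c: "([(x, \<not> b), (x, b)], []) \<in> pres_rel X R"
    using pres_rel.cancel[OF x, of "\<not> b"] by simp
  have "(v @ ([(x, \<not> b), (x, b)] @ u), v @ ([] @ u)) \<in> pres_rel X R"
    by (intro pres_rel.append pres_rel.refl v u c)
  then have "((v @ [(x, \<not> b)]) @ (a # u), []) \<in> pres_rel X R"
    using pres_rel.trans v(2) by (simp add: a) blast
  moreover have "v @ [(x, \<not> b)] \<in> gwords X"
    using v x by (auto simp: gwords_def)
  ultimately show ?case by blast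
qed

lemma group_presented_group: "group (presented_group X R)"
proof (rule groupI)
  let ?G = "presented_group X R" and ?c = "\<lambda>u. pres_rel X R `` {u}"
  show "\<one>\<^bsub>?G\<^esub> \<in> carrier ?G"
    by (simp add: presented_one presented_carrierI gwords_Nil)
  fix A assume A: "A \<in> carrier ?G"
  then obtain u where u: "u \<in> gwords X" "A = ?c u" by (rule presented_carrierE)
  show "\<one>\<^bsub>?G\<^esub> \<otimes>\<^bsub>?G\<^esub> A = A"
    by (simp add: u presented_one presented_mult_class gwords_Nil)
  obtain v where v: "v \<in> gwords X" "(v @ u, []) \<in> pres_rel X R"
    using pres_rel_left_inverse[OF u(1)] by blast
  then have "?c v \<otimes>\<^bsub>?G\<^esub> A = \<one>\<^bsub>?G\<^esub>"
    by (simp add: u presented_one presented_mult_class equiv_class_eq[OF equiv_pres_rel])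
  then show "\<exists>B\<in>carrier ?G. B \<otimes>\<^bsub>?G\<^esub> A = \<one>\<^bsub>?G\<^esub>"
    using v presented_carrierI by blast
  fix B assume "B \<in> carrier ?G"
  then obtain v where v: "v \<in> gwords X" "B = ?c v" by (rule presented_carrierE)
  show "A \<otimes>\<^bsub>?G\<^esub> B \<in> carrier ?G"
    by (simp add: u v presented_mult_class presented_carrierI gwords_append)
  fix C assume "C \<in> carrier ?G"
  then obtain w where w: "w \<in> gwords X" "C = ?c w" by (rule presented_carrierE)
  show "A \<otimes>\<^bsub>?G\<^esub> B \<otimes>\<^bsub>?G\<^esub> C = A \<otimes>\<^bsub>?G\<^esub> (B \<otimes>\<^bsub>?G\<^esub> C)"
    by (simp add: u v w presented_mult_class gwords_append)
qed

context group
begin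

lemma word_eval_closed:
  "f \<in> X \<rightarrow> carrier G \<Longrightarrow> w \<in> gwords X \<Longrightarrow> word_eval G f w \<in> carrier G"
  by (induction w) (auto simp: word_eval_def gwords_def Pi_iff)

lemma word_eval_append:
  assumes "f \<in> X \<rightarrow> carrier G" "u \<in> gwords X" "v \<in> gwords X"
  shows "word_eval G f (u @ v) = word_eval G f u \<otimes> word_eval G f v"
  using assms(2)
proof (induction u)
  case Nil
  then show ?case
    using word_eval_closed[OF assms(1,3)] by (simp add: word_eval_def)
next
  case (Cons a u)
  obtain x b where a: "a = (x, b)" by fastforce
  have u: "u \<in> gwords X" and x: "f x \<in> carrier G"
    using Cons.prems assms(1) by (auto simp: gwords_def a)
  show ?case
    using Cons.IH[OF u] x word_eval_closed[OF assms(1) u] word_eval_closed[OF assms(1,3)]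
    by (simp add: word_eval_def a m_assoc)
qed

lemma word_eval_pres_rel:
  assumes f: "f \<in> X \<rightarrow> carrier G"
    and R: "\<And>u v. (u, v) \<in> R \<Longrightarrow> word_eval G f u = word_eval G f v"
    and "(u, v) \<in> pres_rel X R"
  shows "word_eval G f u = word_eval G f v"
  using assms(3)
proof (induction rule: pres_rel.induct)
  case (append u u' v v')
  then show ?case
    by (metis f word_eval_append pres_rel_gwords)
next
  case (cancel x b)
  then have "f x \<in> carrier G" using f by auto
  then show ?case by (simp add: word_eval_def)
qed (use R in auto)

lemma presented_lift_class:
  assumes "f \<in> X \<rightarrow> carrier G"
    and "\<And>u v. (u, v) \<in> R \<Longrightarrow> word_eval G f u = word_eval G f v"
    and "u \<in> gwords X"
  shows "presented_lift G f (pres_rel X R `` {u}) = word_eval G f u"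
proof -
  have "word_eval G f ` (pres_rel X R `` {u}) = {word_eval G f u}"
    using word_eval_pres_rel[OF assms(1,2)] pres_rel.refl[OF assms(3)] by (auto simp: image_iff)
  then show ?thesis
    by (simp add: presented_lift_def)
qed

lemma presented_lift_hom:
  assumes "f \<in> X \<rightarrow> carrier G"
    and "\<And>u v. (u, v) \<in> R \<Longrightarrow> word_eval G f u = word_eval G f v"
  shows "presented_lift G f \<in> hom (presented_group X R) G"
proof (rule homI)
  fix A assume "A \<in> carrier (presented_group X R)"
  then obtain u where u: "u \<in> gwords X" "A = pres_rel X R `` {u}" by (rule presented_carrierE)
  then show "presented_lift G f A \<in> carrier G"
    by (simp add: presented_lift_class[OF assms] word_eval_closed[OF assms(1)])
  fix B assume "B \<in> carrier (presented_group X R)"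
  then obtain v where v: "v \<in> gwords X" "B = pres_rel X R `` {v}" by (rule presented_carrierE)
  show "presented_lift G f (A \<otimes>\<^bsub>presented_group X R\<^esub> B) = presented_lift G f A \<otimes> presented_lift G f B"
    by (simp add: u v presented_mult_class presented_lift_class[OF assms] gwords_append
        word_eval_append[OF assms(1)])
qed

end


section \<open>Virtual twin groups\<close>

datatype vt_gen = Sgen nat | Rgen nat

abbreviation \<s> :: "nat \<Rightarrow> vt_gen \<times> bool"
  where "\<s> i \<equiv> (Sgen i, True)"

abbreviation \<rho> :: "nat \<Rightarrow> vt_gen \<times> bool"
  where "\<rho> i \<equiv> (Rgen i, True)"

definition vt_gens :: "nat \<Rightarrow> vt_gen set"
  where "vt_gens n = Sgen ` {1..n - 1} \<union> Rgen ` {1..n - 1}"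

definition vt_rels :: "nat \<Rightarrow> (vt_gen gword \<times> vt_gen gword) set"
  where "vt_rels n =
      {([\<s> i, \<s> i], []) | i. i \<in> {1..n - 1}}
    \<union> {([\<rho> i, \<rho> i], []) | i. i \<in> {1..n - 1}}
    \<union> {([\<s> i, \<s> j], [\<s> j, \<s> i]) | i j.
         i \<in> {1..n - 1} \<and> j \<in> {1..n - 1} \<and> \<bar>int i - int j\<bar> \<ge> 2}
    \<union> {([\<rho> i, \<rho> j], [\<rho> j, \<rho> i]) | i j.
         i \<in> {1..n - 1} \<and> j \<in> {1..n - 1} \<and> \<bar>int i - int j\<bar> \<ge> 2}
    \<union> {([\<rho> i, \<s> j], [\<s> j, \<rho> i]) | i j.
         i \<in> {1..n - 1} \<and> j \<in> {1..n - 1} \<and> \<bar>int i - int j\<bar> \<ge> 2}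
    \<union> {([\<rho> i, \<rho> (i + 1), \<rho> i], [\<rho> (i + 1), \<rho> i, \<rho> (i + 1)]) | i. i \<in> {1..n - 2}}
    \<union> {([\<rho> i, \<rho> (i + 1), \<s> i], [\<s> (i + 1), \<rho> i, \<rho> (i + 1)]) | i. i \<in> {1..n - 2}}"

definition VT :: "nat \<Rightarrow> vt_gen gword set monoid"
  where "VT n = presented_group (vt_gens n) (vt_rels n)"

fun vt_transp :: "vt_gen \<Rightarrow> nat \<Rightarrow> nat"
  where "vt_transp (Sgen i) = transpose i (i + 1)"
  | "vt_transp (Rgen i) = transpose i (i + 1)"

text \<open>The surjection \<open>\<pi>\<close> onto the symmetric group. Products in \<^const>\<open>sym_group\<close> are composed from
  right to left; the opposite convention would replace \<open>\<pi> w\<close> by its inverse permutation and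
  therefore gives the same kernel.\<close>

definition vt_perm :: "nat \<Rightarrow> vt_gen gword set \<Rightarrow> nat \<Rightarrow> nat"
  where "vt_perm n = presented_lift (sym_group n) vt_transp"

definition PVT :: "nat \<Rightarrow> vt_gen gword set monoid"
  where "PVT n = (VT n)\<lparr>carrier := kernel (VT n) (sym_group n) (vt_perm n)\<rparr>"

lemma vt_transp_carrier: "vt_transp \<in> vt_gens n \<rightarrow> carrier (sym_group n)"
  by (auto simp: vt_gens_def sym_group_carrier intro!: permutes_swap_id)

lemma vt_transp_rels:
  assumes "(u, v) \<in> vt_rels n"
  shows "word_eval (sym_group n) vt_transp u = word_eval (sym_group n) vt_transp v"
  using assms unfolding vt_rels_def
  by (auto simp: word_eval_def sym_group_mult sym_group_one fun_eq_iff transpose_def)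

lemma vt_rels_gwords: "(u, v) \<in> vt_rels n \<Longrightarrow> u \<in> gwords (vt_gens n) \<and> v \<in> gwords (vt_gens n)"
  unfolding vt_rels_def by (auto simp: gwords_def vt_gens_def)

lemma vt_perm_group_hom: "group_hom (VT n) (sym_group n) (vt_perm n)"
  unfolding VT_def vt_perm_def
  by (intro group_hom.intro group_hom_axioms.intro group_presented_group sym_group_is_group
      group.presented_lift_hom vt_transp_carrier vt_transp_rels)

lemma vt_perm_gen:
  assumes "x \<in> vt_gens n"
  shows "vt_perm n (pres_rel (vt_gens n) (vt_rels n) `` {[(x, True)]}) = vt_transp x"
proof -
  have "[(x, True)] \<in> gwords (vt_gens n)"
    using assms by (simp add: gwords_def)
  then show ?thesis
    unfolding vt_perm_def
    by (simp add: group.presented_lift_class[OF sym_group_is_group vt_transp_carrier vt_transp_rels]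
        word_eval_def sym_group_mult sym_group_one)
qed

lemma group_PVT: "group (PVT n)"
  unfolding PVT_def
  by (intro subgroup.subgroup_is_group group_hom.subgroup_kernel vt_perm_group_hom
      group_hom.axioms(1)[OF vt_perm_group_hom])


section \<open>IA and inner automorphisms\<close>

definition abelianisation :: "('a, 'm) monoid_scheme \<Rightarrow> 'a set monoid"
  where "abelianisation G = G Mod derived G (carrier G)"

text \<open>The map that an automorphism \<open>\<phi>\<close> induces on the abelianisation sends a coset \<open>C\<close> to its
  image \<open>\<phi> ` C\<close>, see \<open>auto_image_coset\<close>.\<close>

definition IA_auto :: "('a, 'm) monoid_scheme \<Rightarrow> ('a \<Rightarrow> 'a) set"
  where "IA_auto G = {\<phi> \<in> auto G. \<forall>C \<in> carrier (abelianisation G). \<phi> ` C = C}"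

definition inner_auto :: "('a, 'm) monoid_scheme \<Rightarrow> ('a \<Rightarrow> 'a) set"
  where "inner_auto G =
    {\<lambda>x\<in>carrier G. g \<otimes>\<^bsub>G\<^esub> x \<otimes>\<^bsub>G\<^esub> inv\<^bsub>G\<^esub> g | g. g \<in> carrier G}"

lemma (in group) auto_image_coset:
  assumes "\<phi> \<in> auto G" "x \<in> carrier G"
  shows "\<phi> ` (derived G (carrier G) #> x) = derived G (carrier G) #> \<phi> x"
proof -
  have \<phi>: "\<phi> \<in> hom G G" and surj: "\<phi> ` carrier G = carrier G"
    using assms(1) by (auto simp: auto_def Bij_def bij_betw_def)
  interpret \<phi>: group_hom G G \<phi>
    by unfold_locales (rule \<phi>)
  have D: "\<phi> ` derived G (carrier G) = derived G (carrier G)"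
    using \<phi>.derived_img[of "carrier G"] surj by simp
  have "derived G (carrier G) \<subseteq> carrier G"
    by (rule derived_in_carrier) simp
  then have "\<phi> ` (derived G (carrier G) #> x) = \<phi> ` derived G (carrier G) #> \<phi> x"
    using assms(2) by (auto simp: r_coset_def image_iff subset_iff)
  then show ?thesis
    by (simp add: D)
qed

end

theory Submission
  imports Defs "HOL-Algebra.Elementary_Groups"
begin

text \<open>The group \<^term>\<open>PVT n\<close> is the right-angled Artin group on the graph whose vertices are the pairs
  \<open>i < j \<le> n\<close> and whose edges join disjoint pairs; the generator \<open>\<lambda>\<^sub>i\<^sub>j\<close> is the conjugate of
  \<open>s\<^sub>1 \<rho>\<^sub>1\<close> by a word in the \<open>\<rho>\<^sub>k\<close> that maps \<open>1, 2\<close> to \<open>i, j\<close>, and the Coxeter presentation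
  of the symmetric group shows that only the order of \<open>i, j\<close> matters.

  For \<open>n \<ge> 5\<close> no link is contained in the star of another vertex and the complement of every star is
  connected. An \<open>IA\<close> endomorphism \<open>\<phi>\<close> is then inner, by an argument with the walls (hyperplanes) of
  the Artin group. If a wall of type \<open>b \<noteq> a\<close> crossed an axis of \<open>\<phi>(a)\<close>, pick \<open>u\<close> in the link of \<open>a\<close>
  outside the star of \<open>b\<close>: some \<open>\<phi>(a)\<^sup>p \<phi>(u)\<^sup>q\<close> with \<open>q \<noteq> 0\<close> fixes this wall and so is conjugate
  into the subgroup of the link of \<open>b\<close>, contradicting the exponent of \<open>u\<close>. Hence \<open>\<phi>(a)\<close> is conjugate
  to \<open>a\<close>, by a coset of the centraliser of \<open>a\<close>. The cosets of adjacent vertices meet, and a base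
  point with the least total distance to all cosets lies in all of them, since otherwise stepping
  across a wall next to it would bring it closer.

  For \<open>n = 3, 4\<close> conjugating \<open>\<lambda>\<^sub>1\<^sub>2\<close> and \<open>\<lambda>\<^sub>3\<^sub>4\<close> by \<open>\<lambda>\<^sub>1\<^sub>3\<close> is an \<open>IA\<close> automorphism that is
  not inner, and for \<open>n = 2\<close> the group is cyclic.\<close>


section \<open>Right-angled Artin groups and their walls\<close>

text \<open>No cube complex is built: a wall is a tagged coset, and the parity with which a word
  crosses it is invariant under rewriting. This replaces the theorem that hyperplanes separate. The
  bound 5 comes from the graph. The complement of the star of {i, j} is complete bipartite on n - 2
  plus n - 2 vertices with a perfect matching removed, which is connected once n - 2 >= 3. For n = 4
  the graph is three disjoint edges and for n = 3 three isolated points, so that one component can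
  be conjugated alone. The delicate case in the descent to a common base point is a wall whose type
  is the very vertex of the missed coset: crossing it need not help, and it has to be excluded
  through links and stars. For the presentation, the hard half is that the pure generators satisfy
  no further relations. Instead of rewriting inside the kernel, the virtual twin group is made to
  act on words in the pairs, as on the normal factor of a semidirect product with the symmetric
  group; the empty word then recovers the spelling of a pure element.\<close>

lemma gwords_Cons [simp]: "c # w \<in> gwords X \<longleftrightarrow> fst c \<in> X \<and> w \<in> gwords X"
  by (cases c) (auto simp: gwords_def)

lemma gwords_append_iff [simp]: "u @ v \<in> gwords X \<longleftrightarrow> u \<in> gwords X \<and> v \<in> gwords X"
  by (auto simp: gwords_def)

declare gwords_Nil [simp]

lemma gwords_mono: "w \<in> gwords X \<Longrightarrow> X \<subseteq> Y \<Longrightarrow> w \<in> gwords Y"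
  by (induction w) auto

lemma gwords_iff: "w \<in> gwords X \<longleftrightarrow> (\<forall>c\<in>set w. fst c \<in> X)"
  by (induction w) auto

lemma pres_rel_right_inverse:
  assumes "u \<in> gwords X"
  obtains v where "v \<in> gwords X" "(v @ u, []) \<in> pres_rel X R" "(u @ v, []) \<in> pres_rel X R"
proof -
  obtain v where v: "v \<in> gwords X" "(v @ u, []) \<in> pres_rel X R"
    using pres_rel_left_inverse[OF assms] by blast
  obtain t where t: "t \<in> gwords X" "(t @ v, []) \<in> pres_rel X R"
    using pres_rel_left_inverse[OF v(1)] by blast
  have uv: "u @ v \<in> gwords X" using assms v by simp
  have "((t @ v) @ u @ v, [] @ u @ v) \<in> pres_rel X R"
    using t uv by (intro pres_rel.append pres_rel.refl)
  moreover have "(t @ (v @ u) @ v, t @ [] @ v) \<in> pres_rel X R"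
    using t v by (intro pres_rel.append pres_rel.refl)
  ultimately have "(u @ v, t @ v) \<in> pres_rel X R"
    by (auto intro: pres_rel.sym pres_rel.trans)
  then have "(u @ v, []) \<in> pres_rel X R"
    using t(2) by (rule pres_rel.trans)
  with v show thesis using that by blast
qed

lemma (in group) inv_cancel:
  "x \<in> carrier G \<Longrightarrow> y \<in> carrier G \<Longrightarrow> inv x \<otimes> (x \<otimes> y) = y"
  "x \<in> carrier G \<Longrightarrow> y \<in> carrier G \<Longrightarrow> x \<otimes> (inv x \<otimes> y) = y"
  by (simp_all flip: m_assoc)

lemmas (in group) word_simps = m_assoc inv_mult_group inv_cancel

lemma (in group) l_coset_eq_iff:
  assumes "subgroup H G" "g \<in> carrier G" "h \<in> carrier G"
  shows "l_coset G g H = l_coset G h H \<longleftrightarrow> inv g \<otimes> h \<in> H"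
proof
  interpret H: subgroup H G by fact
  assume eq: "l_coset G g H = l_coset G h H"
  have "h \<in> l_coset G g H"
    unfolding eq using assms by (force simp: l_coset_def)
  then obtain k where "k \<in> H" "h = g \<otimes> k"
    by (auto simp: l_coset_def)
  then show "inv g \<otimes> h \<in> H"
    using assms by (simp add: inv_cancel)
next
  interpret H: subgroup H G by fact
  assume *: "inv g \<otimes> h \<in> H"
  have "\<exists>k'\<in>H. g \<otimes> k = h \<otimes> k'" "\<exists>k'\<in>H. h \<otimes> k = g \<otimes> k'" if "k \<in> H" for k
  proof (rule bexI)
    show "g \<otimes> k = h \<otimes> (inv (inv g \<otimes> h) \<otimes> k)"
      using assms that by (simp add: word_simps)
    show "inv (inv g \<otimes> h) \<otimes> k \<in> H"
      using * that by blast
    show "\<exists>k'\<in>H. h \<otimes> k = g \<otimes> k'"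
    proof (rule bexI)
      show "h \<otimes> k = g \<otimes> ((inv g \<otimes> h) \<otimes> k)"
        using assms that by (simp add: word_simps)
      show "(inv g \<otimes> h) \<otimes> k \<in> H"
        using * that by blast
    qed
  qed
  then show "l_coset G g H = l_coset G h H"
    unfolding l_coset_def by blast
qed

lemma (in group) commute_conj:
  assumes "x \<in> carrier G" "y \<in> carrier G" "x \<otimes> y = y \<otimes> x"
  shows "inv x \<otimes> y \<otimes> x = y" "x \<otimes> y \<otimes> inv x = y" "inv x \<otimes> y = y \<otimes> inv x"
proof -
  show 1: "inv x \<otimes> y \<otimes> x = y" using assms by (simp add: m_assoc inv_cancel flip: assms(3))
  show "x \<otimes> y \<otimes> inv x = y" using assms by (simp add: m_assoc)
  show "inv x \<otimes> y = y \<otimes> inv x"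
    using arg_cong[OF 1, of "\<lambda>z. z \<otimes> inv x"] assms(1,2) by (simp add: m_assoc)
qed

section \<open>Right-angled Artin groups and their universal property\<close>

definition raag_rels :: "'e set \<Rightarrow> ('e \<Rightarrow> 'e \<Rightarrow> bool) \<Rightarrow> ('e gword \<times> 'e gword) set"
  where "raag_rels E adj =
    {([(x, True), (y, True)], [(y, True), (x, True)]) | x y. x \<in> E \<and> y \<in> E \<and> adj x y}"

text \<open>An arbitrary group with a generating family that obeys no relations beyond the
  commutations, rather than the presented group itself, so that the subgroup \<open>PVT n\<close> of
  \<open>VT n\<close> becomes an instance without transport along an isomorphism.\<close>

locale raag = group G for G (structure) +
  fixes E :: "'e set" and adj :: "'e \<Rightarrow> 'e \<Rightarrow> bool" and lam :: "'e \<Rightarrow> 'a"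
  assumes adj_sym: "adj x y \<Longrightarrow> adj y x"
    and adj_irrefl: "\<not> adj x x"
    and lam_funcset: "lam \<in> E \<rightarrow> carrier G"
    and lam_commute: "x \<in> E \<Longrightarrow> y \<in> E \<Longrightarrow> adj x y \<Longrightarrow> lam x \<otimes> lam y = lam y \<otimes> lam x"
    and lam_generate: "g \<in> carrier G \<Longrightarrow> \<exists>w\<in>gwords E. word_eval G lam w = g"
    and lam_faithful:
      "w \<in> gwords E \<Longrightarrow> word_eval G lam w = \<one> \<Longrightarrow> (w, []) \<in> pres_rel E (raag_rels E adj)"
begin

abbreviation ev :: "'e gword \<Rightarrow> 'a" where "ev \<equiv> word_eval G lam"

definition letter :: "'e \<times> bool \<Rightarrow> 'a"
  where "letter c = (if snd c then lam (fst c) else inv (lam (fst c)))"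

lemma lam_closed [simp, intro]: "x \<in> E \<Longrightarrow> lam x \<in> carrier G"
  using lam_funcset by auto

lemma letter_closed [simp, intro]: "fst c \<in> E \<Longrightarrow> letter c \<in> carrier G"
  by (simp add: letter_def)

lemma letter_flip: "fst c \<in> E \<Longrightarrow> letter (fst c, \<not> snd c) = inv (letter c)"
  by (simp add: letter_def)

lemma ev_closed [simp, intro]: "w \<in> gwords E \<Longrightarrow> ev w \<in> carrier G"
  by (rule word_eval_closed[OF lam_funcset])

lemma ev_Nil [simp]: "ev [] = \<one>"
  by (simp add: word_eval_def)

lemma ev_Cons [simp]: "ev (c # w) = letter c \<otimes> ev w"
  by (simp add: word_eval_def letter_def split_beta)

lemma ev_append [simp]: "u \<in> gwords E \<Longrightarrow> v \<in> gwords E \<Longrightarrow> ev (u @ v) = ev u \<otimes> ev v"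
  by (rule word_eval_append[OF lam_funcset])

text \<open>Appending a word \<open>t\<close> inverse to \<open>v\<close> turns an equality of
  values into a word of value \<one>, to which \<open>lam_faithful\<close> applies.\<close>

lemma ev_eq_iff:
  assumes "u \<in> gwords E" "v \<in> gwords E"
  shows "ev u = ev v \<longleftrightarrow> (u, v) \<in> pres_rel E (raag_rels E adj)"
proof
  assume eq: "ev u = ev v"
  let ?R = "pres_rel E (raag_rels E adj)"
  obtain t where t: "t \<in> gwords E" "(t @ v, []) \<in> ?R" "(v @ t, []) \<in> ?R"
    using pres_rel_right_inverse[OF assms(2)] by blast
  have "ev (t @ v) = ev []"
    by (rule word_eval_pres_rel[OF lam_funcset _ t(2)])
      (auto simp: raag_rels_def letter_def intro: lam_commute)
  then have "ev (v @ t) = \<one>"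
    using t assms by (simp add: inv_comm)
  then have "(u @ t, []) \<in> ?R"
    using t assms eq by (intro lam_faithful) auto
  then have "((u @ t) @ v, [] @ v) \<in> ?R"
    using assms by (intro pres_rel.append pres_rel.refl)
  moreover have "(u @ t @ v, u @ []) \<in> ?R"
    using assms t by (intro pres_rel.append pres_rel.refl)
  ultimately show "(u, v) \<in> ?R"
    by (auto intro: pres_rel.sym pres_rel.trans)
next
  assume "(u, v) \<in> pres_rel E (raag_rels E adj)"
  then show "ev u = ev v"
    by (rule word_eval_pres_rel[OF lam_funcset, rotated])
      (auto simp: raag_rels_def letter_def intro: lam_commute)
qed

lemma word_exists:
  assumes "g \<in> carrier G"
  obtains w where "w \<in> gwords E" "ev w = g"
  using lam_generate[OF assms] by blast

lemma hom_exists: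
  assumes "group H" "f \<in> E \<rightarrow> carrier H"
    and "\<And>x y. x \<in> E \<Longrightarrow> y \<in> E \<Longrightarrow> adj x y \<Longrightarrow> f x \<otimes>\<^bsub>H\<^esub> f y = f y \<otimes>\<^bsub>H\<^esub> f x"
  obtains h where "h \<in> hom G H" "\<And>x. x \<in> E \<Longrightarrow> h (lam x) = f x"
proof -
  interpret H: group H by fact
  define h where "h g = word_eval H f (SOME w. w \<in> gwords E \<and> ev w = g)" for g
  have h: "h (ev w) = word_eval H f w" if "w \<in> gwords E" for w
  proof -
    define v where "v = (SOME v. v \<in> gwords E \<and> ev v = ev w)"
    have "v \<in> gwords E \<and> ev v = ev w"
      unfolding v_def by (rule someI_ex) (use that in blast)
    then have "(v, w) \<in> pres_rel E (raag_rels E adj)"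
      using ev_eq_iff that by blast
    then have "word_eval H f v = word_eval H f w"
      by (rule H.word_eval_pres_rel[OF assms(2), rotated])
        (use assms(2,3) in \<open>auto simp: raag_rels_def word_eval_def Pi_iff\<close>)
    then show ?thesis by (simp add: h_def v_def)
  qed
  have "h \<in> hom G H"
  proof (rule homI)
    fix x assume "x \<in> carrier G"
    then obtain u where u: "u \<in> gwords E" "x = ev u" using word_exists by blast
    then show "h x \<in> carrier H"
      by (simp add: h H.word_eval_closed[OF assms(2)])
    fix y assume "y \<in> carrier G"
    then obtain v where v: "v \<in> gwords E" "y = ev v" using word_exists by blast
    show "h (x \<otimes> y) = h x \<otimes>\<^bsub>H\<^esub> h y"
      using h[of "u @ v"] by (simp add: u v h H.word_eval_append[OF assms(2)])
  qed
  moreover have "h (lam x) = f x" if "x \<in> E" for x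
    using h[of "[(x, True)]"] that assms(2) by (simp add: letter_def word_eval_def Pi_iff)
  ultimately show thesis using that by blast
qed

lemma hom_eqI:
  assumes "group H" "h \<in> hom G H" "k \<in> hom G H" "\<And>x. x \<in> E \<Longrightarrow> h (lam x) = k (lam x)"
    and "g \<in> carrier G"
  shows "h g = k g"
proof -
  interpret h: group_hom G H h using assms by (simp add: group_hom_def group_hom_axioms_def is_group)
  interpret k: group_hom G H k using assms by (simp add: group_hom_def group_hom_axioms_def is_group)
  have "h (ev w) = k (ev w)" if "w \<in> gwords E" for w
    using that by (induction w) (auto simp: letter_def assms(4))
  then show ?thesis
    using word_exists[OF assms(5)] by blast
qed

section \<open>Exponent sums\<close>

text \<open>The exponent sum of \<open>e\<close>, which exists by the universal property.
  \<open>IA_endomorphism_inner\<close> sees the abelianisation only through these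
  homomorphisms.\<close>

definition expo :: "'e \<Rightarrow> 'a \<Rightarrow> int"
  where "expo e = (SOME h. h \<in> hom G integer_group \<and> (\<forall>x\<in>E. h (lam x) = (if x = e then 1 else 0)))"

lemma expo_hom: "expo e \<in> hom G integer_group"
  and expo_lam: "x \<in> E \<Longrightarrow> expo e (lam x) = (if x = e then 1 else 0)"
proof -
  have "(\<lambda>x. if x = e then 1 else 0) \<in> E \<rightarrow> carrier integer_group"
    by simp
  from hom_exists[OF group_integer_group this]
  obtain h where "h \<in> hom G integer_group" "\<And>x. x \<in> E \<Longrightarrow> h (lam x) = (if x = e then 1 else 0)"
    by auto
  then have "\<exists>h. h \<in> hom G integer_group \<and> (\<forall>x\<in>E. h (lam x) = (if x = e then 1 else 0))"
    by blast
  from someI_ex[OF this] show "expo e \<in> hom G integer_group"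
    "x \<in> E \<Longrightarrow> expo e (lam x) = (if x = e then 1 else 0)"
    unfolding expo_def by blast+
qed

lemma expo_mult [simp]:
  "g \<in> carrier G \<Longrightarrow> h \<in> carrier G \<Longrightarrow> expo e (g \<otimes> h) = expo e g + expo e h"
  using expo_hom[of e] by (simp add: hom_def)

lemma expo_one [simp]: "expo e \<one> = 0"
  using expo_mult[of \<one> \<one> e] by simp

lemma expo_inv [simp]: "g \<in> carrier G \<Longrightarrow> expo e (inv g) = - expo e g"
proof -
  assume g: "g \<in> carrier G"
  then have "expo e g + expo e (inv g) = 0"
    by (simp flip: expo_mult)
  then show ?thesis by linarith
qed

lemma expo_pow [simp]:
  "g \<in> carrier G \<Longrightarrow> expo e (g [^] (n::nat)) = int n * expo e g"
  by (induction n) (simp_all add: algebra_simps)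

lemma expo_int_pow [simp]:
  "g \<in> carrier G \<Longrightarrow> expo e (g [^] (k::int)) = k * expo e g"
  by (cases k rule: int_cases2) (simp_all add: int_pow_int int_pow_neg)

lemma letter_commute:
  assumes "fst c \<in> E" "g \<in> carrier G" "lam (fst c) \<otimes> g = g \<otimes> lam (fst c)"
  shows "letter c \<otimes> g = g \<otimes> letter c"
  using assms commute_conj(3)[of "lam (fst c)" g] by (simp add: letter_def)

section \<open>Links and standard parabolic subgroups\<close>

definition lk :: "'e \<Rightarrow> 'e set" where "lk b = {c \<in> E. adj b c}"

definition par :: "'e set \<Rightarrow> 'a set" where "par T = generate G (lam ` (T \<inter> E))"

lemma par_subgroup: "subgroup (par T) G"
  unfolding par_def by (rule generate_is_subgroup) auto

lemma par_closed [intro]: "g \<in> par T \<Longrightarrow> g \<in> carrier G"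
  using subgroup.mem_carrier[OF par_subgroup] .

lemma par_one [simp, intro]: "\<one> \<in> par T"
  using subgroup.one_closed[OF par_subgroup] .

lemma par_mult [intro]: "g \<in> par T \<Longrightarrow> h \<in> par T \<Longrightarrow> g \<otimes> h \<in> par T"
  using subgroup.m_closed[OF par_subgroup] .

lemma par_inv [intro]: "g \<in> par T \<Longrightarrow> inv g \<in> par T"
  using subgroup.m_inv_closed[OF par_subgroup] .

lemma par_letter [intro]: "fst c \<in> T \<Longrightarrow> fst c \<in> E \<Longrightarrow> letter c \<in> par T"
  by (auto simp: letter_def par_def intro: generate.incl generate.inv)

lemma par_lam [intro]: "e \<in> T \<Longrightarrow> e \<in> E \<Longrightarrow> lam e \<in> par T"
  by (auto simp: par_def intro: generate.incl)

lemma par_ev: "w \<in> gwords (T \<inter> E) \<Longrightarrow> ev w \<in> par T"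
  by (induction w) auto

lemma par_word:
  assumes "g \<in> par T"
  obtains w where "w \<in> gwords (T \<inter> E)" "ev w = g"
proof -
  have "\<exists>w \<in> gwords (T \<inter> E). ev w = g"
    using assms unfolding par_def
  proof (induction rule: generate.induct)
    case one
    then show ?case by (intro bexI[of _ "[]"]) auto
  next
    case (incl h)
    then obtain e where "e \<in> T \<inter> E" "h = lam e" by auto
    then show ?case by (intro bexI[of _ "[(e, True)]"]) (auto simp: letter_def)
  next
    case (inv h)
    then obtain e where "e \<in> T \<inter> E" "h = lam e" by auto
    then show ?case by (intro bexI[of _ "[(e, False)]"]) (auto simp: letter_def)
  next
    case (eng h1 h2)
    then obtain u v where "u \<in> gwords (T \<inter> E)" "ev u = h1" "v \<in> gwords (T \<inter> E)" "ev v = h2" by auto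
    moreover from this have "u \<in> gwords E" "v \<in> gwords E" by (auto elim: gwords_mono)
    ultimately show ?case by (intro bexI[of _ "u @ v"]) auto
  qed
  then show thesis using that by blast
qed

lemma par_commute:
  assumes "b \<in> E" "g \<in> par T" "\<And>c. c \<in> T \<Longrightarrow> c \<in> E \<Longrightarrow> c = b \<or> adj b c"
  shows "lam b \<otimes> g = g \<otimes> lam b"
proof -
  obtain w where "w \<in> gwords (T \<inter> E)" "ev w = g" using par_word[OF assms(2)] .
  moreover have "lam b \<otimes> ev w = ev w \<otimes> lam b" if "w \<in> gwords (T \<inter> E)" for w
    using that
  proof (induction w)
    case Nil
    then show ?case using assms by simp
  next
    case (Cons c w)
    have w: "w \<in> gwords E" and c: "fst c \<in> T" "fst c \<in> E" using Cons.prems by (auto elim: gwords_mono)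
    have "lam (fst c) \<otimes> lam b = lam b \<otimes> lam (fst c)"
      using assms(1,3) c lam_commute by metis
    then have "letter c \<otimes> lam b = lam b \<otimes> letter c"
      using c assms(1) by (simp add: letter_commute)
    then have "lam b \<otimes> (letter c \<otimes> ev w) = letter c \<otimes> (lam b \<otimes> ev w)"
      using assms(1) c(2) w by (simp flip: m_assoc)
    also have "\<dots> = letter c \<otimes> ev w \<otimes> lam b"
      using Cons assms(1) c w by (simp add: m_assoc)
    finally show ?case by simp
  qed
  ultimately show ?thesis by blast
qed

lemma expo_par:
  assumes "g \<in> par T" "e \<notin> T"
  shows "expo e g = 0"
proof -
  obtain w where "w \<in> gwords (T \<inter> E)" "ev w = g" using par_word[OF assms(1)] .
  moreover have "expo e (ev w) = 0" if "w \<in> gwords (T \<inter> E)" for w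
    using that
  proof (induction w)
    case (Cons c w)
    then have "w \<in> gwords E" "fst c \<in> E" "fst c \<noteq> e" using assms(2) by (auto elim: gwords_mono)
    with Cons show ?case by (auto simp: letter_def expo_lam)
  qed simp
  ultimately show ?thesis by blast
qed

section \<open>Walls and the action on them\<close>

text \<open>The hyperplane dual to the edge from \<open>g\<close> to
  \<open>g \<otimes> lam b\<close> in the universal cover of the Salvetti complex: the parallel
  edges are those of type \<open>b\<close> starting in this coset. The tag \<open>b\<close> is kept
  because links of different vertices may coincide.\<close>

definition wall :: "'e \<Rightarrow> 'a \<Rightarrow> 'e \<times> 'a set"
  where "wall b g = (b, l_coset G g (par (lk b)))"

definition act :: "'a \<Rightarrow> 'e \<times> 'a set \<Rightarrow> 'e \<times> 'a set"
  where "act g K = (fst K, l_coset G g (snd K))"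

definition Walls :: "('e \<times> 'a set) set"
  where "Walls = {wall b g | b g. b \<in> E \<and> g \<in> carrier G}"

text \<open>The wall between \<one> and \<open>letter c\<close>. A negative letter runs along its
  edge backwards, so the edge starts at \<open>inv (lam (fst c))\<close>.\<close>

definition edge_wall :: "'e \<times> bool \<Rightarrow> 'e \<times> 'a set"
  where "edge_wall c = wall (fst c) (if snd c then \<one> else inv (lam (fst c)))"

lemma fst_wall [simp]: "fst (wall b g) = b"
  and fst_act [simp]: "fst (act g K) = fst K"
  and fst_edge_wall [simp]: "fst (edge_wall c) = fst c"
  by (simp_all add: wall_def act_def edge_wall_def)

lemma wall_eq_iff:
  assumes "g \<in> carrier G" "h \<in> carrier G"
  shows "wall b g = wall c h \<longleftrightarrow> b = c \<and> inv g \<otimes> h \<in> par (lk b)"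
  using l_coset_eq_iff[OF par_subgroup assms] by (auto simp: wall_def)

lemma act_wall [simp]: "g \<in> carrier G \<Longrightarrow> h \<in> carrier G \<Longrightarrow> act g (wall b h) = wall b (g \<otimes> h)"
  by (simp add: act_def wall_def lcos_m_assoc[OF subgroup.subset[OF par_subgroup]])

lemma WallsE:
  assumes "K \<in> Walls"
  obtains b g where "b \<in> E" "g \<in> carrier G" "K = wall b g"
  using assms by (auto simp: Walls_def)

lemma wall_in_Walls [simp, intro]: "b \<in> E \<Longrightarrow> g \<in> carrier G \<Longrightarrow> wall b g \<in> Walls"
  by (auto simp: Walls_def)

lemma edge_wall_in_Walls [simp, intro]: "fst c \<in> E \<Longrightarrow> edge_wall c \<in> Walls"
  by (auto simp: edge_wall_def)

lemma act_in_Walls [simp, intro]: "g \<in> carrier G \<Longrightarrow> K \<in> Walls \<Longrightarrow> act g K \<in> Walls"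
  by (auto elim!: WallsE)

lemma fst_Walls: "K \<in> Walls \<Longrightarrow> fst K \<in> E"
  by (auto elim!: WallsE)

lemma act_act: "g \<in> carrier G \<Longrightarrow> h \<in> carrier G \<Longrightarrow> K \<in> Walls \<Longrightarrow> act g (act h K) = act (g \<otimes> h) K"
  by (auto elim!: WallsE simp: m_assoc)

lemma act_one [simp]: "K \<in> Walls \<Longrightarrow> act \<one> K = K"
  by (auto elim!: WallsE)

lemma act_inv_cancel [simp]:
  "g \<in> carrier G \<Longrightarrow> K \<in> Walls \<Longrightarrow> act (inv g) (act g K) = K"
  "g \<in> carrier G \<Longrightarrow> K \<in> Walls \<Longrightarrow> act g (act (inv g) K) = K"
  by (simp_all add: act_act)

lemma act_eq_iff:
  "g \<in> carrier G \<Longrightarrow> K \<in> Walls \<Longrightarrow> L \<in> Walls \<Longrightarrow> act (inv g) K = L \<longleftrightarrow> K = act g L"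
  by (metis act_inv_cancel)

lemma act_inj: "g \<in> carrier G \<Longrightarrow> K \<in> Walls \<Longrightarrow> L \<in> Walls \<Longrightarrow> act g K = act g L \<longleftrightarrow> K = L"
  by (metis act_inv_cancel(1))

lemma edge_wall_flip: "fst c \<in> E \<Longrightarrow> act (letter c) (edge_wall (fst c, \<not> snd c)) = edge_wall c"
  by (simp add: edge_wall_def letter_def)

section \<open>Crossing parity and separating walls\<close>

primrec crossed :: "'e gword \<Rightarrow> ('e \<times> 'a set) list" where
  "crossed [] = []"
| "crossed (c # w) = edge_wall c # map (act (letter c)) (crossed w)"

text \<open>The parity of the number of crossings of \<open>K\<close> by the path of
  \<open>w\<close> from \<one>; after the first letter, the rest of the path is moved back to
  \<one>.\<close>

primrec side :: "'e gword \<Rightarrow> 'e \<times> 'a set \<Rightarrow> bool" where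
  "side [] K = False"
| "side (c # w) K = ((K = edge_wall c) \<noteq> side w (act (inv (letter c)) K))"

lemma side_append:
  "u \<in> gwords E \<Longrightarrow> v \<in> gwords E \<Longrightarrow> K \<in> Walls \<Longrightarrow>
    side (u @ v) K = (side u K \<noteq> side v (act (inv (ev u)) K))"
proof (induction u arbitrary: K)
  case (Cons c u)
  then show ?case by (auto simp: act_act inv_mult_group)
qed simp

text \<open>A cancelling pair crosses one wall twice, and opposite edges of a commuting square are
  dual to the same wall. Hence every wall has two well-defined sides.\<close>

lemma side_pres_rel:
  assumes "(u, v) \<in> pres_rel E (raag_rels E adj)" "K \<in> Walls"
  shows "side u K = side v K"
  using assms
proof (induction arbitrary: K rule: pres_rel.induct)
  case (append u u' v v')
  then have gw: "u \<in> gwords E" "u' \<in> gwords E" "v \<in> gwords E" "v' \<in> gwords E"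
    by (auto dest: pres_rel_gwords)
  then have "ev u = ev u'" using append ev_eq_iff by blast
  then show ?case using append gw by (simp add: side_append)
next
  case (cancel x b)
  then show ?case
    using act_eq_iff[of "letter (x, b)" K "edge_wall (x, \<not> b)"] edge_wall_flip[of "(x, b)"]
    by auto
next
  case (defining u v)
  then obtain x y where xy: "u = [(x, True), (y, True)]" "v = [(y, True), (x, True)]"
    "x \<in> E" "y \<in> E" "adj x y" by (auto simp: raag_rels_def)
  have "lam x \<in> par (lk y)" "lam y \<in> par (lk x)"
    using xy adj_sym by (auto simp: lk_def)
  then have "wall y (lam x) = wall y \<one>" "wall x (lam y) = wall x \<one>"
    using xy by (auto simp: wall_eq_iff)
  then show ?case
    using xy defining.prems by (auto simp: edge_wall_def letter_def act_eq_iff)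
qed auto

text \<open>The walls separating \<^term>\<open>\<one>\<close> from \<open>g\<close>; the walls separating \<open>g\<close> from \<open>h\<close> are those in
  exactly one of \<open>sep g\<close> and \<open>sep h\<close>.\<close>

definition sep :: "'a \<Rightarrow> ('e \<times> 'a set) set"
  where "sep g = {K \<in> Walls. side (SOME w. w \<in> gwords E \<and> ev w = g) K}"

lemma sep_ev:
  assumes "w \<in> gwords E"
  shows "K \<in> sep (ev w) \<longleftrightarrow> K \<in> Walls \<and> side w K"
proof -
  define v where "v = (SOME v. v \<in> gwords E \<and> ev v = ev w)"
  have "v \<in> gwords E \<and> ev v = ev w"
    unfolding v_def by (rule someI_ex) (use assms in blast)
  then have "(v, w) \<in> pres_rel E (raag_rels E adj)"
    using ev_eq_iff assms by blast
  then show ?thesis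
    using side_pres_rel[of v w K] by (simp add: sep_def flip: v_def) blast
qed

lemma sep_Walls: "K \<in> sep g \<Longrightarrow> K \<in> Walls"
  by (simp add: sep_def)

text \<open>Cocycle identity: a path to \<open>g \<otimes> h\<close> is a path to \<open>g\<close>
  followed by the \<open>g\<close>-translate of a path to \<open>h\<close>.\<close>

lemma sep_mult:
  assumes "g \<in> carrier G" "h \<in> carrier G" "K \<in> Walls"
  shows "K \<in> sep (g \<otimes> h) \<longleftrightarrow> (K \<in> sep g) \<noteq> (act (inv g) K \<in> sep h)"
proof -
  obtain u v where "u \<in> gwords E" "g = ev u" "v \<in> gwords E" "h = ev v"
    using assms word_exists by metis
  then show ?thesis
    using sep_ev[of "u @ v" K] assms by (simp add: sep_ev side_append)
qed

lemma sep_one [simp]: "sep \<one> = {}"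
  using sep_ev[of "[]"] by auto

lemma sep_letter: "fst c \<in> E \<Longrightarrow> sep (letter c) = {edge_wall c}"
  using sep_ev[of "[c]"] by (simp add: set_eq_iff del: split_paired_All) blast

lemma sep_inv:
  assumes "g \<in> carrier G" "K \<in> Walls"
  shows "K \<in> sep (inv g) \<longleftrightarrow> act g K \<in> sep g"
  using sep_mult[of "inv g" g K] assms by simp

lemma crossed_Walls: "w \<in> gwords E \<Longrightarrow> K \<in> set (crossed w) \<Longrightarrow> K \<in> Walls"
  by (induction w arbitrary: K) auto

lemma crossed_append:
  "u \<in> gwords E \<Longrightarrow> v \<in> gwords E \<Longrightarrow> crossed (u @ v) = crossed u @ map (act (ev u)) (crossed v)"
proof (induction u)
  case Nil
  then show ?case by (auto simp: crossed_Walls map_idI)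
next
  case (Cons c u)
  then show ?case by (auto simp: act_act crossed_Walls)
qed

lemma length_crossed [simp]: "length (crossed w) = length w"
  by (induction w) auto

lemma side_imp_crossed: "w \<in> gwords E \<Longrightarrow> K \<in> Walls \<Longrightarrow> side w K \<Longrightarrow> K \<in> set (crossed w)"
proof (induction w arbitrary: K)
  case (Cons c w)
  show ?case
  proof (cases "K = edge_wall c")
    case False
    then have "act (inv (letter c)) K \<in> set (crossed w)" using Cons by auto
    then have "act (letter c) (act (inv (letter c)) K) \<in> act (letter c) ` set (crossed w)" by blast
    then show ?thesis using Cons by simp
  qed simp
qed simp

lemma sep_subset_crossed: "w \<in> gwords E \<Longrightarrow> sep (ev w) \<subseteq> set (crossed w)"
  using side_imp_crossed sep_ev by auto

lemma finite_sep [simp, intro]: "g \<in> carrier G \<Longrightarrow> finite (sep g)"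
  using word_exists sep_subset_crossed by (metis List.finite_set finite_subset)

lemma distinct_crossed_sep:
  "w \<in> gwords E \<Longrightarrow> distinct (crossed w) \<Longrightarrow> sep (ev w) = set (crossed w)"
proof (induction w)
  case (Cons c w)
  then have w: "w \<in> gwords E" and c: "fst c \<in> E" by auto
  have d: "distinct (crossed w)" using Cons.prems by (simp add: distinct_map)
  have IH: "sep (ev w) = set (crossed w)" using Cons.IH w d by blast
  show ?case
  proof (intro equalityI subsetI)
    fix K assume "K \<in> set (crossed (c # w))"
    moreover from this have K: "K \<in> Walls" by (rule crossed_Walls[OF Cons.prems(1)])
    moreover have "act (inv (letter c)) K \<in> sep (ev w) \<longleftrightarrow> K \<in> act (letter c) ` set (crossed w)"
      unfolding IH using K c crossed_Walls[OF w]
      by (force simp: image_iff)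
    ultimately show "K \<in> sep (ev (c # w))"
      using Cons.prems(2) c w by (auto simp: sep_mult sep_letter)
  qed (use sep_subset_crossed[OF Cons.prems(1)] in blast)
qed simp

lemma fst_crossed: "map fst (crossed w) = map fst w"
  by (induction w) (auto simp: comp_def)

text \<open>Convexity of \<open>par T\<close>: a path spelled in \<open>T\<close> stays inside, so
  every wall it crosses is dual to an edge based there.\<close>

lemma fst_sep_par:
  assumes "g \<in> par T" "K \<in> sep g"
  shows "\<exists>v h. v \<in> T \<and> v \<in> E \<and> h \<in> par T \<and> K = wall v h"
proof -
  obtain w where w: "w \<in> gwords (T \<inter> E)" "ev w = g" using par_word[OF assms(1)] .
  have *: "\<exists>v h. v \<in> T \<and> v \<in> E \<and> h \<in> par T \<and> K = wall v h"
    if "w \<in> gwords (T \<inter> E)" "K \<in> set (crossed w)" for w K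
    using that
  proof (induction w arbitrary: K)
    case (Cons c w)
    then have c: "fst c \<in> T" "fst c \<in> E" by auto
    consider "K = edge_wall c" | L where "L \<in> set (crossed w)" "K = act (letter c) L"
      using Cons by auto
    then show ?case
    proof cases
      case 1
      moreover have "(if snd c then \<one> else inv (lam (fst c))) \<in> par T" using c by auto
      ultimately show ?thesis using c unfolding edge_wall_def by blast
    next
      case 2
      then obtain v h where "v \<in> T" "v \<in> E" "h \<in> par T" "L = wall v h"
        using Cons.IH[of L] Cons.prems(1) by auto
      then show ?thesis using 2 c par_closed[of h] by (intro exI[of _ v] exI[of _ "letter c \<otimes> h"]) auto
    qed
  qed simp
  show ?thesis
    using w assms(2) sep_subset_crossed[of w] gwords_mono[OF w(1), of E] by (intro *[of w]) auto
qed

section \<open>Repeated crossings and reduced words\<close>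

lemma crossed_split:
  assumes "w \<in> gwords E" "K \<in> set (crossed w)"
  obtains m d q where "w = m @ d # q" "K = act (ev m) (edge_wall d)"
proof -
  have "\<exists>m d q. w = m @ d # q \<and> K = act (ev m) (edge_wall d)"
    using assms
  proof (induction w arbitrary: K)
    case (Cons c w)
    consider "K = edge_wall c" | L where "L \<in> set (crossed w)" "K = act (letter c) L"
      using Cons by auto
    then show ?case
    proof cases
      case 1
      then show ?thesis using Cons.prems by (intro exI[of _ "[]"] exI[of _ c] exI[of _ w]) auto
    next
      case 2
      then obtain m d q where mdq: "w = m @ d # q" "L = act (ev m) (edge_wall d)"
        using Cons.IH[of L] Cons.prems(1) by (auto simp del: split_paired_Ex)
      then show ?thesis using 2 Cons.prems
        by (intro exI[of _ "c # m"] exI[of _ d] exI[of _ q]) (auto simp: act_act)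
    qed
  qed simp
  then show thesis using that by blast
qed

text \<open>A path that crosses no wall twice until its last edge re-crosses the wall of its first one
  runs parallel to that wall in between.\<close>

lemma coincidence:
  assumes "fst c \<in> E" "fst d \<in> E" "m \<in> gwords E" "distinct (crossed (c # m))"
    and eq: "edge_wall c = act (ev (c # m)) (edge_wall d)"
  shows "d = (fst c, \<not> snd c)" "ev m \<in> par (lk (fst c))" "\<And>e. e \<in> set m \<Longrightarrow> fst e \<in> lk (fst c)"
proof -
  define b where "b = fst c"
  have b: "b \<in> E" "fst d = b" "fst c = b"
    using assms(1) arg_cong[OF eq, of fst] by (auto simp: b_def)
  have m: "ev m \<in> carrier G" using assms(3) by auto
  have b_lk: "b \<notin> lk b" by (simp add: lk_def adj_irrefl)
  have par_type: "fst K \<noteq> b" if "g \<in> par (lk b)" "K \<in> sep g" for g K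
    using fst_sep_par[OF that] b_lk by auto
  have sep_cm: "edge_wall c \<in> sep (letter c \<otimes> ev m)"
    using distinct_crossed_sep[of "c # m"] assms by auto
  have comm: "lam b \<otimes> g = g \<otimes> lam b" if "g \<in> par (lk b)" for g
    by (rule par_commute[OF b(1) that]) (auto simp: lk_def)
  have conj: "inv (lam b) \<otimes> g \<otimes> lam b = g" "lam b \<otimes> g \<otimes> inv (lam b) = g" if "g \<in> par (lk b)" for g
    using commute_conj[OF _ _ comm[OF that]] b par_closed[OF that] by auto
  show d: "d = (fst c, \<not> snd c)"
  proof (rule ccontr)
    \<comment> \<open>With equal signs \<open>letter c \<otimes> ev m\<close> would lie in
      \<open>par (lk b)\<close>, which only walls with types in the link separate from \<one>; but
      \<open>edge_wall c\<close> separates it and has type \<open>b\<close>.\<close>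
    assume "d \<noteq> (fst c, \<not> snd c)"
    then have "d = c" using b by (cases c; cases d) auto
    then have "letter c \<otimes> ev m \<in> par (lk b)"
    proof (cases "snd c")
      case True
      then show ?thesis
        using eq b m \<open>d = c\<close> by (simp add: edge_wall_def letter_def wall_eq_iff)
    next
      case False
      then have *: "lam b \<otimes> (inv (lam b) \<otimes> ev m \<otimes> inv (lam b)) \<in> par (lk b)"
        using eq b m \<open>d = c\<close> by (simp add: edge_wall_def letter_def wall_eq_iff)
      have "inv (lam b) \<otimes> ev m
          = inv (lam b) \<otimes> (lam b \<otimes> (inv (lam b) \<otimes> ev m \<otimes> inv (lam b))) \<otimes> lam b"
        using b m by (simp add: word_simps)
      also have "\<dots> \<in> par (lk b)"
        using conj(1)[OF *] * by simp
      finally show ?thesis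
        using b False by (simp add: letter_def)
    qed
    from par_type[OF this sep_cm] b show False by simp
  qed
  show m_par: "ev m \<in> par (lk (fst c))"
  \<comment> \<open>The sign of \<open>c\<close> decides at which end of the edge the coset is read
    off; in the positive case a conjugation by \<open>lam b\<close>, trivial on
    \<open>par (lk b)\<close>, has to be undone.\<close>
  proof (cases "snd c")
    case True
    then have *: "lam b \<otimes> ev m \<otimes> inv (lam b) \<in> par (lk b)"
      using eq b m d by (simp add: edge_wall_def letter_def wall_eq_iff)
    from conj(1)[OF this] this show ?thesis
      using b m by (simp add: word_simps)
  next
    case False
    then have "lam b \<otimes> (inv (lam b) \<otimes> ev m) \<in> par (lk b)"
      using eq b m d by (simp add: edge_wall_def letter_def wall_eq_iff)
    then show ?thesis using b m by (simp add: inv_cancel)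
  qed
  have "distinct (crossed m)" using assms(4) by (simp add: distinct_map)
  then have "sep (ev m) = set (crossed m)" using distinct_crossed_sep assms(3) by blast
  moreover have "fst ` set (crossed m) = fst ` set m"
    using fst_crossed[of m] by (metis set_map)
  ultimately show "fst e \<in> lk (fst c)" if "e \<in> set m" for e
    using fst_sep_par[OF m_par] that by (metis (no_types, lifting) image_iff fst_wall)
qed

text \<open>The induction finds the shortest suffix with a repetition. Its first letter
  \<open>c\<close> is then involved, and cutting just before the second crossing leaves
  \<open>c # m\<close> free of repetitions.\<close>

lemma not_distinct_crossed:
  assumes "w \<in> gwords E" "\<not> distinct (crossed w)"
  obtains p c m d q where "w = p @ c # m @ d # q" "distinct (crossed (c # m))"
    "edge_wall c = act (ev (c # m)) (edge_wall d)"
proof -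
  have "\<exists>p c m d q. w = p @ c # m @ d # q \<and> distinct (crossed (c # m)) \<and>
    edge_wall c = act (ev (c # m)) (edge_wall d)"
    using assms
  proof (induction w)
    case (Cons c w)
    then have w: "w \<in> gwords E" and c: "fst c \<in> E" by auto
    show ?case
    proof (cases "distinct (crossed w)")
      case False
      then obtain p c' m d q where "w = p @ c' # m @ d # q" "distinct (crossed (c' # m))"
        "edge_wall c' = act (ev (c' # m)) (edge_wall d)" using Cons w by blast
      then show ?thesis by (metis append_Cons)
    next
      case True
      have inj: "inj_on (act (letter c)) (set (crossed w))"
        using act_inj[of "letter c"] c crossed_Walls[OF w] by (auto simp: inj_on_def)
      then have "edge_wall c \<in> act (letter c) ` set (crossed w)"
        using Cons.prems(2) True by (auto simp: distinct_map)
      then obtain K where K: "K \<in> set (crossed w)" "edge_wall c = act (letter c) K" by auto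
      obtain m d q where mdq: "w = m @ d # q" "K = act (ev m) (edge_wall d)"
        using crossed_split[OF w K(1)] .
      have gw: "m \<in> gwords E" "fst d \<in> E" "d # q \<in> gwords E" using w mdq by auto
      have dw: "distinct (crossed m)" "K \<notin> set (crossed m)"
        using True gw unfolding mdq(1) crossed_append[OF gw(1,3)] by (auto simp: mdq(2))
      have "edge_wall c \<notin> act (letter c) ` set (crossed m)"
      proof
        assume "edge_wall c \<in> act (letter c) ` set (crossed m)"
        then obtain L where L: "L \<in> set (crossed m)" "act (letter c) K = act (letter c) L" using K by auto
        then have "K = L"
          using act_inj[of "letter c" K L] c crossed_Walls[OF gw(1)] crossed_Walls[OF w K(1)] by blast
        with L dw show False by blast
      qed
      moreover have "inj_on (act (letter c)) (set (crossed m))"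
        by (rule inj_on_subset[OF inj]) (use gw mdq(1) in \<open>auto simp: crossed_append\<close>)
      ultimately have "distinct (crossed (c # m))"
        using dw by (auto simp: distinct_map)
      moreover have "edge_wall c = act (ev (c # m)) (edge_wall d)"
        using K mdq gw c by (simp add: act_act)
      ultimately show ?thesis using mdq(1) by (metis append_Nil)
    qed
  qed simp
  then show thesis using that by blast
qed

text \<open>In a shortest spelling no wall is crossed twice: by \<open>coincidence\<close> the
  second crossing uses the inverse letter and \<open>c\<close> commutes with all in between, so both
  could be deleted. Word length is thus the number of separating walls.\<close>

lemma reduced_word_exists:
  assumes "g \<in> carrier G"
  obtains w where "w \<in> gwords E" "ev w = g" "distinct (crossed w)" "card (sep g) = length w"
proof -
  obtain w where w: "w \<in> gwords E" "ev w = g"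
    and min: "\<And>v. v \<in> gwords E \<Longrightarrow> ev v = g \<Longrightarrow> length w \<le> length v"
    using ex_has_least_nat[of "\<lambda>w. w \<in> gwords E \<and> ev w = g" _ length] word_exists[OF assms] by metis
  have "distinct (crossed w)"
  proof (rule ccontr)
    assume "\<not> distinct (crossed w)"
    from not_distinct_crossed[OF w(1) this] obtain p c m d q
      where pq: "w = p @ c # m @ d # q" "distinct (crossed (c # m))"
        "edge_wall c = act (ev (c # m)) (edge_wall d)" .
    then have gw: "p \<in> gwords E" "fst c \<in> E" "m \<in> gwords E" "fst d \<in> E" "q \<in> gwords E"
      using w by auto
    note co = coincidence[OF gw(2,4,3) pq(2,3)]
    have ld: "letter d = inv (letter c)" using co(1) letter_flip gw by simp
    have "lam (fst c) \<otimes> ev m = ev m \<otimes> lam (fst c)"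
      by (rule par_commute[OF gw(2) co(2)]) (auto simp: lk_def)
    then have "letter c \<otimes> ev m = ev m \<otimes> letter c"
      using gw(2,3) by (intro letter_commute) auto
    then have "letter c \<otimes> (ev m \<otimes> (inv (letter c) \<otimes> ev q)) = ev m \<otimes> ev q"
      using gw by (simp add: inv_cancel m_assoc flip: m_assoc[of "letter c" "ev m"])
    then have "ev (p @ m @ q) = g"
      using w(2) gw unfolding pq(1) by (simp add: ld)
    with min[of "p @ m @ q"] gw show False by (simp add: pq(1))
  qed
  moreover from this have "card (sep g) = length w"
    using distinct_crossed_sep[OF w(1)] w(2) distinct_card by fastforce
  ultimately show thesis using that w by blast
qed

lemma card_sep_le: "w \<in> gwords E \<Longrightarrow> card (sep (ev w)) \<le> length w"
  using card_mono[OF _ sep_subset_crossed] card_length[of "crossed w"] by fastforce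


section \<open>Separation by walls and centralisers\<close>

definition st :: "'e \<Rightarrow> 'e set" where "st b = insert b (lk b)"

lemma st_commute: "b \<in> E \<Longrightarrow> g \<in> par (st b) \<Longrightarrow> lam b \<otimes> g = g \<otimes> lam b"
  by (erule par_commute) (auto simp: st_def lk_def)

lemma st_sym: "a \<in> E \<Longrightarrow> b \<in> E \<Longrightarrow> a \<in> st b \<longleftrightarrow> b \<in> st a"
  by (auto simp: st_def lk_def dest: adj_sym)

text \<open>The conjugate of \<open>lam b\<close> depends on the wall alone because
  \<open>par (lk b)\<close> centralises \<open>lam b\<close>.\<close>

lemma wall_translation:
  assumes "b \<in> E" "g \<in> carrier G" "h \<in> carrier G" "wall b g = wall b h"
  shows "g \<otimes> lam b \<otimes> inv g = h \<otimes> lam b \<otimes> inv h"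
proof -
  define m where "m = inv g \<otimes> h"
  have m: "m \<in> par (lk b)" "h = g \<otimes> m"
    using assms by (auto simp: wall_eq_iff m_def inv_cancel)
  have "m \<otimes> lam b \<otimes> inv m = lam b"
    using par_commute[OF assms(1) m(1)] commute_conj(2)[of m "lam b"] m assms(1)
    by (auto simp: lk_def)
  then have "g \<otimes> (m \<otimes> lam b \<otimes> inv m) \<otimes> inv g = g \<otimes> lam b \<otimes> inv g" by simp
  then show ?thesis
    using assms par_closed[OF m(1)] by (simp add: m(2) word_simps)
qed

lemma edge_wall_translation:
  assumes "fst c \<in> E" "h \<in> carrier G" "edge_wall c = wall (fst c) h"
  shows "lam (fst c) \<otimes> h = h \<otimes> lam (fst c)"
proof -
  have "h \<otimes> lam (fst c) \<otimes> inv h = lam (fst c)"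
    using wall_translation[OF assms(1) _ assms(2), of "if snd c then \<one> else inv (lam (fst c))"] assms
    by (auto simp: edge_wall_def inv_cancel m_assoc split: if_splits)
  from arg_cong[OF this, of "\<lambda>z. z \<otimes> h"] assms show ?thesis
    by (simp add: m_assoc)
qed

text \<open>The stabiliser of \<open>wall v k\<close> is the conjugate of \<open>par (lk v)\<close>
  by \<open>k\<close>, and exponent sums do not see conjugation.\<close>

lemma fixed_wall_expo:
  assumes "K \<in> Walls" "g \<in> carrier G" "act g K = K" "e \<notin> lk (fst K)"
  shows "expo e g = 0"
proof -
  obtain v k where K: "v \<in> E" "k \<in> carrier G" "K = wall v k" using assms(1) by (rule WallsE)
  then have "inv (g \<otimes> k) \<otimes> k \<in> par (lk v)" using assms by (simp add: wall_eq_iff)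
  then have "expo e (inv (g \<otimes> k) \<otimes> k) = 0" by (rule expo_par) (use assms K in simp)
  then show ?thesis using K assms by simp
qed

text \<open>The letter \<open>c\<close> begins a reduced word for \<open>p\<close>. If its wall did
  not cut off the whole coset \<open>p \<otimes> par T\<close>, it would be crossed inside the
  coset, and \<open>letter c\<close> would commute with some \<open>p \<otimes> h\<close>; removing
  the letter would then stay in the coset and shorten \<open>p\<close>.\<close>

lemma gate:
  assumes p: "p \<in> carrier G" "p \<noteq> \<one>" and min: "\<And>s. s \<in> par T \<Longrightarrow> card (sep p) \<le> card (sep (p \<otimes> s))"
  obtains c where "fst c \<in> E" "card (sep (inv (letter c) \<otimes> p)) < card (sep p)"
    "\<And>s. s \<in> par T \<Longrightarrow> edge_wall c \<in> sep (p \<otimes> s)"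
proof -
  obtain w where w: "w \<in> gwords E" "ev w = p" "distinct (crossed w)" "card (sep p) = length w"
    using reduced_word_exists[OF p(1)] .
  from w(2) p(2) obtain c w' where cw: "w = c # w'" by (cases w) auto
  have c: "fst c \<in> E" and w': "w' \<in> gwords E" using w cw by auto
  have pc: "inv (letter c) \<otimes> p = ev w'" using w(2) c w' by (auto simp: cw inv_cancel)
  have less: "card (sep (inv (letter c) \<otimes> p)) < card (sep p)"
    using card_sep_le[OF w'] w(4) by (simp add: cw pc)
  have K: "edge_wall c \<in> sep p"
    using distinct_crossed_sep[OF w(1,3)] w(2) by (auto simp: cw)
  have "edge_wall c \<in> sep (p \<otimes> s)" if s: "s \<in> par T" for s
  proof (rule ccontr)
    assume "edge_wall c \<notin> sep (p \<otimes> s)"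
    then have "act (inv p) (edge_wall c) \<in> sep s"
      using K p c par_closed[OF s] by (simp add: sep_mult)
    from fst_sep_par[OF s this] obtain v h where
      v: "v \<in> T" "v \<in> E" "h \<in> par T" "act (inv p) (edge_wall c) = wall v h" by blast
    then have hv: "h \<in> carrier G" "v = fst c"
      by (blast, metis fst_act fst_edge_wall fst_wall)
    then have eq: "edge_wall c = wall v (p \<otimes> h)" using act_eq_iff[of p "edge_wall c" "wall v h"] p c v by simp
    have "letter c \<otimes> (p \<otimes> h) = p \<otimes> h \<otimes> letter c"
      by (rule letter_commute[OF c]) (use p hv c eq edge_wall_translation[of c "p \<otimes> h"] in auto)
    then have comm: "inv (letter c) \<otimes> (p \<otimes> h) = p \<otimes> h \<otimes> inv (letter c)"
      using commute_conj(3)[of "letter c" "p \<otimes> h"] p hv c by simp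
    have "inv (letter c) \<otimes> p = inv (letter c) \<otimes> (p \<otimes> h) \<otimes> inv h"
      using p hv c by (simp add: m_assoc)
    also have "\<dots> = p \<otimes> (h \<otimes> inv (letter c) \<otimes> inv h)"
      unfolding comm using p hv c by (simp add: m_assoc)
    finally have eq: "inv (letter c) \<otimes> p = p \<otimes> (h \<otimes> inv (letter c) \<otimes> inv h)" .
    have "h \<otimes> inv (letter c) \<otimes> inv h \<in> par T"
      using v hv c by blast
    from min[OF this] less show False by (simp add: eq)
  qed
  with c less show thesis using that by blast
qed

text \<open>For a shortest connection \<open>p\<close> between \<open>par T\<close> and the coset of
  \<open>h\<close>, the \<open>gate\<close> wall cuts off the far coset. Its type avoids
  \<open>T\<close>, since otherwise the connection could be shortened at its near end; so it does
  not cut \<open>par T\<close> either.\<close>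

lemma separating_wall:
  assumes h: "h \<in> carrier G" and disjoint: "\<And>t. t \<in> par U \<Longrightarrow> h \<otimes> t \<notin> par T"
  obtains K where "K \<in> Walls" "fst K \<notin> T" "\<And>t. t \<in> par U \<Longrightarrow> K \<in> sep (h \<otimes> t)"
proof -
  obtain s t where st: "s \<in> par T" "t \<in> par U"
    and min: "\<And>s' t'. s' \<in> par T \<Longrightarrow> t' \<in> par U \<Longrightarrow> card (sep (s \<otimes> h \<otimes> t)) \<le> card (sep (s' \<otimes> h \<otimes> t'))"
    using ex_has_least_nat[of "\<lambda>st. fst st \<in> par T \<and> snd st \<in> par U" "(\<one>, \<one>)"
        "\<lambda>st. card (sep (fst st \<otimes> h \<otimes> snd st))"]
    by (metis fst_conv snd_conv par_one)
  define p where "p = s \<otimes> h \<otimes> t"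
  have car: "s \<in> carrier G" "t \<in> carrier G" "p \<in> carrier G" using st h by (auto simp: p_def)
  have "p \<noteq> \<one>"
  proof
    assume "p = \<one>"
    from arg_cong[OF this, of "\<lambda>z. inv s \<otimes> z"] have "h \<otimes> t = inv s"
      using car h by (simp add: p_def m_assoc inv_cancel)
    then show False using disjoint[OF st(2)] par_inv[OF st(1)] by simp
  qed
  moreover have "card (sep p) \<le> card (sep (p \<otimes> t'))" if "t' \<in> par U" for t'
    using min[OF st(1) par_mult[OF st(2) that]] car h par_closed[OF that] by (simp add: p_def m_assoc)
  ultimately obtain c where c: "fst c \<in> E" "card (sep (inv (letter c) \<otimes> p)) < card (sep p)"
    "\<And>t'. t' \<in> par U \<Longrightarrow> edge_wall c \<in> sep (p \<otimes> t')"
    using gate[OF car(3)] by blast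
  have T: "fst c \<notin> T"
  proof
    assume "fst c \<in> T"
    then have "inv (letter c) \<otimes> s \<in> par T" using c st by blast
    from min[OF this st(2)] c car h show False by (simp add: p_def m_assoc)
  qed
  have "act (inv s) (edge_wall c) \<in> sep (h \<otimes> t')" if t': "t' \<in> par U" for t'
  proof -
    have "inv t \<otimes> t' \<in> par U" using st t' by blast
    then have "edge_wall c \<in> sep (p \<otimes> (inv t \<otimes> t'))" by (rule c(3))
    also have "p \<otimes> (inv t \<otimes> t') = s \<otimes> (h \<otimes> t')"
      using car h par_closed[OF t'] by (simp add: p_def m_assoc inv_cancel)
    finally have "edge_wall c \<in> sep (s \<otimes> (h \<otimes> t'))" .
    moreover have "edge_wall c \<notin> sep s"
      using fst_sep_par[OF st(1), of "edge_wall c"] T by (metis fst_edge_wall fst_wall)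
    ultimately show ?thesis
      using car h c par_closed[OF t'] by (simp add: sep_mult)
  qed
  then show thesis using that[of "act (inv s) (edge_wall c)"] c T car by simp
qed

text \<open>An element stabilising both \<open>par T\<close> and the disjoint coset \<open>h par U\<close> permutes the finitely many
  walls separating them, hence a power of it fixes one of these walls.\<close>

lemma common_stabiliser:
  assumes h: "h \<in> carrier G" and disjoint: "\<And>t. t \<in> par U \<Longrightarrow> h \<otimes> t \<notin> par T"
  obtains v where "v \<in> E" "v \<notin> T"
    "\<And>c e. c \<in> par T \<Longrightarrow> inv h \<otimes> c \<otimes> h \<in> par U \<Longrightarrow> expo e c \<noteq> 0 \<Longrightarrow> e \<in> lk v"
proof -
  obtain K where K: "K \<in> Walls" "fst K \<notin> T" "\<And>t. t \<in> par U \<Longrightarrow> K \<in> sep (h \<otimes> t)"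
    using separating_wall[OF assms] by blast
  define W where "W = {K \<in> Walls. fst K \<notin> T \<and> (\<forall>t\<in>par U. K \<in> sep (h \<otimes> t))}"
  have "W \<subseteq> sep h"
  proof
    fix L assume "L \<in> W"
    then have "L \<in> sep (h \<otimes> \<one>)" unfolding W_def using par_one by blast
    then show "L \<in> sep h" using h by simp
  qed
  then have fin: "finite W" using finite_sep[OF h] by (rule finite_subset)
  have *: "e \<in> lk (fst K)" if c: "c \<in> par T" "inv h \<otimes> c \<otimes> h \<in> par U" "expo e c \<noteq> 0" for c e
  proof (rule ccontr)
    assume e: "e \<notin> lk (fst K)"
    have cc: "c \<in> carrier G" using c by auto
    have step: "act c L \<in> W" if L: "L \<in> W" for L
    proof -
      have "act c L \<in> sep (h \<otimes> t)" if t: "t \<in> par U" for t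
      proof -
        have tc: "t \<in> carrier G" using t by auto
        \<comment> \<open>Chosen so that \<open>c\<close> carries \<open>h \<otimes> t'\<close> to
          \<open>h \<otimes> t\<close>; it stays in \<open>par U\<close> because
          \<open>inv h \<otimes> c \<otimes> h\<close> lies there.\<close>
        define t' where "t' = inv (inv h \<otimes> c \<otimes> h) \<otimes> t"
        have t': "t' \<in> par U" using c t by (auto simp: t'_def)
        then have "L \<in> sep (h \<otimes> t')" using L by (simp add: W_def)
        moreover have "act c L \<notin> sep c"
        proof
          assume "act c L \<in> sep c"
          from fst_sep_par[OF c(1) this] have "fst (act c L) \<in> T" by (metis fst_wall)
          then show False using L by (simp add: W_def)
        qed
        moreover have "h \<otimes> t = c \<otimes> (h \<otimes> t')"
          using h cc tc by (simp add: t'_def word_simps)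
        ultimately show ?thesis
          using L cc h par_closed[OF t'] by (simp add: W_def sep_mult)
      qed
      then show ?thesis using L cc by (simp add: W_def)
    qed
    have pow: "act (c [^] (n::nat)) K \<in> W" for n
    proof (induction n)
      case 0
      then show ?case using K by (simp add: W_def)
    next
      case (Suc n)
      have "act (c [^] Suc n) K = act c (act (c [^] n) K)"
        using cc K(1) by (simp only: act_act nat_pow_Suc2 nat_pow_closed)
      with step[OF Suc] show ?case by simp
    qed
    have "\<not> inj (\<lambda>n::nat. act (c [^] n) K)"
    proof
      assume "inj (\<lambda>n::nat. act (c [^] n) K)"
      moreover have "finite (range (\<lambda>n::nat. act (c [^] n) K))"
        by (rule finite_subset[OF _ fin]) (use pow in blast)
      ultimately show False by (auto dest: finite_imageD)
    qed
    then obtain i j :: nat where ij: "i < j" "act (c [^] i) K = act (c [^] j) K"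
      using linorder_injI[of "\<lambda>n::nat. act (c [^] n) K"] by blast
    have "act (c [^] i) (act (c [^] (j - i)) K) = act (c [^] i) K"
      using ij(1) cc K(1) by (simp add: act_act nat_pow_mult ij(2))
    then have "act (c [^] (j - i)) K = K"
      using act_inj[of "c [^] i"] cc K(1) by simp
    from fixed_wall_expo[OF K(1) _ this e] cc c(3) ij(1) show False by simp
  qed
  show thesis by (rule that[OF fst_Walls[OF K(1)] K(2)]) (rule *)
qed

text \<open>Otherwise \<open>lam a\<close> stabilises \<open>par (st a)\<close> and a coset disjoint
  from it, and \<open>common_stabiliser\<close> puts \<open>a\<close> into the link of a vertex
  outside the star of \<open>a\<close>.\<close>

lemma centraliser_lam:
  assumes a: "a \<in> E" and g: "g \<in> carrier G" and comm: "g \<otimes> lam a = lam a \<otimes> g"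
  shows "g \<in> par (st a)"
proof (rule ccontr)
  assume *: "g \<notin> par (st a)"
  have "g \<otimes> t \<notin> par (st a)" if t: "t \<in> par (st a)" for t
  proof
    assume "g \<otimes> t \<in> par (st a)"
    then have "g \<otimes> t \<otimes> inv t \<in> par (st a)" using t by blast
    then show False using * g par_closed[OF t] by (simp add: m_assoc)
  qed
  from common_stabiliser[OF g this] obtain v where v: "v \<in> E" "v \<notin> st a"
    "\<And>c e. c \<in> par (st a) \<Longrightarrow> inv g \<otimes> c \<otimes> g \<in> par (st a) \<Longrightarrow> expo e c \<noteq> 0 \<Longrightarrow> e \<in> lk v"
    by blast
  have la: "lam a \<in> par (st a)" using a by (auto simp: st_def)
  have "inv g \<otimes> lam a \<otimes> g = lam a"
    using commute_conj(1)[OF g _ comm] a by simp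
  then have "a \<in> lk v" using v(3)[of "lam a" a] la a by (simp add: expo_lam)
  then show False using v a adj_sym by (auto simp: st_def lk_def)
qed

text \<open>By \<open>centraliser_lam\<close>, \<open>lam a\<close> stabilises the coset
  \<open>k \<otimes> par (st u)\<close> as well as \<open>par (st a)\<close>; if these were
  disjoint, the contradiction in the proof of \<open>centraliser_lam\<close> would recur.\<close>

lemma commuting_conjugates:
  assumes a: "a \<in> E" and u: "u \<in> E" and g: "g \<in> carrier G" and h: "h \<in> carrier G"
    and comm: "(g \<otimes> lam a \<otimes> inv g) \<otimes> (h \<otimes> lam u \<otimes> inv h) = (h \<otimes> lam u \<otimes> inv h) \<otimes> (g \<otimes> lam a \<otimes> inv g)"
  obtains s t where "s \<in> par (st a)" "t \<in> par (st u)" "g \<otimes> s = h \<otimes> t"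
proof -
  define k where "k = inv g \<otimes> h"
  have k: "k \<in> carrier G" using g h by (simp add: k_def)
  define d where "d = inv k \<otimes> lam a \<otimes> k"
  have "d \<otimes> lam u = inv h \<otimes> ((g \<otimes> lam a \<otimes> inv g) \<otimes> (h \<otimes> lam u \<otimes> inv h)) \<otimes> h"
    using g h a u by (simp add: d_def k_def word_simps)
  also have "\<dots> = lam u \<otimes> d"
    unfolding comm using g h a u by (simp add: d_def k_def word_simps)
  finally have d: "d \<in> par (st u)"
    using k a u by (intro centraliser_lam) (auto simp: d_def)
  have "\<exists>t\<in>par (st u). k \<otimes> t \<in> par (st a)"
  proof (rule ccontr)
    assume "\<not> ?thesis"
    then have "\<And>t. t \<in> par (st u) \<Longrightarrow> k \<otimes> t \<notin> par (st a)" by blast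
    from common_stabiliser[OF k this] obtain v where v: "v \<in> E" "v \<notin> st a"
      "\<And>c e. c \<in> par (st a) \<Longrightarrow> inv k \<otimes> c \<otimes> k \<in> par (st u) \<Longrightarrow> expo e c \<noteq> 0 \<Longrightarrow> e \<in> lk v"
      by blast
    have la: "lam a \<in> par (st a)" using a by (auto simp: st_def)
    then have "a \<in> lk v" using v(3)[of "lam a" a] d a by (simp add: expo_lam d_def)
    then show False using v a adj_sym by (auto simp: st_def lk_def)
  qed
  then obtain t where t: "t \<in> par (st u)" "k \<otimes> t \<in> par (st a)" by blast
  have "g \<otimes> (k \<otimes> t) = h \<otimes> t" using g h par_closed[OF t(1)] by (simp add: k_def word_simps)
  with t show thesis using that by blast
qed


section \<open>Cyclic reduction\<close>

lemma distinct_crossedI: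
  assumes "w \<in> gwords E" "length w \<le> card (sep (ev w))"
  shows "distinct (crossed w)"
proof -
  have "card (sep (ev w)) \<le> card (set (crossed w))"
    by (intro card_mono sep_subset_crossed assms) simp
  then show ?thesis
    using assms card_length[of "crossed w"] by (intro card_distinct) simp
qed

lemma gwords_power: "w \<in> gwords E \<Longrightarrow> concat (replicate n w) \<in> gwords E"
  by (induction n) auto

lemma ev_power: "w \<in> gwords E \<Longrightarrow> ev (concat (replicate n w)) = ev w [^] n"
  by (induction n) (auto simp: gwords_power simp flip: nat_pow_Suc2)

lemma power_Suc_append: "concat (replicate (Suc n) w) = concat (replicate n w) @ w"
  by (induction n) simp_all

lemma nth_power:
  "i < n * length w \<Longrightarrow> concat (replicate n w) ! i = w ! (i mod length w)"
proof (induction n arbitrary: i)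
  case (Suc n)
  then show ?case
    by (cases "i < length w") (auto simp: nth_append le_mod_geq)
qed simp

lemma length_power: "length (concat (replicate n w)) = n * length w"
  by (induction n) auto

lemma ev_rotate:
  assumes "w \<in> gwords E"
  obtains g where "g \<in> carrier G" "rotate k w \<in> gwords E" "ev (rotate k w) = inv g \<otimes> ev w \<otimes> g"
proof -
  define i where "i = k mod length w"
  have td: "take i w \<in> gwords E" "drop i w \<in> gwords E"
    using assms by (auto simp: gwords_iff dest: in_set_takeD in_set_dropD)
  have r: "rotate k w = drop i w @ take i w"
    by (simp add: rotate_drop_take i_def)
  have "ev w = ev (take i w) \<otimes> ev (drop i w)"
    using ev_append[OF td] by simp
  then have "ev (rotate k w) = inv (ev (take i w)) \<otimes> ev w \<otimes> ev (take i w)"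
    using td by (simp add: r inv_cancel)
  with td r that show thesis by auto
qed

text \<open>Here \<open>w\<close> is cyclically reduced. A repetition within one period lies in a
  rotation of \<open>w\<close>, which spells a conjugate and so is reduced too. A longer one meets
  the letter \<open>c\<close> again one period later, inside \<open>m\<close> or as
  \<open>d\<close>, and \<open>coincidence\<close> excludes both.\<close>

lemma distinct_crossed_power:
  assumes w: "w \<in> gwords E" "length w = card (sep (ev w))"
    and min: "\<And>g. g \<in> carrier G \<Longrightarrow> card (sep (ev w)) \<le> card (sep (inv g \<otimes> ev w \<otimes> g))"
  shows "distinct (crossed (concat (replicate n w)))"
proof (rule ccontr)
  define W where "W = concat (replicate n w)"
  define L where "L = length w"
  assume "\<not> distinct (crossed (concat (replicate n w)))"
  then have nd: "\<not> distinct (crossed W)" by (simp add: W_def)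
  have W: "W \<in> gwords E" using w by (simp add: W_def gwords_power)
  obtain p c m d q where pq: "W = p @ c # m @ d # q" "distinct (crossed (c # m))"
      "edge_wall c = act (ev (c # m)) (edge_wall d)"
    using not_distinct_crossed[OF W nd] .
  then have gw: "p \<in> gwords E" "fst c \<in> E" "m \<in> gwords E" "fst d \<in> E" "q \<in> gwords E"
    using W by auto
  note co = coincidence[OF gw(2,4,3) pq(2,3)]
  define i where "i = length p"
  have len: "length W = n * L" by (simp add: W_def length_power L_def)
  have nth: "W ! k = w ! (k mod L)" if "k < n * L" for k
    using that by (simp add: W_def nth_power L_def)
  have iL: "i + length m + 1 < n * L" using len by (simp add: pq(1) i_def)
  have c: "c = w ! (i mod L)" using nth[of i] iL by (simp add: pq(1) i_def)
  show False
  proof (cases "length m + 1 < L")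
    case True
    define r where "r = rotate i w"
    obtain g where g: "g \<in> carrier G" "r \<in> gwords E" "ev r = inv g \<otimes> ev w \<otimes> g"
      using ev_rotate[OF w(1)] unfolding r_def .
    have dist: "distinct (crossed r)"
    proof (rule distinct_crossedI[OF g(2)])
      show "length r \<le> card (sep (ev r))"
        unfolding g(3) using min[OF g(1)] w(2) by (simp add: r_def)
    qed
    \<comment> \<open>One more period is appended so that the window of length \<open>L\<close>
      starting at \<open>i\<close> fits.\<close>
    define W' where "W' = concat (replicate (Suc n) w)"
    have W': "W' = W @ w"
      by (simp only: W'_def W_def power_Suc_append)
    have lenW': "length W' = n * L + L" using len by (simp add: W' L_def)
    have "r = take L (drop i W')"
    proof (rule nth_equalityI)
      show "length r = length (take L (drop i W'))"
        using iL lenW' by (simp add: r_def L_def)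
      fix j assume "j < length r"
      then have j: "j < L" by (simp add: r_def L_def)
      then have "i + j < Suc n * length w" using iL by (simp add: L_def)
      then have "W' ! (i + j) = r ! j"
        using j nth_power[of "i + j" "Suc n" w]
        by (simp add: r_def nth_rotate L_def W'_def del: replicate.simps)
      then show "r ! j = take L (drop i W') ! j"
        using j iL lenW' by simp
    qed
    also have "drop i W' = c # m @ d # (q @ w)"
      by (simp add: W' pq(1) i_def)
    also obtain k where "L = Suc (length m + Suc k)"
      using True less_iff_Suc_add by auto
    then have "take L (c # m @ d # (q @ w)) = c # m @ d # take (L - length m - 2) (q @ w)"
      by simp
    finally have r: "r = c # m @ d # take (L - length m - 2) (q @ w)" .
    define q' where "q' = take (L - length m - 2) (q @ w)"
    have "crossed r = crossed (c # m) @ map (act (ev (c # m))) (crossed (d # q'))"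
      using crossed_append[of "c # m" "d # q'"] g(2) unfolding r q'_def by simp
    then have "crossed r = edge_wall c # (map (act (letter c)) (crossed m) @ edge_wall c #
        map (act (ev (c # m))) (map (act (letter d)) (crossed q')))"
      using pq(3) by (simp only: crossed.simps list.map append_Cons)
    then show False
      using dist by simp
  next
    case False
    have WiL: "W ! (i + L) = c" if "i + L < n * L"
      using nth[OF that] by (simp add: c)
    from False consider "L = length m + 1" | "L < length m + 1" by linarith
    then show False
    proof cases
      case 1
      have "d = W ! (i + L)" by (simp add: pq(1) i_def 1 nth_append)
      also have "\<dots> = c" by (rule WiL) (use iL 1 in linarith)
      finally show False using co(1) by (cases c) auto
    next
      case 2
      have "L > 0" using iL by (cases L) auto
      then obtain l where l: "L = Suc l" by (cases L) auto
      then have "l < length m" using 2 by simp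
      then have "m ! l = W ! (i + L)" by (simp add: pq(1) i_def nth_append l)
      also have "\<dots> = c" by (rule WiL) (use iL 2 in linarith)
      finally have "c \<in> set m" using \<open>l < length m\<close> nth_mem by metis
      from co(3)[OF this] show False by (simp add: lk_def adj_irrefl)
    qed
  qed
qed

text \<open>The walls met by an axis of \<open>x\<close>.\<close>

definition axial :: "'a \<Rightarrow> ('e \<times> 'a set) set"
  where "axial x = {K \<in> Walls. \<exists>N. \<forall>n\<ge>N. (K \<in> sep (x [^] (n::nat))) \<noteq> (K \<in> sep (inv (x [^] n)))}"

text \<open>When \<open>x\<close> is shortest in its conjugacy class, powers of a reduced word for
  it stay reduced. Walls of the first period separate \<one> from all positive powers, and from no
  negative one because their translates belong to the next period.\<close>

lemma sep_axial:
  assumes x: "x \<in> carrier G"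
    and min: "\<And>g. g \<in> carrier G \<Longrightarrow> card (sep x) \<le> card (sep (inv g \<otimes> x \<otimes> g))"
  shows "sep x \<subseteq> axial x"
proof
  fix K assume K: "K \<in> sep x"
  obtain w where w: "w \<in> gwords E" "ev w = x" "distinct (crossed w)" "card (sep x) = length w"
    using reduced_word_exists[OF x] .
  let ?W = "\<lambda>n. concat (replicate n w)"
  have dist: "distinct (crossed (?W n))" for n
    using w min by (intro distinct_crossed_power) auto
  have sepW: "sep (x [^] n) = set (crossed (?W n))" for n
    using distinct_crossed_sep[OF _ dist] w ev_power gwords_power by metis
  have Kw: "K \<in> set (crossed w)" using distinct_crossed_sep[OF w(1,3)] K w(2) by simp
  have "K \<in> sep (x [^] n) \<and> K \<notin> sep (inv (x [^] n))" if n: "n \<ge> 1" for n :: nat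
  proof
    obtain k where k: "n = Suc k" using n by (cases n) auto
    show "K \<in> sep (x [^] n)"
      using Kw w(1) gwords_power[OF w(1), of k] unfolding sepW k
      by (simp add: crossed_append)
    have "?W (Suc n) = ?W n @ w"
      by (rule power_Suc_append)
    then have "crossed (?W (Suc n)) = crossed (?W n) @ map (act (x [^] n)) (crossed w)"
      using w ev_power[of w n] gwords_power[of w n] by (simp only: crossed_append)
    then have "act (x [^] n) K \<notin> set (crossed (?W n))"
      using dist[of "Suc n"] Kw by auto
    then show "K \<notin> sep (inv (x [^] n))"
      using sep_Walls[OF K] x by (simp add: sep_inv sepW)
  qed
  then show "K \<in> axial x" using sep_Walls[OF K] unfolding axial_def by blast
qed

text \<open>By \<open>sep_inv\<close>, a wall fixed by \<open>x [^] k\<close> would treat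
  \<open>x [^] (k * n)\<close> and its inverse alike for every \<open>n\<close>.\<close>

lemma axial_not_fixed:
  assumes x: "x \<in> carrier G" and K: "K \<in> axial x" and k: "k > 0" and fixed: "act (x [^] (k::nat)) K = K"
  shows False
proof -
  obtain N where N: "\<And>n::nat. n \<ge> N \<Longrightarrow> (K \<in> sep (x [^] n)) \<noteq> (K \<in> sep (inv (x [^] n)))" and KW: "K \<in> Walls"
    using K unfolding axial_def by blast
  have "act (x [^] (k * n)) K = K" for n
  proof (induction n)
    case (Suc n)
    have "act (x [^] (k * Suc n)) K = act (x [^] k) (act (x [^] (k * n)) K)"
      using x KW by (simp add: act_act nat_pow_mult)
    then show ?case using Suc fixed by simp
  qed (use KW in simp)
  moreover have "k * N \<ge> N" using k by simp
  ultimately show False using N[of "k * N"] x KW by (simp add: sep_inv)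
qed

text \<open>Applying \<open>y\<close> replaces the base point \<one> by \<open>y\<close>, which
  matters only if a translate of \<open>act y K\<close> by a power of \<open>x\<close> separates
  \<one> from \<open>y\<close>. The translates in either direction are pairwise distinct, so this
  concerns finitely many exponents.\<close>

lemma axial_commute:
  assumes x: "x \<in> carrier G" and y: "y \<in> carrier G" and comm: "x \<otimes> y = y \<otimes> x" and K: "K \<in> axial x"
  shows "act y K \<in> axial x"
proof -
  obtain N where N: "\<And>n::nat. n \<ge> N \<Longrightarrow> (K \<in> sep (x [^] n)) \<noteq> (K \<in> sep (inv (x [^] n)))" and KW: "K \<in> Walls"
    using K unfolding axial_def by blast
  have cn: "x [^] n \<otimes> y = y \<otimes> x [^] n" for n :: nat
  proof (induction n)
    case (Suc n)
    have "x [^] Suc n \<otimes> y = x [^] n \<otimes> y \<otimes> x"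
      using x y comm by (simp add: m_assoc)
    then show ?case using x y by (simp only: Suc) (simp add: m_assoc)
  qed (use y in simp)
  have ci: "inv (x [^] n) \<otimes> y = y \<otimes> inv (x [^] n)" for n :: nat
    using commute_conj(3)[OF _ y cn] x by simp
  have no_fix: "act (x [^] k) (act y K) \<noteq> act y K" if "k > 0" for k :: nat
  proof
    assume "act (x [^] k) (act y K) = act y K"
    then have "act y (act (x [^] k) K) = act y K"
      using x y KW by (simp add: act_act cn[of k])
    then have "act (x [^] k) K = K" using act_inj[OF y] x KW by simp
    then show False using axial_not_fixed[OF x K that] by blast
  qed
  have inj1: "inj (\<lambda>n::nat. act (x [^] n) (act y K))"
  proof (rule linorder_injI)
    fix i j :: nat assume "i < j"
    have "x [^] j = x [^] i \<otimes> x [^] (j - i)"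
      using \<open>i < j\<close> x by (simp add: nat_pow_mult)
    then have "act (x [^] j) (act y K) = act (x [^] i) (act (x [^] (j - i)) (act y K))"
      using act_act[of "x [^] i" "x [^] (j - i)" "act y K"] x y KW by simp
    moreover have "act (x [^] (j - i)) (act y K) \<noteq> act y K" using no_fix \<open>i < j\<close> by simp
    ultimately show "act (x [^] i) (act y K) \<noteq> act (x [^] j) (act y K)"
      using act_inj[of "x [^] i"] x y KW by (metis act_in_Walls nat_pow_closed)
  qed
  have inj2: "inj (\<lambda>n::nat. act (inv (x [^] n)) (act y K))"
  proof (rule injI)
    fix i j :: nat assume eq: "act (inv (x [^] i)) (act y K) = act (inv (x [^] j)) (act y K)"
    have *: "act (x [^] (i + j)) (act (inv (x [^] k)) (act y K)) = act (x [^] l) (act y K)"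
      if "i + j = l + k" for k l
    proof -
      have "x [^] (i + j) \<otimes> inv (x [^] k) = x [^] l"
        using x by (simp add: that m_assoc flip: nat_pow_mult)
      then show ?thesis using x y KW by (simp add: act_act flip: m_assoc)
    qed
    have "act (x [^] j) (act y K) = act (x [^] i) (act y K)"
      using *[of j i] *[of i j] eq by simp
    from injD[OF inj1 this] show "i = j" by simp
  qed
  have "finite (sep y)" using y by simp
  then have "finite {n::nat. act (x [^] n) (act y K) \<in> sep y}" "finite {n::nat. act (inv (x [^] n)) (act y K) \<in> sep y}"
    using finite_vimageI[OF _ inj1] finite_vimageI[OF _ inj2] by (simp_all add: vimage_def)
  then obtain N1 N2 where N12: "\<forall>n\<in>{n::nat. act (x [^] n) (act y K) \<in> sep y}. n < N1"
    "\<forall>n\<in>{n::nat. act (inv (x [^] n)) (act y K) \<in> sep y}. n < N2"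
    unfolding finite_nat_set_iff_bounded by blast
  have "(act y K \<in> sep (x [^] n)) \<noteq> (act y K \<in> sep (inv (x [^] n)))" if n: "n \<ge> max N (max N1 N2)" for n
  proof -
    have 1: "act (x [^] n) (act y K) \<notin> sep y" "act (inv (x [^] n)) (act y K) \<notin> sep y"
      using N12 n by (force, force)
    have "act y K \<in> sep (y \<otimes> x [^] n) \<longleftrightarrow> (act y K \<in> sep y) \<noteq> (K \<in> sep (x [^] n))"
      using x y KW by (simp add: sep_mult)
    moreover have "act y K \<in> sep (y \<otimes> x [^] n) \<longleftrightarrow> act y K \<in> sep (x [^] n)"
      using x y KW 1 unfolding cn[symmetric] by (simp add: sep_mult)
    moreover have "act y K \<in> sep (y \<otimes> inv (x [^] n)) \<longleftrightarrow> (act y K \<in> sep y) \<noteq> (K \<in> sep (inv (x [^] n)))"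
      using x y KW by (simp add: sep_mult)
    moreover have "act y K \<in> sep (y \<otimes> inv (x [^] n)) \<longleftrightarrow> act y K \<in> sep (inv (x [^] n))"
      using x y KW 1 unfolding ci[symmetric] by (simp add: sep_mult)
    ultimately show ?thesis using N[of n] n by auto
  qed
  then show ?thesis using KW y unfolding axial_def by blast
qed

text \<open>The path to a power of \<open>x\<close> consists of translates of one period; shifting
  the period that crosses \<open>K\<close> back to the first gives the exponent.\<close>

lemma axial_translate:
  assumes x: "x \<in> carrier G" and K: "K \<in> axial x"
  shows "\<exists>k::int. act (x [^] k) K \<in> sep x"
proof -
  have *: "\<exists>k::int. act (x [^] k) L \<in> sep x" if "L \<in> Walls" "L \<in> sep (x [^] n)" for L and n :: nat
    using that
  proof (induction n)
    case (Suc n)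
    then have "L \<in> sep (x [^] n) \<or> act (inv (x [^] n)) L \<in> sep x"
      using x by (auto simp: sep_mult)
    then show ?case
    proof
      assume "act (inv (x [^] n)) L \<in> sep x"
      then have "act (x [^] (- int n)) L \<in> sep x" using x by (simp add: int_pow_neg_int)
      then show ?thesis by blast
    qed (use Suc in blast)
  qed simp
  obtain n :: nat where n: "(K \<in> sep (x [^] n)) \<noteq> (K \<in> sep (inv (x [^] n)))" and KW: "K \<in> Walls"
    using K unfolding axial_def by blast
  then consider "K \<in> sep (x [^] n)" | "act (x [^] n) K \<in> sep (x [^] n)"
    using sep_inv[of "x [^] n" K] x by auto
  then show ?thesis
  proof cases
    case 2
    then obtain k :: int where "act (x [^] k) (act (x [^] n) K) \<in> sep x" using * KW x by blast
    then have "act (x [^] (k + int n)) K \<in> sep x"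
      using x KW by (simp add: act_act int_pow_mult int_pow_int)
    then show ?thesis by blast
  qed (use * KW in blast)
qed

text \<open>Powers of \<open>x\<close> bring every \<open>act (y [^] q) K\<close> into the finite
  set \<open>sep x\<close>. Two values of \<open>q\<close> collide, and the resulting element fixes
  \<open>K\<close> while its exponent of \<open>u\<close> is a nonzero multiple of that of
  \<open>y\<close>.\<close>

lemma expo_commuting:
  assumes x: "x \<in> carrier G" and y: "y \<in> carrier G" and comm: "x \<otimes> y = y \<otimes> x"
    and K: "K \<in> axial x" and u: "expo u x = 0" "expo u y \<noteq> 0"
  shows "u \<in> lk (fst K)"
proof (rule ccontr)
  assume nu: "u \<notin> lk (fst K)"
  have KW: "K \<in> Walls" using K by (simp add: axial_def)
  have ax: "act (y [^] (q::nat)) K \<in> axial x" for q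
  proof (induction q)
    case (Suc q)
    have "act (y [^] Suc q) K = act y (act (y [^] q) K)"
      using y KW by (simp only: act_act nat_pow_Suc2 nat_pow_closed)
    then show ?case using axial_commute[OF x y comm Suc] by simp
  qed (use K KW in simp)
  have "\<forall>q::nat. \<exists>k::int. act (x [^] k) (act (y [^] q) K) \<in> sep x"
    using axial_translate[OF x ax] by blast
  from choice[OF this]
  obtain \<kappa> :: "nat \<Rightarrow> int" where \<kappa>: "\<And>q. act (x [^] \<kappa> q) (act (y [^] q) K) \<in> sep x"
    by blast
  have "\<not> inj (\<lambda>q. act (x [^] \<kappa> q) (act (y [^] q) K))"
  proof
    assume "inj (\<lambda>q. act (x [^] \<kappa> q) (act (y [^] q) K))"
    moreover have "finite (range (\<lambda>q. act (x [^] \<kappa> q) (act (y [^] q) K)))"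
      by (rule finite_subset[OF _ finite_sep[OF x]]) (use \<kappa> in blast)
    ultimately show False by (auto dest: finite_imageD)
  qed
  then obtain q r :: nat where qr: "q < r" "act (x [^] \<kappa> q) (act (y [^] q) K) = act (x [^] \<kappa> r) (act (y [^] r) K)"
    using linorder_injI[of "\<lambda>q. act (x [^] \<kappa> q) (act (y [^] q) K)"] by blast
  define g where "g = inv (x [^] \<kappa> q \<otimes> y [^] q) \<otimes> (x [^] \<kappa> r \<otimes> y [^] r)"
  have g: "g \<in> carrier G" using x y by (simp add: g_def)
  have "act (x [^] \<kappa> q \<otimes> y [^] q) K = act (x [^] \<kappa> r \<otimes> y [^] r) K"
    using qr(2) x y KW by (simp add: act_act)
  then have "act g K = act (inv (x [^] \<kappa> q \<otimes> y [^] q)) (act (x [^] \<kappa> q \<otimes> y [^] q) K)"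
    using x y KW by (simp add: g_def act_act)
  then have "act g K = K" using x y KW by simp
  then have "expo u g = 0" using fixed_wall_expo[OF KW g _ nu] by blast
  moreover have "expo u g = (int r - int q) * expo u y"
    using x y u(1) by (simp add: g_def algebra_simps)
  ultimately show False using u(2) qr(1) by simp
qed

lemma par_singleton:
  assumes "a \<in> E" "g \<in> par {a}"
  shows "\<exists>k::int. g = lam a [^] k"
proof -
  obtain w where "w \<in> gwords ({a} \<inter> E)" "ev w = g" using par_word[OF assms(2)] .
  moreover have "\<exists>k::int. ev w = lam a [^] k" if "w \<in> gwords ({a} \<inter> E)" for w
    using that
  proof (induction w)
    case Nil
    then show ?case by (intro exI[of _ 0]) simp
  next
    case (Cons c w)
    then obtain k :: int where k: "ev w = lam a [^] k" "fst c = a" by auto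
    have "letter c = lam a [^] (if snd c then 1 else -1 :: int)"
      using assms(1) k(2) by (simp add: letter_def int_pow_neg)
    then show ?case using assms(1) k(1) by (auto simp flip: int_pow_mult)
  qed
  ultimately show ?thesis by blast
qed

text \<open>In a shortest conjugate, \<open>expo_commuting\<close> with the supplied
  \<open>y\<close> and \<open>u\<close> forbids walls of every type \<open>b\<close> other than
  \<open>a\<close>. What remains is a power of \<open>lam a\<close>, and the exponent sum makes it
  the first power.\<close>

lemma conjugate_of_generator:
  assumes a: "a \<in> E" and x: "x \<in> carrier G" "expo a x = 1"
    and cent: "\<And>b. b \<in> E \<Longrightarrow> b \<noteq> a \<Longrightarrow>
      \<exists>y u. y \<in> carrier G \<and> x \<otimes> y = y \<otimes> x \<and> u \<notin> lk b \<and> expo u x = 0 \<and> expo u y \<noteq> 0"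
  obtains g where "g \<in> carrier G" "x = g \<otimes> lam a \<otimes> inv g"
proof -
  obtain g where g: "g \<in> carrier G"
    and min: "\<And>h. h \<in> carrier G \<Longrightarrow> card (sep (inv g \<otimes> x \<otimes> g)) \<le> card (sep (inv h \<otimes> x \<otimes> h))"
    using ex_has_least_nat[of "\<lambda>g. g \<in> carrier G" \<one> "\<lambda>g. card (sep (inv g \<otimes> x \<otimes> g))"] by blast
  define z where "z = inv g \<otimes> x \<otimes> g"
  have z: "z \<in> carrier G" using g x by (simp add: z_def)
  have minz: "card (sep z) \<le> card (sep (inv h \<otimes> z \<otimes> h))" if h: "h \<in> carrier G" for h
    using min[of "g \<otimes> h"] g h x by (simp add: z_def word_simps)
  have type: "fst K = a" if K: "K \<in> sep z" for K
  proof (rule ccontr)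
    assume "fst K \<noteq> a"
    moreover have "fst K \<in> E" using fst_Walls[OF sep_Walls[OF K]] .
    ultimately obtain y u where y: "y \<in> carrier G" "x \<otimes> y = y \<otimes> x" "u \<notin> lk (fst K)" "expo u x = 0" "expo u y \<noteq> 0"
      using cent by blast
    define y' where "y' = inv g \<otimes> y \<otimes> g"
    have "z \<otimes> y' = inv g \<otimes> (x \<otimes> y) \<otimes> g" using g x y(1) by (simp add: z_def y'_def word_simps)
    also have "\<dots> = y' \<otimes> z" unfolding y(2) using g x y(1) by (simp add: z_def y'_def word_simps)
    finally have "z \<otimes> y' = y' \<otimes> z" .
    moreover have "K \<in> axial z" using sep_axial[OF z minz] K by blast
    ultimately have "u \<in> lk (fst K)"
      using expo_commuting[OF z, of y' K u] g x y by (simp add: y'_def z_def)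
    with y(3) show False by blast
  qed
  obtain w where w: "w \<in> gwords E" "ev w = z" "distinct (crossed w)"
    using reduced_word_exists[OF z] by blast
  have "fst ` set (crossed w) \<subseteq> {a}" using distinct_crossed_sep[OF w(1,3)] w(2) type by auto
  then have "fst ` set w \<subseteq> {a}" by (metis fst_crossed set_map)
  then have "w \<in> gwords ({a} \<inter> E)" using a by (auto simp: gwords_iff)
  then have "z \<in> par {a}" using par_ev w(2) by blast
  then obtain k :: int where k: "z = lam a [^] k" using par_singleton[OF a] by blast
  have "k = 1" using arg_cong[OF k, of "expo a"] a g x by (simp add: z_def expo_lam)
  then have "x = g \<otimes> lam a \<otimes> inv g"
    using arg_cong[OF k, of "\<lambda>z. g \<otimes> z \<otimes> inv g"] a g x by (simp add: z_def word_simps)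
  with g show thesis using that by blast
qed


section \<open>Cosets of conjugators\<close>

text \<open>For a family \<open>F\<close> of conjugates of the generators, \<open>conjugators F a\<close> is a left coset of the
  centraliser of \<open>lam a\<close>, and \<open>cut F a\<close> consists of the walls separating it from \<^term>\<open>\<one>\<close>.\<close>

definition conjugators :: "('e \<Rightarrow> 'a) \<Rightarrow> 'e \<Rightarrow> 'a set"
  where "conjugators F a = {z \<in> carrier G. z \<otimes> lam a \<otimes> inv z = F a}"

definition cut :: "('e \<Rightarrow> 'a) \<Rightarrow> 'e \<Rightarrow> ('e \<times> 'a set) set"
  where "cut F a = {K \<in> Walls. \<forall>z\<in>conjugators F a. K \<in> sep z}"

lemma conjugators_star:
  assumes "a \<in> E" "z \<in> conjugators F a"
  shows "s \<in> par (st a) \<Longrightarrow> z \<otimes> s \<in> conjugators F a"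
    and "z' \<in> conjugators F a \<Longrightarrow> inv z \<otimes> z' \<in> par (st a)"
proof -
  assume s: "s \<in> par (st a)"
  then have "s \<otimes> lam a \<otimes> inv s = lam a"
    using commute_conj(2)[of s "lam a"] st_commute[OF assms(1) s] assms par_closed[OF s] by simp
  then have "z \<otimes> (s \<otimes> lam a \<otimes> inv s) \<otimes> inv z = F a"
    using assms by (simp add: conjugators_def)
  then show "z \<otimes> s \<in> conjugators F a"
    using assms par_closed[OF s] by (simp add: conjugators_def word_simps)
next
  assume z': "z' \<in> conjugators F a"
  then have car: "z \<in> carrier G" "z' \<in> carrier G" and eq: "z' \<otimes> lam a \<otimes> inv z' = z \<otimes> lam a \<otimes> inv z"
    using assms by (auto simp: conjugators_def)
  from arg_cong[OF eq, of "\<lambda>x. inv z \<otimes> x \<otimes> z'"]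
  show "inv z \<otimes> z' \<in> par (st a)"
    using car assms(1) by (intro centraliser_lam) (auto simp: word_simps)
qed

text \<open>The conjugators form a translate of \<open>par (st a)\<close>, which is convex by
  \<open>fst_sep_par\<close>.\<close>

lemma crossed_conjugators:
  assumes a: "a \<in> E" and z: "z \<in> conjugators F a" and z': "z' \<in> conjugators F a"
    and K: "K \<in> Walls" "K \<in> sep z" "K \<notin> sep z'"
  shows "fst K \<in> st a \<and> (\<exists>y\<in>conjugators F a. K = wall (fst K) y)"
proof -
  have car: "z \<in> carrier G" "z' \<in> carrier G" using z z' by (auto simp: conjugators_def)
  define s where "s = inv z \<otimes> z'"
  have s: "s \<in> par (st a)" unfolding s_def by (rule conjugators_star(2)[OF a z z'])
  have "z' = z \<otimes> s" using car by (simp add: s_def inv_cancel)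
  then have "act (inv z) K \<in> sep s"
    using K car par_closed[OF s] by (simp add: sep_mult)
  from fst_sep_par[OF s this] obtain v h where
    v: "v \<in> st a" "v \<in> E" "h \<in> par (st a)" "act (inv z) K = wall v h" by blast
  have "K = wall v (z \<otimes> h)"
    using v(4) act_eq_iff[OF car(1) K(1), of "wall v h"] v car par_closed[OF v(3)] by simp
  moreover from this have "fst K = v" by simp
  ultimately show ?thesis using v conjugators_star(1)[OF a z v(3)] by auto
qed

lemma conjugators_meet:
  assumes a: "a \<in> E" "conjugators F a \<noteq> {}" and b: "b \<in> E" "conjugators F b \<noteq> {}"
    and comm: "F a \<otimes> F b = F b \<otimes> F a"
  obtains z where "z \<in> conjugators F a" "z \<in> conjugators F b"
proof -
  obtain x y where x: "x \<in> conjugators F a" and y: "y \<in> conjugators F b" using a b by blast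
  then have "x \<in> carrier G" "y \<in> carrier G" "x \<otimes> lam a \<otimes> inv x = F a" "y \<otimes> lam b \<otimes> inv y = F b"
    by (auto simp: conjugators_def)
  with comm obtain s t where st: "s \<in> par (st a)" "t \<in> par (st b)" "x \<otimes> s = y \<otimes> t"
    using commuting_conjugates[OF a(1) b(1), of x y] by auto
  have "x \<otimes> s \<in> conjugators F a" by (rule conjugators_star(1)[OF a(1) x st(1)])
  moreover have "x \<otimes> s \<in> conjugators F b"
    unfolding st(3) by (rule conjugators_star(1)[OF b(1) y st(2)])
  ultimately show thesis using that by blast
qed

lemma finite_cut:
  assumes "conjugators F a \<noteq> {}"
  shows "finite (cut F a)"
proof -
  obtain z where "z \<in> conjugators F a" using assms by blast
  then have "cut F a \<subseteq> sep z" "finite (sep z)" by (auto simp: cut_def conjugators_def)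
  then show ?thesis by (rule finite_subset)
qed

text \<open>Conjugating the family translates its cosets, which amounts to moving the base point
  from \<one> to \<open>x\<close>.\<close>

lemma conjugators_conj:
  assumes "x \<in> carrier G" "a \<in> E" "F a \<in> carrier G"
  shows "conjugators (\<lambda>a. inv x \<otimes> F a \<otimes> x) a = (\<otimes>) (inv x) ` conjugators F a"
proof (intro equalityI subsetI)
  fix z assume "z \<in> conjugators (\<lambda>a. inv x \<otimes> F a \<otimes> x) a"
  then have z: "z \<in> carrier G" "z \<otimes> lam a \<otimes> inv z = inv x \<otimes> F a \<otimes> x" by (auto simp: conjugators_def)
  from arg_cong[OF z(2), of "\<lambda>y. x \<otimes> y \<otimes> inv x"]
  have "x \<otimes> z \<in> conjugators F a" using assms z(1) by (simp add: conjugators_def word_simps)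
  moreover have "z = inv x \<otimes> (x \<otimes> z)" using assms z by (simp add: inv_cancel)
  ultimately show "z \<in> (\<otimes>) (inv x) ` conjugators F a" by blast
next
  fix z assume "z \<in> (\<otimes>) (inv x) ` conjugators F a"
  then obtain y where y: "y \<in> carrier G" "y \<otimes> lam a \<otimes> inv y = F a" "z = inv x \<otimes> y"
    by (auto simp: conjugators_def)
  then show "z \<in> conjugators (\<lambda>a. inv x \<otimes> F a \<otimes> x) a"
    using assms by (simp add: conjugators_def word_simps flip: y(2))
qed

text \<open>Moving the base point across an edge only affects the wall of that edge.\<close>

lemma card_cut_conj:
  assumes c: "fst c \<in> E" and a: "a \<in> E" "F a \<in> carrier G" "conjugators F a \<noteq> {}"
  defines "F' \<equiv> \<lambda>a. inv (letter c) \<otimes> F a \<otimes> letter c"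
  shows "card (cut F' a) \<le> card (cut F a) + 1"
    and "z \<in> conjugators F a \<Longrightarrow> edge_wall c \<in> sep z \<Longrightarrow> card (cut F' a) \<le> card (cut F a)"
    and "edge_wall c \<in> cut F a \<Longrightarrow> card (cut F' a) + 1 \<le> card (cut F a)"
proof -
  \<comment> \<open>The image of \<open>cut F' a\<close> under \<open>act (letter c)\<close>: seen
    from the new base point, only the answer for \<open>edge_wall c\<close> is reversed.\<close>
  define C where "C = {K \<in> Walls. \<forall>z\<in>conjugators F a. (K = edge_wall c) \<noteq> (K \<in> sep z)}"
  have lc: "letter c \<in> carrier G" using c by auto
  have conj: "conjugators F' a = (\<otimes>) (inv (letter c)) ` conjugators F a"
    unfolding F'_def by (rule conjugators_conj[OF lc a(1), of F, OF a(2)])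
  have "K \<in> sep (inv (letter c) \<otimes> z) \<longleftrightarrow> (act (letter c) K = edge_wall c) \<noteq> (act (letter c) K \<in> sep z)"
    if "K \<in> Walls" "z \<in> conjugators F a" for K z
  proof -
    have "z \<in> carrier G" using that by (simp add: conjugators_def)
    then show ?thesis using that lc sep_letter[OF c] by (simp add: sep_mult sep_inv)
  qed
  then have mem: "K \<in> cut F' a \<longleftrightarrow> act (letter c) K \<in> C" if "K \<in> Walls" for K
    using that lc by (simp add: cut_def C_def conj)
  have "act (letter c) ` cut F' a = C"
  proof (intro equalityI subsetI)
    fix K assume "K \<in> C"
    then have K: "K \<in> Walls" by (simp add: C_def)
    then have "K = act (letter c) (act (inv (letter c)) K)" using lc by simp
    moreover from this have "act (inv (letter c)) K \<in> cut F' a" using mem[of "act (inv (letter c)) K"] \<open>K \<in> C\<close> K lc by simp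
    ultimately show "K \<in> act (letter c) ` cut F' a" by blast
  next
    fix K assume "K \<in> act (letter c) ` cut F' a"
    then show "K \<in> C" using mem by (auto simp: cut_def)
  qed
  moreover have "inj_on (act (letter c)) (cut F' a)"
    using act_inj[OF lc] by (auto simp: inj_on_def cut_def)
  ultimately have card: "card (cut F' a) = card C" using card_image by fastforce
  have fin: "finite (cut F a)" by (rule finite_cut[OF a(3)])
  have "C \<subseteq> insert (edge_wall c) (cut F a)" by (auto simp: C_def cut_def)
  then have "card C \<le> card (insert (edge_wall c) (cut F a))" using fin by (intro card_mono) auto
  also have "\<dots> \<le> card (cut F a) + 1" using fin by (simp add: card_insert_if)
  finally show "card (cut F' a) \<le> card (cut F a) + 1" by (simp add: card)
  show "card (cut F' a) \<le> card (cut F a)" if z: "z \<in> conjugators F a" "edge_wall c \<in> sep z"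
  proof -
    have "C \<subseteq> cut F a"
    proof
      fix K assume "K \<in> C"
      moreover from this have "K \<noteq> edge_wall c" using z unfolding C_def by blast
      ultimately show "K \<in> cut F a" by (simp add: C_def cut_def del: split_paired_All)
    qed
    then show ?thesis unfolding card using fin by (intro card_mono)
  qed
  show "card (cut F' a) + 1 \<le> card (cut F a)" if K: "edge_wall c \<in> cut F a"
  proof -
    obtain z where "z \<in> conjugators F a" using a by blast
    then have "C \<subseteq> cut F a - {edge_wall c}" using K by (auto simp: C_def cut_def)
    then have "card C \<le> card (cut F a - {edge_wall c})" using fin by (intro card_mono) auto
    moreover have "card (cut F a) > 0" using fin K card_gt_0_iff by blast
    ultimately show ?thesis unfolding card using fin K by simp
  qed
qed

end


section \<open>Rigid graphs\<close>

text \<open>Connectedness is phrased through two-valued functions, the form in which it is applied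
  to the sides of a wall. Two vertices off each star are required so that crossing a wall gains at
  least 2 while it may lose 1.\<close>

locale rigid_raag = raag +
  assumes finite_E: "finite E"
    and no_domination: "x \<in> E \<Longrightarrow> y \<in> E \<Longrightarrow> x \<noteq> y \<Longrightarrow> \<exists>u\<in>lk x. u \<notin> st y"
    and star_complement_connected:
      "v \<in> E \<Longrightarrow> (\<And>b c. b \<in> E - st v \<Longrightarrow> c \<in> E - st v \<Longrightarrow> adj b c \<Longrightarrow> Q b = (Q c :: bool)) \<Longrightarrow>
        b \<in> E - st v \<Longrightarrow> c \<in> E - st v \<Longrightarrow> Q b = Q c"
    and star_complement_nontrivial: "v \<in> E \<Longrightarrow> \<exists>b\<in>E - st v. \<exists>c\<in>E - st v. b \<noteq> c"
begin

text \<open>\<open>K\<close> is the first wall on the way to the missed coset and \<open>v\<close>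
  its type. Cosets of vertices off the star of \<open>v\<close> are not cut by \<open>K\<close>, and
  adjacent ones meet, so all of them lie on one side. If it is the far side, crossing
  \<open>K\<close> is the required step; the near side is contradictory.\<close>

lemma cut_decrease:
  assumes conj: "\<And>a. a \<in> E \<Longrightarrow> conjugators F a \<noteq> {}"
    and comm: "\<And>a b. a \<in> E \<Longrightarrow> b \<in> E \<Longrightarrow> adj a b \<Longrightarrow> F a \<otimes> F b = F b \<otimes> F a"
    and a0: "a0 \<in> E" "\<one> \<notin> conjugators F a0"
  obtains c where "fst c \<in> E"
    "(\<Sum>a\<in>E. card (cut (\<lambda>a. inv (letter c) \<otimes> F a \<otimes> letter c) a)) < (\<Sum>a\<in>E. card (cut F a))"
proof -
  have F: "F a \<in> carrier G" if "a \<in> E" for a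
  proof -
    obtain z where "z \<in> conjugators F a" using conj[OF \<open>a \<in> E\<close>] by blast
    then have "z \<otimes> lam a \<otimes> inv z = F a" "z \<in> carrier G" by (auto simp: conjugators_def)
    then show ?thesis using that by (metis inv_closed lam_closed m_closed)
  qed
  obtain p where p: "p \<in> conjugators F a0"
    and pmin: "\<And>z. z \<in> conjugators F a0 \<Longrightarrow> card (sep p) \<le> card (sep z)"
    using ex_has_least_nat[of "\<lambda>z. z \<in> conjugators F a0" _ "\<lambda>z. card (sep z)"] conj[OF a0(1)] by blast
  have pc: "p \<in> carrier G" "p \<noteq> \<one>" using p a0 by (auto simp: conjugators_def)
  have "card (sep p) \<le> card (sep (p \<otimes> s))" if "s \<in> par (st a0)" for s
    using pmin conjugators_star(1)[OF a0(1) p that] .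
  from gate[OF pc this] obtain c where c: "fst c \<in> E"
    and far: "\<And>s. s \<in> par (st a0) \<Longrightarrow> edge_wall c \<in> sep (p \<otimes> s)"
    by metis
  define v where "v = fst c"
  define K where "K = edge_wall c"
  have v: "v \<in> E" "fst K = v" and KW: "K \<in> Walls" using c by (auto simp: v_def K_def)
  have far: "K \<in> sep z" if "z \<in> conjugators F a0" for z
  proof -
    have "z \<in> carrier G" using that by (simp add: conjugators_def)
    then show ?thesis
      using far[OF conjugators_star(2)[OF a0(1) p that]] pc by (simp add: inv_cancel K_def)
  qed
  have meet: "\<exists>z. z \<in> conjugators F a \<and> z \<in> conjugators F b" if "a \<in> E" "b \<in> E" "adj a b" for a b
    using conjugators_meet[of a F b] conj comm that by metis
  define Q where "Q b \<longleftrightarrow> K \<in> cut F b" for b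
  have side: "K \<in> sep z \<longleftrightarrow> Q b" if b: "b \<in> E - st v" and z: "z \<in> conjugators F b" for b z
  proof -
    have "v \<notin> st b" using b v st_sym by blast
    have "K \<in> sep z \<longleftrightarrow> K \<in> sep z'" if z': "z' \<in> conjugators F b" for z'
    proof (rule ccontr)
      assume "\<not> ?thesis"
      then have "fst K \<in> st b"
        using crossed_conjugators[OF _ z z' KW] crossed_conjugators[OF _ z' z KW] b by blast
      with \<open>v \<notin> st b\<close> v show False by simp
    qed
    then show ?thesis using z KW unfolding Q_def cut_def by blast
  qed
  have Q_adj: "Q b = Q d" if "b \<in> E - st v" "d \<in> E - st v" "adj b d" for b d
    using meet[of b d] side[OF that(1)] side[OF that(2)] that by blast
  have Q_const: "Q b = Q d" if "b \<in> E - st v" "d \<in> E - st v" for b d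
    by (rule star_complement_connected[OF v(1) Q_adj that])
  \<comment> \<open>By \<open>no_domination\<close> a neighbour \<open>b\<close> of \<open>v\<close>
    has a neighbour \<open>d\<close> off the star of \<open>v\<close>. Their cosets meet, so the
    coset of \<open>b\<close> has a point on the common side.\<close>
  have link: "\<exists>d\<in>E - st v. \<exists>z. z \<in> conjugators F b \<and> z \<in> conjugators F d" if b: "b \<in> lk v" for b
  proof -
    have b': "b \<in> E" "b \<noteq> v" using b adj_irrefl by (auto simp: lk_def)
    then obtain d where d: "d \<in> lk b" "d \<notin> st v" using no_domination[of b v] v by blast
    then have "\<exists>z. z \<in> conjugators F b \<and> z \<in> conjugators F d" using meet[of b d] b' by (auto simp: lk_def)
    then show ?thesis using d by (auto simp: lk_def)
  qed
  obtain b1 b2 where b12: "b1 \<in> E - st v" "b2 \<in> E - st v" "b1 \<noteq> b2"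
    using star_complement_nontrivial[OF v(1)] by blast
  show thesis
  proof (cases "Q b1")
    case True
    define F' where "F' = (\<lambda>a. inv (letter c) \<otimes> F a \<otimes> letter c)"
    \<comment> \<open>The indicators on the left are the guaranteed gain at two vertices, the one on
      the right the possible loss at \<open>v\<close>.\<close>
    have le: "card (cut F' a) + (if a = b1 then 1 else 0) + (if a = b2 then 1 else 0)
        \<le> card (cut F a) + (if a = v then 1 else 0)" if a: "a \<in> E" for a
    proof -
      note card_cut_conj[OF c a F[OF a] conj[OF a], folded F'_def]
      note cc = this
      have v12: "v \<noteq> b1" "v \<noteq> b2" using b12 by (auto simp: st_def)
      consider "a \<in> E - st v" | "a \<in> lk v" | "a = v" using a by (auto simp: st_def)
      then show ?thesis
      proof cases
        case 1
        then have "Q a" using Q_const[OF _ b12(1)] True by blast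
        then have "card (cut F' a) + 1 \<le> card (cut F a)" using cc(3) by (simp add: Q_def K_def)
        then show ?thesis using b12(3) by auto
      next
        case 2
        then obtain d z where dz: "d \<in> E - st v" "z \<in> conjugators F a" "z \<in> conjugators F d"
          using link by blast
        then have "K \<in> sep z" using side[of d z] Q_const[of d b1] b12 True by blast
        then have "card (cut F' a) \<le> card (cut F a)" using cc(2) dz(2) by (simp add: K_def)
        moreover have "a \<noteq> b1" "a \<noteq> b2" using 2 b12 by (auto simp: st_def)
        ultimately show ?thesis by simp
      next
        case 3
        then show ?thesis using cc(1) v12 by simp
      qed
    qed
    have "(\<Sum>a\<in>E. card (cut F' a) + (if a = b1 then 1 else 0) + (if a = b2 then 1 else 0))
        \<le> (\<Sum>a\<in>E. card (cut F a) + (if a = v then 1 else 0))"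
      by (rule sum_mono) (rule le)
    then have "(\<Sum>a\<in>E. card (cut F' a)) + 2 \<le> (\<Sum>a\<in>E. card (cut F a)) + 1"
      using finite_E b12 v by (simp add: sum.distrib)
    then show thesis using that[OF c] by (simp add: F'_def)
  next
    case False
    have near: "K \<notin> sep z" if "d \<in> E - st v" "z \<in> conjugators F d" for d z
      using side[OF that] Q_const[OF that(1) b12(1)] False by blast
    \<comment> \<open>All of the missed coset is beyond \<open>K\<close>, whereas cosets of vertices
      off the star or in the link have points on the near side; only \<open>v\<close> itself is
      left.\<close>
    have "a0 \<notin> E - st v" using near[OF _ p] far[OF p] by blast
    moreover have "a0 \<notin> lk v" using link[of a0] near far by blast
    ultimately have a0v: "a0 = v" using a0 by (auto simp: st_def)
    \<comment> \<open>The coset of \<open>b\<close> has points on both sides of \<open>K\<close>, so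
      \<open>K\<close> is dual to an edge at one of its points \<open>y\<close>, and
      \<open>y\<close> commutes with \<open>lam v\<close>.\<close>
    have comm_v: "F b \<otimes> lam v = lam v \<otimes> F b" if b: "b \<in> lk v" for b
    proof -
      have bE: "b \<in> E" "adj v b" "adj b v" using b adj_sym by (auto simp: lk_def)
      obtain z where z: "z \<in> conjugators F b" "z \<in> conjugators F v" using meet[of b v] bE v by blast
      have "K \<in> sep z" using far z a0v by simp
      moreover obtain d z' where dz: "d \<in> E - st v" "z' \<in> conjugators F b" "z' \<in> conjugators F d"
        using link[OF b] by blast
      then have "K \<notin> sep z'" using near by blast
      ultimately obtain y where y: "y \<in> conjugators F b" "K = wall v y"
        using crossed_conjugators[OF bE(1) z(1) dz(2) KW] unfolding v(2) by blast
      then have yc: "y \<in> carrier G" "y \<otimes> lam b \<otimes> inv y = F b" by (auto simp: conjugators_def)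
      have "lam v \<otimes> y = y \<otimes> lam v"
        using edge_wall_translation[OF c yc(1)] y(2) by (simp add: K_def v_def)
      then have yv: "y \<otimes> lam v \<otimes> inv y = lam v" using commute_conj(2)[of y "lam v"] yc v by simp
      have "F b \<otimes> lam v = (y \<otimes> lam b \<otimes> inv y) \<otimes> (y \<otimes> lam v \<otimes> inv y)"
        by (simp only: yc(2) yv)
      also have "\<dots> = y \<otimes> (lam b \<otimes> lam v) \<otimes> inv y"
        using yc(1) bE(1) v(1) by (simp add: word_simps)
      also have "\<dots> = (y \<otimes> lam v \<otimes> inv y) \<otimes> (y \<otimes> lam b \<otimes> inv y)"
        unfolding lam_commute[OF bE(1) v(1) bE(3)] using yc(1) bE(1) v(1) by (simp add: word_simps)
      finally show ?thesis by (simp only: yc(2) yv)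
    qed
    have "p \<otimes> t \<notin> par (st v)" if t: "t \<in> par (st v)" for t
    proof
      assume "p \<otimes> t \<in> par (st v)"
      then have "p \<otimes> t \<otimes> inv t \<in> par (st v)" using t by blast
      then have "p \<in> par (st v)" using pc par_closed[OF t] by (simp add: m_assoc)
      then have "p \<otimes> inv p \<in> conjugators F v"
        using conjugators_star(1)[OF v(1)] p a0v by blast
      then show False using a0 a0v pc by simp
    qed
    \<comment> \<open>Each \<open>F b\<close> with \<open>b\<close> in the link of \<open>v\<close>
      stabilises both \<open>par (st v)\<close> and its disjoint translate by \<open>p\<close>. The
      vertex \<open>w\<close> obtained is the same for all \<open>b\<close>, so its star would
      contain the whole link of \<open>v\<close>.\<close>
    from common_stabiliser[OF pc(1) this] obtain w where w: "w \<in> E" "w \<notin> st v"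
      "\<And>c e. c \<in> par (st v) \<Longrightarrow> inv p \<otimes> c \<otimes> p \<in> par (st v) \<Longrightarrow> expo e c \<noteq> 0 \<Longrightarrow> e \<in> lk w"
      by blast
    have "b \<in> st w" if b: "b \<in> lk v" for b
    proof -
      have bE: "b \<in> E" "adj v b" using b by (auto simp: lk_def)
      have Fv: "p \<otimes> lam v \<otimes> inv p = F v" using p a0v by (simp add: conjugators_def)
      have "inv p \<otimes> F b \<otimes> p \<otimes> lam v = inv p \<otimes> (F b \<otimes> (p \<otimes> lam v \<otimes> inv p)) \<otimes> p"
        using pc v F[OF bE(1)] by (simp add: word_simps)
      also have "\<dots> = inv p \<otimes> ((p \<otimes> lam v \<otimes> inv p) \<otimes> F b) \<otimes> p"
        unfolding Fv using comm[OF v(1) bE] by simp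
      also have "\<dots> = lam v \<otimes> (inv p \<otimes> F b \<otimes> p)"
        using pc v F[OF bE(1)] by (simp add: word_simps)
      finally have "inv p \<otimes> F b \<otimes> p \<in> par (st v)"
        using pc v F[OF bE(1)] by (intro centraliser_lam) auto
      moreover have "F b \<in> par (st v)"
        using comm_v[OF b] v F[OF bE(1)] by (intro centraliser_lam) auto
      moreover have "expo b (F b) = 1"
      proof -
        obtain z where "z \<in> carrier G" "F b = z \<otimes> lam b \<otimes> inv z"
          using conj[OF bE(1)] by (auto simp: conjugators_def)
        then show ?thesis using bE by (simp add: expo_lam)
      qed
      ultimately show ?thesis using w(3)[of "F b" b] by (simp add: st_def)
    qed
    moreover have "v \<noteq> w" using w by (auto simp: st_def)
    ultimately show thesis using no_domination[of v w] v w by blast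
  qed
qed

lemma simultaneous_conjugator:
  assumes conj: "\<And>a. a \<in> E \<Longrightarrow> conjugators F a \<noteq> {}"
    and comm: "\<And>a b. a \<in> E \<Longrightarrow> b \<in> E \<Longrightarrow> adj a b \<Longrightarrow> F a \<otimes> F b = F b \<otimes> F a"
  obtains x where "x \<in> carrier G" "\<And>a. a \<in> E \<Longrightarrow> F a = x \<otimes> lam a \<otimes> inv x"
proof -
  define Fx where "Fx x a = inv x \<otimes> F a \<otimes> x" for x a
  have F: "F a \<in> carrier G" if "a \<in> E" for a
  proof -
    obtain z where "z \<in> conjugators F a" using conj[OF \<open>a \<in> E\<close>] by blast
    then have "z \<otimes> lam a \<otimes> inv z = F a" "z \<in> carrier G" by (auto simp: conjugators_def)
    then show ?thesis using that by (metis inv_closed lam_closed m_closed)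
  qed
  obtain x where x: "x \<in> carrier G"
    and min: "\<And>y. y \<in> carrier G \<Longrightarrow> (\<Sum>a\<in>E. card (cut (Fx x) a)) \<le> (\<Sum>a\<in>E. card (cut (Fx y) a))"
    using ex_has_least_nat[of "\<lambda>x. x \<in> carrier G" \<one> "\<lambda>x. \<Sum>a\<in>E. card (cut (Fx x) a)"] by blast
  have conj': "conjugators (Fx x) a \<noteq> {}" if "a \<in> E" for a
    using conjugators_conj[OF x that, of F] F[OF that] conj[OF that] by (simp add: Fx_def[abs_def])
  have comm': "Fx x a \<otimes> Fx x b = Fx x b \<otimes> Fx x a" if "a \<in> E" "b \<in> E" "adj a b" for a b
  proof -
    have "Fx x a \<otimes> Fx x b = inv x \<otimes> (F a \<otimes> F b) \<otimes> x"
      using x F that by (simp add: Fx_def word_simps)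
    also have "\<dots> = Fx x b \<otimes> Fx x a"
      unfolding comm[OF that] using x F that by (simp add: Fx_def word_simps)
    finally show ?thesis .
  qed
  have "\<one> \<in> conjugators (Fx x) a" if a: "a \<in> E" for a
  proof (rule ccontr)
    assume "\<one> \<notin> conjugators (Fx x) a"
    from cut_decrease[of "Fx x", OF conj' comm' a this] obtain c where c: "fst c \<in> E"
      "(\<Sum>a\<in>E. card (cut (\<lambda>a. inv (letter c) \<otimes> Fx x a \<otimes> letter c) a)) < (\<Sum>a\<in>E. card (cut (Fx x) a))"
      by blast
    \<comment> \<open>The further step across the edge of \<open>c\<close> leads to the base point
      \<open>x \<otimes> letter c\<close>, which also competes in the minimum.\<close>
    have "conjugators (\<lambda>a. inv (letter c) \<otimes> Fx x a \<otimes> letter c) b = conjugators (Fx (x \<otimes> letter c)) b"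
      if "b \<in> E" for b
      using x c(1) F[OF that] by (simp add: conjugators_def Fx_def word_simps)
    then have "(\<Sum>a\<in>E. card (cut (\<lambda>a. inv (letter c) \<otimes> Fx x a \<otimes> letter c) a))
        = (\<Sum>a\<in>E. card (cut (Fx (x \<otimes> letter c)) a))"
      by (intro sum.cong) (auto simp: cut_def)
    with c(2) min[of "x \<otimes> letter c"] x c(1) show False by simp
  qed
  then have "F a = x \<otimes> lam a \<otimes> inv x" if "a \<in> E" for a
    using that x F[OF that] by (auto simp: conjugators_def Fx_def word_simps)
  with x show thesis using that by blast
qed

theorem IA_endomorphism_inner:
  assumes \<phi>: "\<phi> \<in> hom G G" and expo: "\<And>g e. g \<in> carrier G \<Longrightarrow> e \<in> E \<Longrightarrow> expo e (\<phi> g) = expo e g"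
  obtains x where "x \<in> carrier G" "\<And>g. g \<in> carrier G \<Longrightarrow> \<phi> g = x \<otimes> g \<otimes> inv x"
proof -
  have \<phi>c: "\<phi> g \<in> carrier G" if "g \<in> carrier G" for g
    using \<phi> that by (auto simp: hom_def)
  have comm: "\<phi> (lam a) \<otimes> \<phi> (lam b) = \<phi> (lam b) \<otimes> \<phi> (lam a)" if "a \<in> E" "b \<in> E" "adj a b" for a b
    using hom_mult[OF \<phi>, of "lam a" "lam b"] hom_mult[OF \<phi>, of "lam b" "lam a"] lam_commute[OF that] that
    by simp
  have "conjugators (\<lambda>a. \<phi> (lam a)) a \<noteq> {}" if a: "a \<in> E" for a
  proof -
    have "\<exists>y u. y \<in> carrier G \<and> \<phi> (lam a) \<otimes> y = y \<otimes> \<phi> (lam a) \<and> u \<notin> lk b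
        \<and> expo u (\<phi> (lam a)) = 0 \<and> expo u y \<noteq> 0" if b: "b \<in> E" "b \<noteq> a" for b
    proof -
      \<comment> \<open>The test element is \<open>\<phi> (lam u)\<close>: it commutes with
        \<open>\<phi> (lam a)\<close> and, exponents being preserved, has exponent 1 in
        \<open>u\<close>.\<close>
      obtain u where u: "u \<in> lk a" "u \<notin> st b" using no_domination[OF a b(1)] b(2) by metis
      then have "u \<in> E" "adj a u" "u \<noteq> a" using adj_irrefl by (auto simp: lk_def)
      then show ?thesis
        using u a comm[of a u] \<phi>c[of "lam u"]
        by (intro exI[of _ "\<phi> (lam u)"] exI[of _ u]) (simp add: expo expo_lam st_def)
    qed
    note cent = this
    have "expo a (\<phi> (lam a)) = 1" using a by (simp add: expo expo_lam)
    from conjugate_of_generator[OF a \<phi>c[OF lam_closed[OF a]] this cent]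
    obtain g where "g \<in> carrier G" "\<phi> (lam a) = g \<otimes> lam a \<otimes> inv g" by blast
    then show ?thesis by (auto simp: conjugators_def)
  qed
  from simultaneous_conjugator[of "\<lambda>a. \<phi> (lam a)", OF this comm] obtain x where
    x: "x \<in> carrier G" "\<And>a. a \<in> E \<Longrightarrow> \<phi> (lam a) = x \<otimes> lam a \<otimes> inv x" by blast
  have "(\<lambda>g. x \<otimes> g \<otimes> inv x) \<in> hom G G"
    using x(1) by (intro homI) (auto simp: word_simps)
  from hom_eqI[OF is_group \<phi> this x(2)] x(1) show thesis by (rule that[rotated])
qed

end


section \<open>IA automorphisms of right-angled Artin groups\<close>

lemma (in group) IA_auto_derived:
  assumes "\<phi> \<in> IA_auto G" "g \<in> carrier G"
  obtains d where "d \<in> derived G (carrier G)" "\<phi> g = d \<otimes> g"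
proof -
  let ?D = "derived G (carrier G)"
  interpret D: normal ?D G by (rule derived_is_normal) (rule normal_self)
  have "?D #> g \<in> carrier (abelianisation G)"
    using assms(2) by (auto simp: abelianisation_def carrier_FactGroup)
  then have "\<phi> ` (?D #> g) = ?D #> g" using assms(1) by (auto simp: IA_auto_def)
  moreover have "g \<in> ?D #> g" by (rule rcos_self[OF assms(2) D.subgroup_axioms])
  ultimately have "\<phi> g \<in> ?D #> g" by blast
  then show thesis using that by (auto simp: r_coset_def)
qed

lemma (in group) IA_auto_comm:
  assumes "\<And>x y. x \<in> carrier G \<Longrightarrow> y \<in> carrier G \<Longrightarrow> x \<otimes> y = y \<otimes> x" "\<phi> \<in> IA_auto G"
  shows "\<phi> \<in> inner_auto G"
proof -
  interpret comm_group G by (rule group_comm_groupI) (rule assms(1))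
  have "\<phi> g = g" if "g \<in> carrier G" for g
    using IA_auto_derived[OF assms(2) that] derived_eq_singleton[of "carrier G"] that by auto
  moreover have "\<phi> \<in> extensional (carrier G)"
    using assms(2) by (auto simp: IA_auto_def auto_def Bij_def)
  ultimately have "\<phi> = (\<lambda>x\<in>carrier G. \<one> \<otimes> x \<otimes> inv \<one>)"
    by (intro extensionalityI[of \<phi> "carrier G"]) auto
  then show ?thesis unfolding inner_auto_def by blast
qed

context raag
begin

lemma expo_derived:
  assumes "d \<in> derived G (carrier G)"
  shows "expo e d = 0"
proof -
  have "d \<in> carrier G \<and> expo e d = 0"
    using assms unfolding derived_def
  proof (induction rule: generate.induct)
    case (inv h)
    then show ?case by auto
  next
    case (incl h)
    then show ?case by auto
  qed auto
  then show ?thesis by blast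
qed

lemma IA_auto_expo:
  assumes "\<phi> \<in> IA_auto G" "g \<in> carrier G"
  shows "expo e (\<phi> g) = expo e g"
proof -
  obtain d where d: "d \<in> derived G (carrier G)" "\<phi> g = d \<otimes> g"
    using IA_auto_derived[OF assms] .
  moreover have "d \<in> carrier G" using d(1) derived_in_carrier[of "carrier G"] by auto
  ultimately show ?thesis using assms(2) by (simp add: expo_derived)
qed

text \<open>As the derived subgroup is normal, the property that
  \<open>\<phi> g \<otimes> inv g\<close> lies in it passes to inverses and products, hence from the
  generators to all words.\<close>

lemma IA_autoI:
  assumes "\<phi> \<in> auto G" "\<And>e. e \<in> E \<Longrightarrow> \<phi> (lam e) \<otimes> inv (lam e) \<in> derived G (carrier G)"
  shows "\<phi> \<in> IA_auto G"
proof -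
  let ?D = "derived G (carrier G)"
  interpret D: normal ?D G by (rule derived_is_normal) (rule normal_self)
  interpret \<phi>: group_hom G G \<phi>
    using assms(1) by unfold_locales (auto simp: auto_def)
  have DC: "d \<in> carrier G" if "d \<in> ?D" for d using D.subset that by blast
  have ev: "\<phi> (ev w) \<otimes> inv (ev w) \<in> ?D" if "w \<in> gwords E" for w
    using that
  proof (induction w)
    case (Cons c w)
    then have c: "fst c \<in> E" and w: "w \<in> gwords E" by auto
    define e where "e = lam (fst c)"
    define d where "d = \<phi> e \<otimes> inv e"
    define k where "k = \<phi> (ev w) \<otimes> inv (ev w)"
    have e: "e \<in> carrier G" using c by (simp add: e_def)
    have d: "d \<in> ?D" using assms(2)[OF c] by (simp add: d_def e_def)
    have k: "k \<in> ?D" using Cons.IH[OF w] by (simp add: k_def)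
    have \<phi>e: "\<phi> e = d \<otimes> e" using e by (simp add: d_def m_assoc)
    have "\<phi> (letter c) \<otimes> inv (letter c) \<in> ?D"
    proof (cases "snd c")
      case True
      then show ?thesis using d by (simp add: letter_def d_def e_def)
    next
      case False
      then have "\<phi> (letter c) \<otimes> inv (letter c) = inv e \<otimes> inv d \<otimes> e"
        using e DC[OF d] by (simp add: letter_def \<phi>e word_simps flip: e_def)
      then show ?thesis using D.inv_op_closed1[OF e, of "inv d"] d by simp
    qed
    moreover have "\<phi> (ev (c # w)) \<otimes> inv (ev (c # w)) =
        (\<phi> (letter c) \<otimes> inv (letter c)) \<otimes> (letter c \<otimes> k \<otimes> inv (letter c))"
      using c w by (simp add: k_def word_simps)
    moreover have "letter c \<otimes> k \<otimes> inv (letter c) \<in> ?D"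
      using D.inv_op_closed2[of "letter c" k] c k by simp
    ultimately show ?case by simp
  qed simp
  have "\<phi> ` K = K" if K: "K \<in> carrier (abelianisation G)" for K
  proof -
    obtain x where x: "x \<in> carrier G" "K = ?D #> x"
      using K by (auto simp: abelianisation_def carrier_FactGroup)
    obtain w where "w \<in> gwords E" "ev w = x" using word_exists[OF x(1)] .
    then have "\<phi> x \<otimes> inv x \<in> ?D" using ev by blast
    then have "(\<phi> x \<otimes> inv x) \<otimes> x \<in> ?D #> x" by (auto simp: r_coset_def)
    then have "\<phi> x \<in> ?D #> x" using x(1) by (simp add: m_assoc)
    then have "?D #> x = ?D #> \<phi> x"
      by (rule repr_independence[OF _ x(1) D.subgroup_axioms])
    then show ?thesis using auto_image_coset[OF assms(1) x(1)] x(2) by simp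
  qed
  then show ?thesis using assms(1) by (simp add: IA_auto_def)
qed

text \<open>Conjugating by \<open>a\<close> the generators in a union \<open>C\<close> of components of the graph is an \<open>IA\<close>
  automorphism; a homomorphism \<open>f\<close> detects that it is not inner.\<close>

lemma partial_conjugation_not_inner:
  assumes a: "a \<in> E" "a \<notin> C" and d: "d \<in> E" "d \<in> C" and d': "d' \<in> E" "d' \<notin> C"
    and closed: "\<And>x y. x \<in> E \<Longrightarrow> y \<in> E \<Longrightarrow> adj x y \<Longrightarrow> x \<in> C \<Longrightarrow> y \<in> C"
    and H: "group H" "f \<in> E \<rightarrow> carrier H"
      "\<And>x y. x \<in> E \<Longrightarrow> y \<in> E \<Longrightarrow> adj x y \<Longrightarrow> f x \<otimes>\<^bsub>H\<^esub> f y = f y \<otimes>\<^bsub>H\<^esub> f x"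
    and f: "f d = f d'" "f a \<otimes>\<^bsub>H\<^esub> f d \<noteq> f d \<otimes>\<^bsub>H\<^esub> f a"
  shows "\<exists>\<phi>\<in>IA_auto G. \<phi> \<notin> inner_auto G"
proof -
  define p where "p g e = (if e \<in> C then g \<otimes> lam e \<otimes> inv g else lam e)" for g e
  have hom: "\<exists>h. h \<in> hom G G \<and> (\<forall>e\<in>E. h (lam e) = p g e)" if g: "g \<in> carrier G" for g
  proof -
    have "p g \<in> E \<rightarrow> carrier G" using g by (auto simp: p_def)
    moreover have "p g x \<otimes> p g y = p g y \<otimes> p g x" if xy: "x \<in> E" "y \<in> E" "adj x y" for x y
    proof (cases "x \<in> C")
      case True
      then have "y \<in> C" using closed xy by blast
      then have "p g x \<otimes> p g y = g \<otimes> (lam x \<otimes> lam y) \<otimes> inv g"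
        using True g xy by (simp add: p_def word_simps)
      also have "\<dots> = p g y \<otimes> p g x"
        unfolding lam_commute[OF xy] using True \<open>y \<in> C\<close> g xy by (simp add: p_def word_simps)
      finally show ?thesis .
    next
      case False
      then have "y \<notin> C" using closed[of y x] xy adj_sym by blast
      with False show ?thesis using lam_commute[OF xy] by (simp add: p_def)
    qed
    ultimately show ?thesis using hom_exists[OF is_group, of "p g"] by metis
  qed
  have la: "lam a \<in> carrier G" using a by simp
  obtain h1 h2 where h1: "h1 \<in> hom G G" "\<And>e. e \<in> E \<Longrightarrow> h1 (lam e) = p (lam a) e"
    and h2: "h2 \<in> hom G G" "\<And>e. e \<in> E \<Longrightarrow> h2 (lam e) = p (inv lam a) e"
    using hom[OF la] hom[of "inv lam a"] la by (metis inv_closed)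
  interpret h1: group_hom G G h1 using h1(1) by unfold_locales
  interpret h2: group_hom G G h2 using h2(1) by unfold_locales
  \<comment> \<open>Since \<open>a\<close> lies outside \<open>C\<close>, both maps fix the
    conjugating element, which makes them inverse to each other.\<close>
  have ha: "h1 (lam a) = lam a" "h2 (lam a) = lam a" using h1(2) h2(2) a by (auto simp: p_def)
  have "h1 (h2 (lam e)) = lam e" "h2 (h1 (lam e)) = lam e" if "e \<in> E" for e
    using that la ha by (auto simp: h1(2) h2(2) p_def word_simps)
  then have gens: "(h1 \<circ> h2) (lam e) = (\<lambda>x. x) (lam e)" "(h2 \<circ> h1) (lam e) = (\<lambda>x. x) (lam e)"
    if "e \<in> E" for e using that by auto
  have homs: "h1 \<circ> h2 \<in> hom G G" "h2 \<circ> h1 \<in> hom G G" "(\<lambda>x. x) \<in> hom G G"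
    by (auto intro: homI)
  have inv12: "h1 (h2 x) = x" "h2 (h1 x) = x" if "x \<in> carrier G" for x
    using hom_eqI[OF is_group homs(1,3) gens(1) that] hom_eqI[OF is_group homs(2,3) gens(2) that]
    by auto
  define \<phi> where "\<phi> = restrict h1 (carrier G)"
  have bij: "bij_betw h1 (carrier G) (carrier G)"
    by (rule bij_betw_byWitness[where f' = h2]) (auto simp: inv12)
  have \<phi>_auto: "\<phi> \<in> auto G"
    unfolding auto_def Bij_def
  proof (intro IntI CollectI)
    show "\<phi> \<in> hom G G" unfolding \<phi>_def by (intro homI) auto
    show "bij_betw \<phi> (carrier G) (carrier G)"
      using bij by (simp add: \<phi>_def)
  qed (simp add: \<phi>_def)
  have \<phi>_lam: "\<phi> (lam e) = p (lam a) e" if "e \<in> E" for e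
    using that h1(2) by (simp add: \<phi>_def)
  have "\<phi> (lam e) \<otimes> inv lam e \<in> derived G (carrier G)" if e: "e \<in> E" for e
  proof (cases "e \<in> C")
    case True
    then have "\<phi> (lam e) \<otimes> inv lam e = lam a \<otimes> lam e \<otimes> inv lam a \<otimes> inv lam e"
      using \<phi>_lam[OF e] by (simp add: p_def)
    then show ?thesis
      unfolding derived_def using la e by (auto intro!: generate.incl)
  next
    case False
    then show ?thesis using \<phi>_lam[OF e] e by (simp add: p_def derived_def generate.one)
  qed
  then have "\<phi> \<in> IA_auto G" by (intro IA_autoI \<phi>_auto)
  moreover have "\<phi> \<notin> inner_auto G"
  proof
    assume "\<phi> \<in> inner_auto G"
    then obtain g where g: "g \<in> carrier G" "\<phi> = (\<lambda>x\<in>carrier G. g \<otimes> x \<otimes> inv g)"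
      by (auto simp: inner_auto_def)
    interpret H: group H by fact
    obtain h where h: "h \<in> hom G H" "\<And>e. e \<in> E \<Longrightarrow> h (lam e) = f e"
      using hom_exists[OF H] by metis
    interpret h: group_hom G H h using h(1) by unfold_locales
    \<comment> \<open>The unmoved generator \<open>d'\<close> and the moved one \<open>d\<close>
      have the same image under \<open>h\<close>, so a common conjugator \<open>g\<close> would
      force \<open>f a\<close> to commute with that image.\<close>
    have eq: "g \<otimes> lam e \<otimes> inv g = p (lam a) e" if "e \<in> E" for e
      using \<phi>_lam[OF that] g that by simp
    have "h g \<otimes>\<^bsub>H\<^esub> f d' \<otimes>\<^bsub>H\<^esub> inv\<^bsub>H\<^esub> h g = f d'"
      using arg_cong[OF eq[OF d'(1)], of h] g(1) d' h(2) by (simp add: p_def)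
    moreover have "h g \<otimes>\<^bsub>H\<^esub> f d \<otimes>\<^bsub>H\<^esub> inv\<^bsub>H\<^esub> h g = f a \<otimes>\<^bsub>H\<^esub> f d \<otimes>\<^bsub>H\<^esub> inv\<^bsub>H\<^esub> f a"
      using arg_cong[OF eq[OF d(1)], of h] g(1) d la h(2) a(1) by (simp add: p_def)
    ultimately have "f a \<otimes>\<^bsub>H\<^esub> f d \<otimes>\<^bsub>H\<^esub> inv\<^bsub>H\<^esub> f a = f d" using f(1) by simp
    from arg_cong[OF this, of "\<lambda>x. x \<otimes>\<^bsub>H\<^esub> f a"]
    have "f a \<otimes>\<^bsub>H\<^esub> f d = f d \<otimes>\<^bsub>H\<^esub> f a"
      using H(2) a(1) d(1) by (simp add: H.m_assoc Pi_iff)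
    with f(2) show False by blast
  qed
  ultimately show ?thesis by blast
qed

end


section \<open>Words in the pairs\<close>

type_synonym edge = "nat \<times> nat"

definition edges :: "nat \<Rightarrow> edge set"
  where "edges n = {(i, j). 1 \<le> i \<and> i < j \<and> j \<le> n}"

definition disjoint_edges :: "edge \<Rightarrow> edge \<Rightarrow> bool"
  where "disjoint_edges e f \<longleftrightarrow> fst e < snd e \<and> fst f < snd f \<and> {fst e, snd e} \<inter> {fst f, snd f} = {}"

text \<open>The signed letter standing for \<open>\<lambda>\<^sub>i\<^sub>j\<close>, where \<open>\<lambda>\<^sub>j\<^sub>i\<close> is the inverse of \<open>\<lambda>\<^sub>i\<^sub>j\<close>.\<close>

definition signed :: "nat \<Rightarrow> nat \<Rightarrow> edge \<times> bool"
  where "signed i j = (if i < j then ((i, j), True) else ((j, i), False))"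

text \<open>The effect on a pure generator of conjugation by a word in the \<open>\<rho> i\<close>
  with permutation \<open>p\<close>; reversing the order of the indices costs an inversion.\<close>

definition relabel :: "(nat \<Rightarrow> nat) \<Rightarrow> edge \<times> bool \<Rightarrow> edge \<times> bool"
  where "relabel p c = (if snd c then signed (p (fst (fst c))) (p (snd (fst c)))
     else signed (p (snd (fst c))) (p (fst (fst c))))"

lemma signed_edges: "i \<in> {1..n} \<Longrightarrow> j \<in> {1..n} \<Longrightarrow> i \<noteq> j \<Longrightarrow> fst (signed i j) \<in> edges n"
  by (auto simp: signed_def edges_def)

lemma signed_cases:
  assumes "fst c \<in> edges n"
  obtains i j where "i \<in> {1..n}" "j \<in> {1..n}" "i \<noteq> j" "c = signed i j"
proof (cases "snd c")
  case True
  then show ?thesis using assms that[of "fst (fst c)" "snd (fst c)"]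
    by (cases c) (auto simp: edges_def signed_def)
next
  case False
  then show ?thesis using assms that[of "snd (fst c)" "fst (fst c)"]
    by (cases c) (auto simp: edges_def signed_def)
qed

lemma signed_flip: "i \<noteq> j \<Longrightarrow> (fst (signed i j), \<not> snd (signed i j)) = signed j i"
  by (auto simp: signed_def)

lemma relabel_signed: "i \<noteq> j \<Longrightarrow> relabel p (signed i j) = signed (p i) (p j)"
  by (auto simp: signed_def relabel_def)

lemma relabel_edges:
  assumes "p permutes {1..n}" "fst c \<in> edges n"
  shows "fst (relabel p c) \<in> edges n"
proof -
  obtain i j where ij: "i \<in> {1..n}" "j \<in> {1..n}" "i \<noteq> j" "c = signed i j" using signed_cases[OF assms(2)] .
  then have "p i \<noteq> p j" using permutes_inj[OF assms(1)] by (auto dest: injD)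
  then show ?thesis
    using ij permutes_in_image[OF assms(1)] by (simp add: relabel_signed signed_edges del: atLeastAtMost_iff)
qed

lemma relabel_comp:
  assumes "inj q" "fst c \<in> edges n"
  shows "relabel p (relabel q c) = relabel (p \<circ> q) c"
proof -
  obtain i j where ij: "i \<noteq> j" "c = signed i j" using signed_cases[OF assms(2)] by metis
  then have "q i \<noteq> q j" using assms(1) by (auto dest: injD)
  then show ?thesis using ij by (simp add: relabel_signed)
qed

lemma relabel_id: "fst c \<in> edges n \<Longrightarrow> relabel id c = c"
  using signed_cases[of c n] relabel_signed[of _ _ id] by (metis id_apply)

abbreviation edge_rel :: "nat \<Rightarrow> (edge gword \<times> edge gword) set"
  where "edge_rel n \<equiv> pres_rel (edges n) (raag_rels (edges n) disjoint_edges)"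

text \<open>The defining relations mention positive letters only; in the quotient group commutation
  extends to inverses.\<close>

lemma edge_rel_commute:
  assumes "fst c \<in> edges n" "fst d \<in> edges n" "disjoint_edges (fst c) (fst d)"
  shows "([c, d], [d, c]) \<in> edge_rel n"
proof -
  interpret A: group "presented_group (edges n) (raag_rels (edges n) disjoint_edges)"
    by (rule group_presented_group)
  let ?A = "presented_group (edges n) (raag_rels (edges n) disjoint_edges)"
  define q where "q w = edge_rel n `` {w}" for w
  have q_app: "q (u @ v) = q u \<otimes>\<^bsub>?A\<^esub> q v" if "u \<in> gwords (edges n)" "v \<in> gwords (edges n)" for u v
    using presented_mult_class[OF that] by (simp add: q_def)
  have q_eq: "q u = q v \<longleftrightarrow> (u, v) \<in> edge_rel n" if "u \<in> gwords (edges n)" "v \<in> gwords (edges n)" for u v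
    using that by (simp add: q_def eq_equiv_class_iff[OF equiv_pres_rel])
  have q_car: "q u \<in> carrier ?A" if "u \<in> gwords (edges n)" for u
    using presented_carrierI[OF that] by (simp add: q_def)
  have q_one: "q [] = \<one>\<^bsub>?A\<^esub>" by (simp add: q_def presented_one)
  have q_inv: "q [(e, False)] = inv\<^bsub>?A\<^esub> q [(e, True)]" if e: "e \<in> edges n" for e
  proof -
    have "q [(e, False), (e, True)] = q []"
      using pres_rel.cancel[OF e, of False] e by (subst q_eq) auto
    then have "q [(e, False)] \<otimes>\<^bsub>?A\<^esub> q [(e, True)] = \<one>\<^bsub>?A\<^esub>"
      using q_app[of "[(e, False)]" "[(e, True)]"] e q_one by simp
    then show ?thesis using e by (intro A.inv_equality[symmetric] q_car) auto
  qed
  obtain e f b b' where cd: "c = (e, b)" "d = (f, b')" by (metis surj_pair)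
  have ef: "e \<in> edges n" "f \<in> edges n" "disjoint_edges e f" using assms cd by auto
  have car: "q [(e, x)] \<in> carrier ?A" "q [(f, x)] \<in> carrier ?A" for x
    using ef q_car by auto
  have "([(e, True), (f, True)], [(f, True), (e, True)]) \<in> edge_rel n"
  proof (rule pres_rel.defining)
    show "([(e, True), (f, True)], [(f, True), (e, True)]) \<in> raag_rels (edges n) disjoint_edges"
      using ef unfolding raag_rels_def by blast
  qed (use ef in auto)
  then have "q [(e, True), (f, True)] = q [(f, True), (e, True)]"
    using ef by (subst q_eq) auto
  then have TT: "q [(e, True)] \<otimes>\<^bsub>?A\<^esub> q [(f, True)] = q [(f, True)] \<otimes>\<^bsub>?A\<^esub> q [(e, True)]"
    using q_app[of "[(e, True)]" "[(f, True)]"] q_app[of "[(f, True)]" "[(e, True)]"] ef by simp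
  have FT: "q [(e, x)] \<otimes>\<^bsub>?A\<^esub> q [(f, True)] = q [(f, True)] \<otimes>\<^bsub>?A\<^esub> q [(e, x)]" for x
    using A.commute_conj(3)[OF car TT] TT q_inv ef by (cases x) auto
  have "q [(e, x)] \<otimes>\<^bsub>?A\<^esub> q [(f, y)] = q [(f, y)] \<otimes>\<^bsub>?A\<^esub> q [(e, x)]" for x y
    using A.commute_conj(3)[OF car(2) car(1) FT[symmetric], of x] FT[of x] q_inv ef by (cases y) auto
  then have "q [c, d] = q [d, c]"
    using q_app[of "[c]" "[d]"] q_app[of "[d]" "[c]"] ef cd by simp
  then show ?thesis using ef cd by (subst (asm) q_eq) auto
qed

lemma signed_commute:
  assumes "{i, j, k, l} \<subseteq> {1..n}" "distinct [i, j, k, l]"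
  shows "([signed i j, signed k l], [signed k l, signed i j]) \<in> edge_rel n"
proof (rule edge_rel_commute)
  show "fst (signed i j) \<in> edges n" "fst (signed k l) \<in> edges n"
    using assms by (auto intro!: signed_edges simp del: One_nat_def)
  show "disjoint_edges (fst (signed i j)) (fst (signed k l))"
    using assms(2) by (auto simp: signed_def disjoint_edges_def)
qed

lemma signed_cancel:
  assumes "i \<in> {1..n}" "j \<in> {1..n}" "i \<noteq> j"
  shows "([signed i j, signed j i], []) \<in> edge_rel n"
  using pres_rel.cancel[OF signed_edges[OF assms], of "snd (signed i j)"] signed_flip[OF assms(3)] by simp

lemma relabel_gwords:
  "p permutes {1..n} \<Longrightarrow> w \<in> gwords (edges n) \<Longrightarrow> map (relabel p) w \<in> gwords (edges n)"
  by (auto simp: gwords_iff relabel_edges)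

text \<open>Permutations preserve disjointness of pairs and send inverse letters to inverse letters,
  so the symmetric group acts on the Artin group.\<close>

lemma relabel_rel:
  assumes p: "p permutes {1..n}" and "(u, v) \<in> edge_rel n"
  shows "(map (relabel p) u, map (relabel p) v) \<in> edge_rel n"
  using assms(2)
proof (induction rule: pres_rel.induct)
  case (refl w)
  then show ?case by (intro pres_rel.refl relabel_gwords p)
next
  case (cancel x b)
  then obtain i j where ij: "i \<in> {1..n}" "j \<in> {1..n}" "i \<noteq> j" "(x, b) = signed i j"
    using signed_cases[of "(x, b)" n] by auto
  then have "p i \<noteq> p j" using permutes_inj[OF p] by (auto dest: injD)
  moreover have "(x, \<not> b) = signed j i" using signed_flip[OF ij(3)] ij(4) by (metis fst_conv snd_conv)
  ultimately show ?case
    using ij signed_cancel[of "p i" n "p j"] permutes_in_image[OF p]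
    by (simp add: relabel_signed del: atLeastAtMost_iff)
next
  case (defining u v)
  then obtain x y where xy: "u = [(x, True), (y, True)]" "v = [(y, True), (x, True)]"
    "x \<in> edges n" "y \<in> edges n" "disjoint_edges x y" by (auto simp: raag_rels_def)
  obtain i j k l where ijkl: "x = (i, j)" "y = (k, l)" by (metis surj_pair)
  have d: "distinct [i, j, k, l]" "{i, j, k, l} \<subseteq> {1..n}"
    using xy by (auto simp: ijkl disjoint_edges_def edges_def)
  have "distinct [p i, p j, p k, p l]"
    using d(1) permutes_inj[OF p] by (auto dest: injD)
  moreover have "{p i, p j, p k, p l} \<subseteq> {1..n}"
    using d(2) permutes_in_image[OF p] by (auto simp del: atLeastAtMost_iff)
  ultimately show ?case using signed_commute by (simp add: xy ijkl relabel_def)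
qed (auto intro: pres_rel.sym pres_rel.trans pres_rel.append)

section \<open>Action of the virtual twin generators on words in the pairs\<close>

primrec gen_index :: "vt_gen \<Rightarrow> nat" where
  "gen_index (Sgen i) = i"
| "gen_index (Rgen i) = i"

definition swap :: "nat \<Rightarrow> nat \<Rightarrow> nat" where "swap i = transpose i (i + 1)"

lemma swap_permutes: "i \<in> {1..<n} \<Longrightarrow> swap i permutes {1..n}"
  unfolding swap_def by (intro permutes_swap_id) auto

lemma swap_braid: "swap i \<circ> swap (Suc i) \<circ> swap i = swap (Suc i) \<circ> swap i \<circ> swap (Suc i)"
proof
  fix x
  consider "x = i" | "x = Suc i" | "x = Suc (Suc i)" | "x \<notin> {i, Suc i, Suc (Suc i)}" by blast
  then show "(swap i \<circ> swap (Suc i) \<circ> swap i) x = (swap (Suc i) \<circ> swap i \<circ> swap (Suc i)) x"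
    by cases (simp_all add: swap_def)
qed

lemma swap_swap: "swap i \<circ> swap i = id"
  by (simp add: swap_def)

text \<open>The action of the virtual twin group on words in the pure generators: \<open>\<rho>\<^sub>i\<close> relabels, and
  \<open>s\<^sub>i = \<lambda>\<^sub>i\<^sub>,\<^sub>i\<^sub>+\<^sub>1 \<rho>\<^sub>i\<close> relabels and then multiplies by \<open>\<lambda>\<^sub>i\<^sub>,\<^sub>i\<^sub>+\<^sub>1\<close>.\<close>

definition act_gen :: "vt_gen \<times> bool \<Rightarrow> edge gword \<Rightarrow> edge gword"
  where "act_gen c w =
    (case fst c of Sgen i \<Rightarrow> [signed i (i + 1)] | Rgen i \<Rightarrow> []) @ map (relabel (swap (gen_index (fst c)))) w"

definition act_word :: "vt_gen gword \<Rightarrow> edge gword \<Rightarrow> edge gword"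
  where "act_word u w = foldr act_gen u w"

lemma act_word_simps [simp]:
  "act_word [] w = w"
  "act_word (c # u) w = act_gen c (act_word u w)"
  "act_word (u @ v) w = act_word u (act_word v w)"
  by (simp_all add: act_word_def)

text \<open>The bound 5 is spent here: each rigidity condition asks for an index off at most four
  given ones.\<close>

lemma fresh_index:
  assumes "5 \<le> n"
  obtains t :: nat where "t \<in> {1..n}" "t \<notin> {a, b, c, d}"
proof -
  have "card {a, b, c, d} \<le> 4" by (simp add: card_insert_if)
  then have "\<not> {1..n} \<subseteq> {a, b, c, d}"
    using assms card_mono[of "{a, b, c, d}" "{1..n}"] by auto
  then show thesis using that by blast
qed

definition pr :: "nat \<Rightarrow> nat \<Rightarrow> edge" where "pr x y = (min x y, max x y)"

lemma pr_edges: "x \<in> {1..n} \<Longrightarrow> y \<in> {1..n} \<Longrightarrow> x \<noteq> y \<Longrightarrow> pr x y \<in> edges n"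
  by (auto simp: pr_def edges_def min_def max_def)

lemma disjoint_edges_pr: "x \<noteq> y \<Longrightarrow> z \<noteq> t \<Longrightarrow> disjoint_edges (pr x y) (pr z t) \<longleftrightarrow> {x, y} \<inter> {z, t} = {}"
  by (auto simp: pr_def disjoint_edges_def min_def max_def)

lemma pr_eq_iff: "pr x y = pr z t \<longleftrightarrow> (x = z \<and> y = t) \<or> (x = t \<and> y = z)"
  by (auto simp: pr_def min_def max_def)

lemma edges_pr:
  assumes "e \<in> edges n"
  obtains x y where "x \<in> {1..n}" "y \<in> {1..n}" "x \<noteq> y" "e = pr x y"
  using assms that[of "fst e" "snd e"] by (cases e) (auto simp: edges_def pr_def)


section \<open>The virtual twin group\<close>

locale virtual_twin =
  fixes n :: nat and G (structure)
  assumes n_ge_2: "2 \<le> n" and G_def: "G = VT n"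

sublocale virtual_twin \<subseteq> group G
  unfolding G_def VT_def by (rule group_presented_group)

context virtual_twin
begin

section \<open>Relations between the generators\<close>

definition vt :: "vt_gen gword \<Rightarrow> vt_gen gword set"
  where "vt w = pres_rel (vt_gens n) (vt_rels n) `` {w}"

definition s :: "nat \<Rightarrow> vt_gen gword set" where "s i = vt [\<s> i]"
definition r :: "nat \<Rightarrow> vt_gen gword set" where "r i = vt [\<rho> i]"

lemma vt_Nil: "vt [] = \<one>"
  by (simp add: vt_def G_def VT_def presented_one)

lemma vt_append: "u \<in> gwords (vt_gens n) \<Longrightarrow> v \<in> gwords (vt_gens n) \<Longrightarrow> vt (u @ v) = vt u \<otimes> vt v"
  by (simp add: vt_def G_def VT_def presented_mult_class)

lemma vt_closed [simp, intro]: "u \<in> gwords (vt_gens n) \<Longrightarrow> vt u \<in> carrier G"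
  by (simp add: vt_def G_def VT_def presented_carrierI)

lemma vt_eq_iff:
  "u \<in> gwords (vt_gens n) \<Longrightarrow> v \<in> gwords (vt_gens n) \<Longrightarrow>
    vt u = vt v \<longleftrightarrow> (u, v) \<in> pres_rel (vt_gens n) (vt_rels n)"
  by (simp add: vt_def eq_equiv_class_iff[OF equiv_pres_rel])

lemma vt_carrierE:
  assumes "g \<in> carrier G"
  obtains u where "u \<in> gwords (vt_gens n)" "g = vt u"
  using presented_carrierE[of g "vt_gens n" "vt_rels n"] assms that
  unfolding vt_def G_def VT_def by blast

lemma Sgen_in [simp]: "Sgen i \<in> vt_gens n \<longleftrightarrow> i \<in> {1..<n}"
  and Rgen_in [simp]: "Rgen i \<in> vt_gens n \<longleftrightarrow> i \<in> {1..<n}"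
  using n_ge_2 by (auto simp: vt_gens_def)

lemma s_closed [simp, intro]: "i \<in> {1..<n} \<Longrightarrow> s i \<in> carrier G"
  and r_closed [simp, intro]: "i \<in> {1..<n} \<Longrightarrow> r i \<in> carrier G"
  by (simp_all add: s_def r_def)

lemma vt_rel: "(u, v) \<in> vt_rels n \<Longrightarrow> vt u = vt v"
  using vt_rels_gwords by (subst vt_eq_iff) (auto intro: pres_rel.defining)

lemma vt_word2:
  assumes "fst a \<in> vt_gens n" "fst b \<in> vt_gens n"
  shows "vt [a, b] = vt [a] \<otimes> vt [b]"
  using vt_append[of "[a]" "[b]"] assms by simp

lemma vt_word3:
  assumes "fst a \<in> vt_gens n" "fst b \<in> vt_gens n" "fst c \<in> vt_gens n"
  shows "vt [a, b, c] = vt [a] \<otimes> vt [b] \<otimes> vt [c]"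
  using vt_append[of "[a, b]" "[c]"] vt_word2[of a b] assms by simp

lemma s_square: "i \<in> {1..<n} \<Longrightarrow> s i \<otimes> s i = \<one>"
  and r_square: "i \<in> {1..<n} \<Longrightarrow> r i \<otimes> r i = \<one>"
  using vt_rel[of "[\<s> i, \<s> i]" "[]"] vt_rel[of "[\<rho> i, \<rho> i]" "[]"]
  by (auto simp: s_def r_def vt_rels_def vt_word2 vt_Nil)

lemma far_commute:
  assumes "i \<in> {1..<n}" "j \<in> {1..<n}" "i + 2 \<le> j \<or> j + 2 \<le> i"
  shows "s i \<otimes> s j = s j \<otimes> s i" "r i \<otimes> r j = r j \<otimes> r i" "r i \<otimes> s j = s j \<otimes> r i"
proof -
  have "i \<in> {1..n - 1} \<and> j \<in> {1..n - 1} \<and> \<bar>int i - int j\<bar> \<ge> 2" using assms by auto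
  then have "([\<s> i, \<s> j], [\<s> j, \<s> i]) \<in> vt_rels n" "([\<rho> i, \<rho> j], [\<rho> j, \<rho> i]) \<in> vt_rels n"
    "([\<rho> i, \<s> j], [\<s> j, \<rho> i]) \<in> vt_rels n"
    unfolding vt_rels_def by blast+
  from this[THEN vt_rel] show "s i \<otimes> s j = s j \<otimes> s i" "r i \<otimes> r j = r j \<otimes> r i"
    "r i \<otimes> s j = s j \<otimes> r i"
    using assms(1,2) by (simp_all add: s_def r_def vt_word2)
qed

lemma braid: "i \<in> {1..<n - 1} \<Longrightarrow> r i \<otimes> r (i + 1) \<otimes> r i = r (i + 1) \<otimes> r i \<otimes> r (i + 1)"
  and mixed: "i \<in> {1..<n - 1} \<Longrightarrow> r i \<otimes> r (i + 1) \<otimes> s i = s (i + 1) \<otimes> r i \<otimes> r (i + 1)"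
proof -
  assume i: "i \<in> {1..<n - 1}"
  then have "i \<in> {1..n - 2}" and i': "i \<in> {1..<n}" "i + 1 \<in> {1..<n}" by auto
  from this(1) have "([\<rho> i, \<rho> (i + 1), \<rho> i], [\<rho> (i + 1), \<rho> i, \<rho> (i + 1)]) \<in> vt_rels n"
    "([\<rho> i, \<rho> (i + 1), \<s> i], [\<s> (i + 1), \<rho> i, \<rho> (i + 1)]) \<in> vt_rels n"
    unfolding vt_rels_def by blast+
  from this[THEN vt_rel] show "r i \<otimes> r (i + 1) \<otimes> r i = r (i + 1) \<otimes> r i \<otimes> r (i + 1)"
    "r i \<otimes> r (i + 1) \<otimes> s i = s (i + 1) \<otimes> r i \<otimes> r (i + 1)"
    using i' by (simp_all add: s_def r_def vt_word3)
qed

lemma r_inv: "i \<in> {1..<n} \<Longrightarrow> inv (r i) = r i"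
  and s_inv: "i \<in> {1..<n} \<Longrightarrow> inv (s i) = s i"
  by (simp_all add: inv_equality r_square s_square)

lemma vt_letter:
  assumes "fst c \<in> vt_gens n"
  shows "vt [c] = (case fst c of Sgen i \<Rightarrow> s i | Rgen i \<Rightarrow> r i)"
proof (cases "snd c")
  case True
  then show ?thesis by (cases c) (auto simp: s_def r_def split: vt_gen.split)
next
  case False
  have c: "c = (fst c, False)" using False by (cases c) auto
  have "vt [(fst c, False)] \<otimes> vt [(fst c, True)] = \<one>"
    using assms vt_eq_iff[of "[(fst c, False), (fst c, True)]" "[]"]
      pres_rel.cancel[of "fst c" "vt_gens n" False]
    by (simp add: vt_Nil flip: vt_word2)
  then have "vt [c] = inv (vt [(fst c, True)])"
    using assms c by (metis gwords_Cons gwords_Nil fst_conv inv_equality vt_closed inv_inv)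
  then show ?thesis
    using assms r_inv s_inv by (auto simp: s_def r_def split: vt_gen.splits)
qed

section \<open>The Coxeter presentation of the symmetric group\<close>

fun perm :: "nat list \<Rightarrow> nat \<Rightarrow> nat" where
  "perm [] = id"
| "perm (i # u) = transpose i (i + 1) \<circ> perm u"

fun rho_word :: "nat list \<Rightarrow> vt_gen gword set" where
  "rho_word [] = \<one>"
| "rho_word (i # u) = r i \<otimes> rho_word u"

lemma perm_append: "perm (u @ v) = perm u \<circ> perm v"
  by (induction u) (auto simp: o_assoc)

lemma rho_word_closed [simp, intro]: "u \<in> lists {1..<n} \<Longrightarrow> rho_word u \<in> carrier G"
  by (induction u) auto

lemma rho_word_append: "u \<in> lists {1..<n} \<Longrightarrow> v \<in> lists {1..<n} \<Longrightarrow> rho_word (u @ v) = rho_word u \<otimes> rho_word v"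
  by (induction u) (auto simp: m_assoc)

lemma perm_rev: "perm u (perm (rev u) x) = x" "perm (rev u) (perm u x) = x"
  by (induction u arbitrary: x) (auto simp: perm_append)

lemma rev_lists: "rev u \<in> lists A \<longleftrightarrow> u \<in> lists A"
  by (simp add: lists_eq_set)

lemma rho_word_rev: "u \<in> lists {1..<n} \<Longrightarrow> rho_word (rev u) = inv (rho_word u)"
  by (induction u) (simp_all add: rho_word_append inv_mult_group r_inv rev_lists)

lemma rho_word_vt: "u \<in> lists {1..<n} \<Longrightarrow> vt (map \<rho> u) = rho_word u"
proof (induction u)
  case (Cons i u)
  have "map \<rho> u \<in> gwords (vt_gens n)" using Cons.prems by (auto simp: gwords_iff)
  then show ?case using vt_append[of "[\<rho> i]" "map \<rho> u"] Cons by (simp add: r_def)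
qed (simp add: vt_Nil)

interpretation \<pi>: group_hom G "sym_group n" "vt_perm n"
  unfolding G_def by (rule vt_perm_group_hom)

lemma vt_perm_r: "i \<in> {1..<n} \<Longrightarrow> vt_perm n (r i) = transpose i (i + 1)"
  and vt_perm_s: "i \<in> {1..<n} \<Longrightarrow> vt_perm n (s i) = transpose i (i + 1)"
  using vt_perm_gen[of "Rgen i" n] vt_perm_gen[of "Sgen i" n] by (simp_all add: r_def s_def vt_def)

lemma vt_perm_rho_word: "u \<in> lists {1..<n} \<Longrightarrow> vt_perm n (rho_word u) = perm u"
proof (induction u)
  case Nil
  then show ?case using \<pi>.hom_one by (simp add: sym_group_one)
next
  case (Cons i u)
  then show ?case by (simp add: vt_perm_r sym_group_mult)
qed

lemma perm_eq_if_rho_word_eq: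
  "u \<in> lists {1..<n} \<Longrightarrow> v \<in> lists {1..<n} \<Longrightarrow> rho_word u = rho_word v \<Longrightarrow> perm u = perm v"
  using vt_perm_rho_word by metis

lemma perm_permutes: "u \<in> lists {a..<b} \<Longrightarrow> perm u permutes {a..b}"
proof (induction u)
  case (Cons i u)
  then have "transpose i (i + 1) permutes {a..b}" by (intro permutes_swap_id) auto
  moreover have "perm u permutes {a..b}" using Cons by simp
  ultimately show ?case unfolding perm.simps by (rule permutes_compose[rotated])
qed (simp add: permutes_id)

lemma rho_word_commute:
  assumes "u \<in> lists {1..<n}" "k \<in> {1..<n}" "\<And>i. i \<in> set u \<Longrightarrow> i + 2 \<le> k \<or> k + 2 \<le> i"
  shows "rho_word u \<otimes> r k = r k \<otimes> rho_word u"
  using assms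
proof (induction u)
  case (Cons i u)
  then have "r i \<otimes> rho_word u \<otimes> r k = r i \<otimes> r k \<otimes> rho_word u" by (simp add: m_assoc)
  also have "r i \<otimes> r k = r k \<otimes> r i"
    using Cons.hyps(1) Cons.prems(1) Cons.prems(2)[of i] by (intro far_commute) auto
  finally show ?case using Cons.hyps Cons.prems(1) by (simp add: m_assoc)
qed simp

text \<open>The run \<open>m, m - 1, ..., j\<close>; the value \<open>j = Suc m\<close> gives the
  empty list, which represents the trivial coset.\<close>

definition desc :: "nat \<Rightarrow> nat \<Rightarrow> nat list"
  where "desc m j = rev [j..<Suc m]"

lemma desc_lists: "1 \<le> j \<Longrightarrow> m < n \<Longrightarrow> desc m j \<in> lists {1..<n}"
  by (auto simp: desc_def)

lemma desc_snoc: "j \<le> m \<Longrightarrow> desc m j = desc m (Suc j) @ [j]"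
  by (simp add: desc_def upt_rec[of j])

lemma desc_split: "j \<le> k \<Longrightarrow> k \<le> Suc m \<Longrightarrow> 0 < k \<Longrightarrow> desc m j = desc m k @ desc (k - 1) j"
  using upt_add_eq_append[of j k "Suc m - k"] by (simp add: desc_def)

text \<open>The coset representatives \<open>desc m j\<close> of the symmetric group on \<open>{1..m}\<close> in the one on
  \<open>{1..m + 1}\<close> are permuted by right multiplication with a generator.\<close>

lemma desc_step:
  assumes m: "m < n" and j: "1 \<le> j" "j \<le> Suc m" and k: "1 \<le> k" "k \<le> m"
  shows "\<exists>u' j'. u' \<in> lists {1..<m} \<and> 1 \<le> j' \<and> j' \<le> Suc m \<and> rho_word (desc m j) \<otimes> r k = rho_word u' \<otimes> rho_word (desc m j')"
proof -
  consider "k + 1 = j" | "k = j" | "k + 2 \<le> j" | "j < k" using k j by linarith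
  then show ?thesis
  proof cases
    case 1
    then have "rho_word (desc m j) \<otimes> r k = rho_word (desc m k)"
      using desc_snoc[of k m] k m desc_lists[of j m] j by (simp add: rho_word_append)
    then show ?thesis using k m rho_word_closed[OF desc_lists[of k m]]
      by (intro exI[of _ "[]"] exI[of _ k]) simp
  next
    case 2
    then have "rho_word (desc m j) \<otimes> r k = rho_word (desc m (Suc j))"
      using desc_snoc[of j m] k m desc_lists[of "Suc j" m] by (simp add: rho_word_append m_assoc r_square)
    then show ?thesis using k m 2 rho_word_closed[OF desc_lists[of "Suc j" m]]
      by (intro exI[of _ "[]"] exI[of _ "Suc j"]) simp
  next
    case 3
    then have "rho_word (desc m j) \<otimes> r k = r k \<otimes> rho_word (desc m j)"
      using k m j by (intro rho_word_commute desc_lists) (auto simp: desc_def)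
    then show ?thesis using k m j 3 by (intro exI[of _ "[k]"] exI[of _ j]) auto
  next
    \<comment> \<open>Here \<open>k\<close> occurs inside the run, directly followed by
      \<open>k - 1\<close>. By the braid relation \<open>r k\<close> passes through the run from the
      right and emerges on the left as \<open>r (k - 1)\<close>.\<close>
    case 4
    then have k2: "k \<ge> 2" using j by simp
    define k' where "k' = k - 1"
    have k': "k = Suc k'" "1 \<le> k'" "j \<le> k'" using k2 4 by (auto simp: k'_def)
    define A where "A = desc m (Suc k)"
    define B where "B = desc (k' - 1) j"
    have "desc m j = desc m (Suc k) @ desc k j" using desc_split[of j "Suc k" m] k 4 by simp
    also have "desc k j = desc k k @ desc k' j" using desc_split[of j k k] k 4 by (simp add: k'_def)
    also have "desc k k = [k]" by (simp add: desc_def)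
    also have "desc k' j = desc k' k' @ B" using desc_split[of j k' k'] k' by (simp add: B_def)
    also have "desc k' k' = [k']" by (simp add: desc_def)
    finally have D: "desc m j = A @ [k, k'] @ B" by (simp add: A_def)
    have AB: "A \<in> lists {1..<n}" "B \<in> lists {1..<n}"
      using desc_lists[of j m] j m unfolding D by auto
    have kn: "k \<in> {1..<n}" "k' \<in> {1..<n}" using k k' m by auto
    have Ac: "rho_word A \<otimes> r k' = r k' \<otimes> rho_word A"
      by (rule rho_word_commute[OF AB(1) kn(2)]) (auto simp: A_def desc_def k')
    have Bc: "rho_word B \<otimes> r k = r k \<otimes> rho_word B"
      by (rule rho_word_commute[OF AB(2) kn(1)]) (use k' in \<open>auto simp: B_def desc_def\<close>)
    have br: "r k \<otimes> r k' \<otimes> r k = r k' \<otimes> r k \<otimes> r k'" using braid[of k'] k' kn m by simp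
    have "rho_word (desc m j) \<otimes> r k = rho_word A \<otimes> (r k \<otimes> r k') \<otimes> (rho_word B \<otimes> r k)"
      using AB kn by (simp add: D rho_word_append m_assoc)
    also have "\<dots> = rho_word A \<otimes> (r k \<otimes> r k' \<otimes> r k) \<otimes> rho_word B"
      unfolding Bc using AB kn by (simp add: m_assoc)
    also have "\<dots> = (rho_word A \<otimes> r k') \<otimes> (r k \<otimes> r k') \<otimes> rho_word B"
      unfolding br using AB kn by (simp add: m_assoc)
    also have "\<dots> = r k' \<otimes> rho_word (desc m j)"
      unfolding Ac using AB kn by (simp add: D rho_word_append m_assoc)
    finally show ?thesis
      using k' k j kn m by (intro exI[of _ "[k']"] exI[of _ j]) auto
  qed
qed

lemma normal_form:
  assumes m: "m < n" and u: "u \<in> lists {1..<Suc m}"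
  shows "\<exists>u' j. u' \<in> lists {1..<m} \<and> 1 \<le> j \<and> j \<le> Suc m \<and> rho_word u = rho_word (u' @ desc m j)"
  using u
proof (induction u rule: rev_induct)
  case Nil
  show ?case by (intro exI[of _ "[]"] exI[of _ "Suc m"]) (simp add: desc_def)
next
  case (snoc k u)
  then obtain u' j where u': "u' \<in> lists {1..<m}" "1 \<le> j" "j \<le> Suc m" "rho_word u = rho_word (u' @ desc m j)" by auto
  obtain v j' where v: "v \<in> lists {1..<m}" "1 \<le> j'" "j' \<le> Suc m"
    "rho_word (desc m j) \<otimes> r k = rho_word v \<otimes> rho_word (desc m j')"
    using desc_step[OF m u'(2,3), of k] snoc.prems by auto
  have l: "u' \<in> lists {1..<n}" "v \<in> lists {1..<n}" "u \<in> lists {1..<n}" "k \<in> {1..<n}"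
    "desc m j \<in> lists {1..<n}" "desc m j' \<in> lists {1..<n}"
    using u' v snoc.prems m desc_lists[of j m] desc_lists[of j' m] by auto
  have "rho_word (u @ [k]) = rho_word u' \<otimes> (rho_word (desc m j) \<otimes> r k)"
    using l u'(4) by (simp add: rho_word_append m_assoc)
  also have "\<dots> = rho_word ((u' @ v) @ desc m j')"
    unfolding v(4) using l by (simp add: rho_word_append m_assoc)
  finally show ?case using v u' by (intro exI[of _ "u' @ v"] exI[of _ j']) auto
qed

lemma perm_desc: "1 \<le> j \<Longrightarrow> j \<le> m \<Longrightarrow> perm (desc m j) j = Suc m"
proof (induction "m - j" arbitrary: j)
  case 0
  then have "j = m" by simp
  then show ?case by (simp add: desc_def)
next
  case (Suc d)
  then have "perm (desc m (Suc j)) (Suc j) = Suc m" by (intro Suc.hyps) auto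
  then show ?case using Suc.prems by (simp add: desc_snoc perm_append)
qed

text \<open>In the normal form \<open>u'\<close> fixes \<open>Suc m\<close>, while a nonempty run
  sends \<open>j\<close> to \<open>Suc m\<close>. A trivial permutation therefore has an empty run,
  and induction applies to \<open>u'\<close>.\<close>

lemma coxeter_faithful:
  assumes "m \<le> n" "u \<in> lists {1..<m}" "perm u = id"
  shows "rho_word u = \<one>"
  using assms
proof (induction m arbitrary: u)
  case 0
  then show ?case by (cases u) auto
next
  case (Suc m)
  then obtain u' j where u': "u' \<in> lists {1..<m}" "1 \<le> j" "j \<le> Suc m" "rho_word u = rho_word (u' @ desc m j)"
    using normal_form[of m u] by auto
  have l: "u' \<in> lists {1..<n}" "desc m j \<in> lists {1..<n}" "u \<in> lists {1..<n}"
    using u' Suc.prems desc_lists[of j m] by auto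
  then have p: "perm u' \<circ> perm (desc m j) = id"
    using perm_eq_if_rho_word_eq[of u "u' @ desc m j"] u'(4) Suc.prems(3) by (simp only: perm_append append_in_lists_conv)
  have "j = Suc m"
  proof (rule ccontr)
    assume "j \<noteq> Suc m"
    then have "perm (desc m j) j = Suc m" using u' by (intro perm_desc) auto
    moreover have "perm u' (Suc m) = Suc m"
      using perm_permutes[OF u'(1)] by (auto simp: permutes_def)
    ultimately have "id j = Suc m" using p by (metis comp_apply)
    with \<open>j \<noteq> Suc m\<close> show False by simp
  qed
  then have d: "desc m j = []" by (simp add: desc_def)
  then have "perm u' = id" using p by simp
  then have "rho_word u' = \<one>" using Suc.prems(1) by (intro Suc.IH[OF _ u'(1)]) simp_all
  then show ?case using u'(4) d by simp
qed

text \<open>A run of adjacent transpositions brings \<open>p a\<close> back to \<open>a\<close>, and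
  the rest permutes a shorter interval. The lower end is variable because \<open>Lam_eq\<close>
  needs permutations fixing 1 and 2 to be spelled from index 3 on.\<close>

lemma perm_exists:
  assumes "p permutes {a..n}" "1 \<le> a"
  obtains u where "u \<in> lists {a..<n}" "perm u = p"
proof -
  have "\<exists>u. u \<in> lists {a..<n} \<and> perm u = p"
    using assms
  proof (induction "Suc n - a" arbitrary: a p)
    case 0
    then have "p = id" by (auto simp: permutes_def fun_eq_iff) 
    then show ?case by (intro exI[of _ "[]"]) simp
  next
    case (Suc d)
    define b where "b = p a"
    have a: "a \<le> n" using Suc.hyps(2) by simp
    then have b: "a \<le> b" "b \<le> n" using permutes_in_image[OF Suc.prems(1), of a] by (auto simp: b_def)
    have move: "perm [c..<b] b = c" if "c \<le> b" for c
      using that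
    proof (induction "b - c" arbitrary: c)
      case (Suc d)
      then have "perm [Suc c..<b] b = Suc c" by (intro Suc.hyps) auto
      then show ?case using Suc by (simp add: upt_rec[of c])
    qed simp
    define q where "q = perm [a..<b] \<circ> p"
    have "[a..<b] \<in> lists {a..<n}" using b by auto
    then have q: "q permutes {a..n}" unfolding q_def
      by (intro permutes_compose Suc.prems perm_permutes)
    have qa: "q a = a" using move[OF b(1)] by (simp add: q_def b_def)
    have "q permutes {Suc a..n}"
    proof (rule permutes_superset[OF q])
      fix x assume "x \<in> {a..n} - {Suc a..n}"
      then have "x = a" by auto
      then show "q x = x" using qa by simp
    qed
    moreover have "d = Suc n - Suc a" using Suc.hyps(2) by simp
    ultimately obtain u where u: "u \<in> lists {Suc a..<n}" "perm u = q"
      using Suc.hyps(1)[of "Suc a" q] by auto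
    have "perm (rev [a..<b] @ u) = p"
      unfolding perm_append u(2) q_def by (simp add: fun_eq_iff perm_rev)
    moreover have "rev [a..<b] @ u \<in> lists {a..<n}" using u(1) b by auto
    ultimately show ?case by blast
  qed
  then show thesis using that by blast
qed

lemma rho_word_eq_iff:
  assumes "u \<in> lists {1..<n}" "v \<in> lists {1..<n}"
  shows "rho_word u = rho_word v \<longleftrightarrow> perm u = perm v"
proof
  assume eq: "perm u = perm v"
  have "rev u @ v \<in> lists {1..<n}" using assms by auto
  moreover have "perm (rev u @ v) = id" using perm_rev(2) by (simp add: perm_append fun_eq_iff flip: eq)
  ultimately have "rho_word (rev u @ v) = \<one>" by (intro coxeter_faithful[of n]) auto
  then have "inv (rho_word u) \<otimes> rho_word v = \<one>"
    using rho_word_append[of "rev u" v] assms by (simp add: rho_word_rev rev_lists)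
  then have "rho_word u \<otimes> (inv (rho_word u) \<otimes> rho_word v) = rho_word u" using assms by simp
  then show "rho_word u = rho_word v" using assms by (simp add: inv_cancel)
qed (use assms perm_eq_if_rho_word_eq in blast)

section \<open>The pure generators\<close>

lemma perm_extend2:
  assumes "i \<in> {1..n}" "j \<in> {1..n}" "i \<noteq> j"
  obtains u where "u \<in> lists {1..<n}" "perm u 1 = i" "perm u 2 = j"
proof -
  \<comment> \<open>The right factor sends 2 to the preimage of \<open>j\<close> under the left one,
    and it fixes 1 because \<open>j\<close> differs from \<open>i\<close>.\<close>
  define p where "p = transpose 1 i \<circ> transpose 2 (transpose 1 i j)"
  have "p permutes {1..n}"
    unfolding p_def using assms n_ge_2
    by (intro permutes_compose permutes_swap_id) (auto simp: transpose_def)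
  then obtain u where "u \<in> lists {1..<n}" "perm u = p" by (rule perm_exists) simp
  then show thesis using assms that by (auto simp: p_def transpose_def)
qed

lemma perm_extend4:
  assumes "{i, j, k, l} \<subseteq> {1..n}" "distinct [i, j, k, l]"
  obtains u where "u \<in> lists {1..<n}" "perm u 1 = i" "perm u 2 = j" "perm u 3 = k" "perm u 4 = l"
proof -
  obtain u where u: "u \<in> lists {1..<n}" "perm u 1 = i" "perm u 2 = j"
    using perm_extend2[of i j] assms by auto
  have "card {i, j, k, l} \<le> card {1..n}" by (rule card_mono[OF _ assms(1)]) simp
  then have n4: "n \<ge> 4" using assms(2) by simp
  have pu: "perm u permutes {1..n}" using perm_permutes[OF u(1)] .
  \<comment> \<open>The targets \<open>k\<close> and \<open>l\<close> are pulled back through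
    \<open>u\<close>, and \<open>l\<close> also through the transposition of 3; neither result is 1
    or 2, so the values there are kept.\<close>
  define k' where "k' = perm (rev u) k"
  define l' where "l' = transpose 3 k' (perm (rev u) l)"
  have pr: "perm (rev u) permutes {1..n}" using u(1) by (intro perm_permutes) auto
  have kl: "k' \<in> {1..n}" "perm (rev u) l \<in> {1..n}"
    using assms(1) permutes_in_image[OF pr] by (auto simp: k'_def)
  have d: "k' \<noteq> 1" "k' \<noteq> 2" "perm (rev u) l \<noteq> 1" "perm (rev u) l \<noteq> 2" "k' \<noteq> perm (rev u) l"
    using u assms(2) perm_rev(1)[of u] by (auto simp: k'_def) (metis)+
  define p where "p = perm u \<circ> transpose 3 k' \<circ> transpose 4 l'"
  have l': "l' \<in> {1..n}" "l' \<noteq> 1" "l' \<noteq> 2" "l' \<noteq> 3"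
    using kl d n4 by (auto simp: l'_def transpose_def)
  have "p permutes {1..n}"
    unfolding p_def using kl l' n4 by (intro permutes_compose permutes_swap_id pu) auto
  then obtain v where v: "v \<in> lists {1..<n}" "perm v = p" by (rule perm_exists) simp
  have t: "transpose 3 k' l' = perm (rev u) l" "transpose 3 k' 3 = k'" by (simp_all add: l'_def)
  have "p 4 = l" "p 3 = k" "p 1 = i" "p 2 = j"
    using l' d u(2,3) t perm_rev(1)[of u] by (auto simp: p_def k'_def transpose_def)
  then show thesis using that[OF v(1)] v(2) by simp
qed

definition Lam :: "nat \<Rightarrow> nat \<Rightarrow> vt_gen gword set"
  where "Lam i j =
    (let u = SOME u. u \<in> lists {1..<n} \<and> perm u 1 = i \<and> perm u 2 = j
     in rho_word u \<otimes> (s 1 \<otimes> r 1) \<otimes> inv (rho_word u))"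

lemma one_less_n [simp]: "Suc 0 < n"
  using n_ge_2 by simp

text \<open>Two admissible words differ by a permutation fixing 1 and 2. By the Coxeter presentation
  the difference is a word in the \<open>r i\<close> with \<open>i\<close> at least 3, which
  commutes with \<open>s 1\<close> and \<open>r 1\<close>.\<close>

lemma Lam_eq:
  assumes u: "u \<in> lists {1..<n}" "perm u 1 = i" "perm u 2 = j"
  shows "Lam i j = rho_word u \<otimes> (s 1 \<otimes> r 1) \<otimes> inv (rho_word u)"
proof -
  define v where "v = (SOME u. u \<in> lists {1..<n} \<and> perm u 1 = i \<and> perm u 2 = j)"
  have v: "v \<in> lists {1..<n}" "perm v 1 = i" "perm v 2 = j"
    using someI_ex[of "\<lambda>u. u \<in> lists {1..<n} \<and> perm u 1 = i \<and> perm u 2 = j"] u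
    unfolding v_def by blast+
  define p where "p = perm (rev u @ v)"
  have l: "rev u @ v \<in> lists {1..<n}" using u v by auto
  have p: "p permutes {1..n}" unfolding p_def by (rule perm_permutes[OF l])
  have fix12: "p 1 = 1" "p 2 = 2" using u v perm_rev(2)[of u] by (auto simp: p_def perm_append)
  have "p permutes {3..n}"
  proof (rule permutes_superset[OF p])
    fix x assume "x \<in> {1..n} - {3..n}"
    then have "x = 1 \<or> x = 2" by auto
    then show "p x = x" using fix12 by auto
  qed
  then obtain w where w: "w \<in> lists {3..<n}" "perm w = p" by (rule perm_exists) simp
  have wl: "w \<in> lists {1..<n}" using w(1) by auto
  have "rho_word (rev u @ v) = rho_word w" using rho_word_eq_iff[OF l wl] w(2) by (simp add: p_def)
  then have "inv (rho_word u) \<otimes> rho_word v = rho_word w" using rho_word_append[of "rev u" v] u(1) v(1)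
    by (simp add: rho_word_rev rev_lists)
  then have "rho_word u \<otimes> (inv (rho_word u) \<otimes> rho_word v) = rho_word u \<otimes> rho_word w" by simp
  then have rv: "rho_word v = rho_word u \<otimes> rho_word w" using u(1) v(1) by (simp add: inv_cancel)
  have comm: "rho_word w \<otimes> (s 1 \<otimes> r 1) = (s 1 \<otimes> r 1) \<otimes> rho_word w"
    using w(1)
  proof (induction w)
    case (Cons i w)
    have i: "i \<in> {1..<n}" "3 \<le> i" and w: "w \<in> lists {1..<n}" using Cons.hyps by auto
    have "r i \<otimes> (s 1 \<otimes> r 1) = s 1 \<otimes> (r i \<otimes> r 1)"
      using far_commute(3)[of i 1] i by (simp flip: m_assoc)
    also have "\<dots> = (s 1 \<otimes> r 1) \<otimes> r i"
      using far_commute(2)[of i 1] i by (simp add: m_assoc)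
    finally have *: "r i \<otimes> (s 1 \<otimes> r 1) = (s 1 \<otimes> r 1) \<otimes> r i" .
    have "rho_word (i # w) \<otimes> (s 1 \<otimes> r 1) = r i \<otimes> (s 1 \<otimes> r 1) \<otimes> rho_word w"
      using Cons.IH i w by (simp add: m_assoc)
    then show ?case unfolding * using i w by (simp add: m_assoc)
  qed simp
  have "Lam i j = rho_word v \<otimes> (s 1 \<otimes> r 1) \<otimes> inv (rho_word v)"
    by (simp add: Lam_def Let_def v_def)
  also have "\<dots> = rho_word u \<otimes> (rho_word w \<otimes> (s 1 \<otimes> r 1) \<otimes> inv (rho_word w)) \<otimes> inv (rho_word u)"
    unfolding rv using u(1) wl by (simp add: word_simps)
  also have "rho_word w \<otimes> (s 1 \<otimes> r 1) \<otimes> inv (rho_word w) = s 1 \<otimes> r 1"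
    using commute_conj(2)[OF _ _ comm] wl by simp
  finally show ?thesis .
qed

lemma Lam_closed [simp, intro]:
  assumes "i \<in> {1..n}" "j \<in> {1..n}" "i \<noteq> j"
  shows "Lam i j \<in> carrier G"
proof -
  obtain u where "u \<in> lists {1..<n}" "perm u 1 = i" "perm u 2 = j" using perm_extend2[OF assms] .
  then show ?thesis by (simp add: Lam_eq)
qed

lemma Lam_conj:
  assumes "i \<in> {1..n}" "j \<in> {1..n}" "i \<noteq> j" "v \<in> lists {1..<n}"
  shows "rho_word v \<otimes> Lam i j \<otimes> inv (rho_word v) = Lam (perm v i) (perm v j)"
proof -
  obtain u where u: "u \<in> lists {1..<n}" "perm u 1 = i" "perm u 2 = j" using perm_extend2[OF assms(1-3)] .
  have "Lam (perm v i) (perm v j) = rho_word (v @ u) \<otimes> (s 1 \<otimes> r 1) \<otimes> inv (rho_word (v @ u))"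
    using u assms(4) by (intro Lam_eq) (auto simp: perm_append)
  then show ?thesis using u assms(4) by (simp add: Lam_eq[OF u] rho_word_append word_simps)
qed

text \<open>Conjugation by \<open>r i \<otimes> r (Suc i)\<close> moves the pair one step up; the
  relation \<open>mixed\<close> says that it moves \<open>s i\<close> in the same way, and
  \<open>braid\<close> does so for \<open>r i\<close>.\<close>

lemma Lam_adjacent: "i \<in> {1..<n} \<Longrightarrow> Lam i (Suc i) = s i \<otimes> r i"
proof (induction i)
  case (Suc i)
  show ?case
  proof (cases "i = 0")
    case True
    then show ?thesis using Lam_eq[of "[]" 1 2] by (simp add: numeral_2_eq_2)
  next
    case False
    then have i: "i \<in> {1..<n}" "Suc i \<in> {1..<n}" "i \<in> {1..<n - 1}" using Suc.prems by auto
    have "perm [i, Suc i] i = Suc i" "perm [i, Suc i] (Suc i) = Suc (Suc i)"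
      by (simp_all add: transpose_def)
    then have "Lam (Suc i) (Suc (Suc i)) = rho_word [i, Suc i] \<otimes> Lam i (Suc i) \<otimes> inv (rho_word [i, Suc i])"
      using Lam_conj[of i "Suc i" "[i, Suc i]"] i by (simp del: perm.simps rho_word.simps)
    also have "rho_word [i, Suc i] = r i \<otimes> r (Suc i)"
      using i by simp
    also have "inv (r i \<otimes> r (Suc i)) = r (Suc i) \<otimes> r i"
      using i by (simp add: inv_mult_group r_inv)
    also have "Lam i (Suc i) = s i \<otimes> r i"
      using Suc.IH i by simp
    finally have "Lam (Suc i) (Suc (Suc i)) = r i \<otimes> r (Suc i) \<otimes> (s i \<otimes> r i) \<otimes> (r (Suc i) \<otimes> r i)" .
    also have "\<dots> = (r i \<otimes> r (Suc i) \<otimes> s i) \<otimes> (r i \<otimes> r (Suc i) \<otimes> r i)"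
      using i by (simp add: m_assoc)
    also have "\<dots> = s (Suc i) \<otimes> r i \<otimes> r (Suc i) \<otimes> (r (Suc i) \<otimes> r i \<otimes> r (Suc i))"
      using mixed[OF i(3)] braid[OF i(3)] by simp
    also have "\<dots> = s (Suc i) \<otimes> (r i \<otimes> (r (Suc i) \<otimes> r (Suc i)) \<otimes> r i) \<otimes> r (Suc i)"
      using i by (simp add: m_assoc)
    also have "\<dots> = s (Suc i) \<otimes> r (Suc i)"
      using i by (simp only: r_square r_one r_closed s_closed)
    finally show ?thesis .
  qed
qed simp

text \<open>Exchanging 1 and 2 conjugates \<open>s 1 \<otimes> r 1\<close> by \<open>r 1\<close>,
  which gives \<open>r 1 \<otimes> s 1\<close>, the inverse of a product of two involutions.\<close>

lemma Lam_flip: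
  assumes "i \<in> {1..n}" "j \<in> {1..n}" "i \<noteq> j"
  shows "Lam j i = inv (Lam i j)"
proof -
  obtain u where u: "u \<in> lists {1..<n}" "perm u 1 = i" "perm u 2 = j" using perm_extend2[OF assms] .
  have one: "(1::nat) \<in> {1..<n}" by simp
  have "Lam j i = rho_word (u @ [1]) \<otimes> (s 1 \<otimes> r 1) \<otimes> inv (rho_word (u @ [1]))"
    using u by (intro Lam_eq) (auto simp: perm_append numeral_2_eq_2)
  also have "\<dots> = rho_word u \<otimes> (r 1 \<otimes> s 1) \<otimes> inv (rho_word u)"
    using u(1) one by (simp add: rho_word_append word_simps r_inv r_square flip: m_assoc[of "r 1" "r 1"] m_assoc[of "r (Suc 0)" "r (Suc 0)"])
  also have "\<dots> = inv (Lam i j)"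
    using u(1) one by (simp add: Lam_eq[OF u] word_simps r_inv s_inv)
  finally show ?thesis .
qed

text \<open>One word takes 1, 2, 3, 4 to the four indices, which reduces the claim to far
  commutation between indices 1 and 3.\<close>

lemma Lam_commute:
  assumes "{i, j, k, l} \<subseteq> {1..n}" "distinct [i, j, k, l]"
  shows "Lam i j \<otimes> Lam k l = Lam k l \<otimes> Lam i j"
proof -
  obtain u where u: "u \<in> lists {1..<n}" "perm u 1 = i" "perm u 2 = j" "perm u 3 = k" "perm u 4 = l"
    using perm_extend4[OF assms] .
  have "card {i, j, k, l} \<le> card {1..n}" by (rule card_mono[OF _ assms(1)]) simp
  then have n4: "n \<ge> 4" using assms(2) by simp
  have i: "Suc 0 \<in> {1..<n}" "3 \<in> {1..<n}" using n4 by auto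
  have c: "s 1 \<otimes> s 3 = s 3 \<otimes> s 1" "r 1 \<otimes> r 3 = r 3 \<otimes> r 1" "r 1 \<otimes> s 3 = s 3 \<otimes> r 1" "s 1 \<otimes> r 3 = r 3 \<otimes> s 1"
    using far_commute[of 1 3] far_commute(3)[of 3 1] i by auto
  have kl: "Lam k l = rho_word u \<otimes> (s 3 \<otimes> r 3) \<otimes> inv (rho_word u)"
    using Lam_conj[of 3 4 u] Lam_adjacent[of 3] u n4 by simp
  have "(s 1 \<otimes> r 1) \<otimes> (s 3 \<otimes> r 3) = s 1 \<otimes> (r 1 \<otimes> s 3) \<otimes> r 3" using i by (simp add: m_assoc)
  also have "\<dots> = (s 1 \<otimes> s 3) \<otimes> (r 1 \<otimes> r 3)" unfolding c(3) using i by (simp add: m_assoc)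
  also have "\<dots> = s 3 \<otimes> (s 1 \<otimes> r 3) \<otimes> r 1" unfolding c(1,2) using i by (simp add: m_assoc)
  also have "\<dots> = (s 3 \<otimes> r 3) \<otimes> (s 1 \<otimes> r 1)" unfolding c(4) using i by (simp add: m_assoc)
  finally have c13: "(s 1 \<otimes> r 1) \<otimes> (s 3 \<otimes> r 3) = (s 3 \<otimes> r 3) \<otimes> (s 1 \<otimes> r 1)" .
  have "Lam i j \<otimes> Lam k l = rho_word u \<otimes> ((s 1 \<otimes> r 1) \<otimes> (s 3 \<otimes> r 3)) \<otimes> inv (rho_word u)"
    unfolding kl Lam_eq[OF u(1-3)] using u(1) i by (simp add: word_simps)
  also have "\<dots> = Lam k l \<otimes> Lam i j"
    unfolding c13 kl Lam_eq[OF u(1-3)] using u(1) i by (simp add: word_simps)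
  finally show ?thesis .
qed

lemma vt_perm_Lam:
  assumes "i \<in> {1..n}" "j \<in> {1..n}" "i \<noteq> j"
  shows "vt_perm n (Lam i j) = id"
proof -
  obtain u where u: "u \<in> lists {1..<n}" "perm u 1 = i" "perm u 2 = j" using perm_extend2[OF assms] .
  have one: "(1::nat) \<in> {1..<n}" by simp
  then have "vt_perm n (s 1 \<otimes> r 1) = \<one>\<^bsub>sym_group n\<^esub>"
    by (simp add: vt_perm_r vt_perm_s sym_group_mult sym_group_one del: one_less_n)
  then have "vt_perm n (Lam i j) = vt_perm n (rho_word u) \<otimes>\<^bsub>sym_group n\<^esub> inv\<^bsub>sym_group n\<^esub> vt_perm n (rho_word u)"
    using u(1) rho_word_closed[OF u(1)] s_closed[OF one] r_closed[OF one]
    by (simp add: Lam_eq[OF u] del: rho_word_closed s_closed r_closed)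
  also have "\<dots> = \<one>\<^bsub>sym_group n\<^esub>"
    using rho_word_closed[OF u(1)] by (intro \<pi>.H.r_inv) simp
  finally show ?thesis by (simp add: sym_group_one)
qed


section \<open>The presentation of the pure virtual twin group\<close>

lemma gen_index_range: "x \<in> vt_gens n \<Longrightarrow> gen_index x \<in> {1..<n}"
  by (cases x) auto

lemma index_lists: "V \<in> gwords (vt_gens n) \<Longrightarrow> map (gen_index \<circ> fst) V \<in> lists {1..<n}"
  using gen_index_range by (induction V) auto

lemma act_gen_gwords:
  assumes "fst c \<in> vt_gens n" "w \<in> gwords (edges n)"
  shows "act_gen c w \<in> gwords (edges n)"
  using relabel_gwords[OF swap_permutes[OF gen_index_range[OF assms(1)]] assms(2)] assms(1)
    signed_edges[of "gen_index (fst c)" n "gen_index (fst c) + 1"]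
  by (auto simp: act_gen_def split: vt_gen.split)

lemma act_word_gwords: "u \<in> gwords (vt_gens n) \<Longrightarrow> w \<in> gwords (edges n) \<Longrightarrow> act_word u w \<in> gwords (edges n)"
  by (induction u) (auto simp: act_gen_gwords)

lemma act_gen_rel:
  assumes "fst c \<in> vt_gens n" "(w, w') \<in> edge_rel n"
  shows "(act_gen c w, act_gen c w') \<in> edge_rel n"
  unfolding act_gen_def
proof (rule pres_rel.append)
  show "(map (relabel (swap (gen_index (fst c)))) w, map (relabel (swap (gen_index (fst c)))) w') \<in> edge_rel n"
    by (rule relabel_rel[OF swap_permutes[OF gen_index_range[OF assms(1)]] assms(2)])
  show "(case fst c of Sgen i \<Rightarrow> [signed i (i + 1)] | Rgen i \<Rightarrow> [],
      case fst c of Sgen i \<Rightarrow> [signed i (i + 1)] | Rgen i \<Rightarrow> []) \<in> edge_rel n"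
    using assms(1) signed_edges[of _ n] by (intro pres_rel.refl) (auto split: vt_gen.split)
qed

lemma act_word_rel:
  "u \<in> gwords (vt_gens n) \<Longrightarrow> (w, w') \<in> edge_rel n \<Longrightarrow> (act_word u w, act_word u w') \<in> edge_rel n"
  by (induction u) (auto simp: act_gen_rel)

lemma relabel_word_comp:
  assumes "inj q" "w \<in> gwords (edges n)"
  shows "map (relabel p) (map (relabel q) w) = map (relabel (p \<circ> q)) w"
  using assms relabel_comp[OF assms(1)] by (auto simp: gwords_iff)

lemma relabel_word_id: "w \<in> gwords (edges n) \<Longrightarrow> map (relabel id) w = w"
  by (intro map_idI) (auto simp: gwords_iff relabel_id)

lemma inj_swap: "inj (swap i)"
  by (simp add: swap_def)

text \<open>Most relations give equal words as soon as the permutations agree. Only the square of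
  \<open>\<s> i\<close> uses free cancellation, and only the far commutation of
  \<open>\<s> i\<close> and \<open>\<s> j\<close> uses that of disjoint pairs.\<close>

lemma act_word_relation:
  assumes "(u, v) \<in> vt_rels n" "w \<in> gwords (edges n)"
  shows "(act_word u w, act_word v w) \<in> edge_rel n"
proof -
  have R2: "map (relabel (swap i)) (map (relabel (swap j)) w) = map (relabel (swap i \<circ> swap j)) w" for i j
    by (rule relabel_word_comp[OF inj_swap assms(2)])
  have R3: "map (relabel (swap i)) (map (relabel (swap j)) (map (relabel (swap k)) w))
      = map (relabel (swap i \<circ> swap j \<circ> swap k)) w" for i j k
    using relabel_word_comp[of "swap j \<circ> swap k" w "swap i"] assms(2) inj_swap
    by (simp add: R2 inj_compose o_assoc del: map_map)
  have far: "swap i \<circ> swap j = swap j \<circ> swap i" if "i + 2 \<le> j \<or> j + 2 \<le> i" for i j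
    using that by (auto simp: fun_eq_iff swap_def transpose_def)
  have far_sw: "swap i j = j" "swap i (Suc j) = Suc j" if "i + 2 \<le> j \<or> j + 2 \<le> i" for i j
    using that by (auto simp: swap_def transpose_def)
  have W: "(x, x) \<in> edge_rel n" if "x \<in> gwords (edges n)" for x
    using that by (rule pres_rel.refl)
  have rg: "map (relabel (swap i \<circ> swap j)) w \<in> gwords (edges n)" if "i \<in> {1..<n}" "j \<in> {1..<n}" for i j
    using that assms(2) swap_permutes by (intro relabel_gwords permutes_compose) auto
  have rg3: "map (relabel (swap i \<circ> swap j \<circ> swap k)) w \<in> gwords (edges n)"
    if "i \<in> {1..<n}" "j \<in> {1..<n}" "k \<in> {1..<n}" for i j k
    using that assms(2) swap_permutes by (intro relabel_gwords permutes_compose) auto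
  have idx: "i \<in> {1..<n}" if "i \<in> {1..n - 1}" for i using that n_ge_2 by auto
  have sg: "[signed i (Suc i)] \<in> gwords (edges n)" if "i \<in> {1..<n}" for i
    using that signed_edges[of i n "Suc i"] by simp
  have rs: "relabel (swap i) (signed j (Suc j)) = signed (swap i j) (swap i (Suc j))" for i j
    by (simp add: relabel_signed)
  have absd: "i + 2 \<le> j \<or> j + 2 \<le> i" if "\<bar>int i - int j\<bar> \<ge> 2" for i j using that by linarith
  let ?ok = "\<lambda>p. (act_word (fst p) w, act_word (snd p) w) \<in> edge_rel n"
  have ss_ok: "?ok ([\<s> i, \<s> i], [])" if ss: "i \<in> {1..n - 1}" for i
  proof -
    have "act_word [\<s> i, \<s> i] w = [signed i (Suc i), signed (Suc i) i] @ w"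
      by (simp add: act_gen_def rs R2 swap_swap relabel_word_id[OF assms(2)] del: map_map)
         (simp add: swap_def)
    moreover have "([signed i (Suc i), signed (Suc i) i] @ w, [] @ w) \<in> edge_rel n"
      using ss by (intro pres_rel.append signed_cancel W assms(2)) auto
    ultimately show ?thesis by simp
  qed
  have rr_ok: "?ok ([\<rho> i, \<rho> i], [])" if rr: "i \<in> {1..n - 1}" for i
  proof -
    show ?thesis
      using assms(2) by (simp add: act_gen_def R2 swap_swap relabel_word_id W del: map_map)
  qed
  have ssc_ok: "?ok ([\<s> i, \<s> j], [\<s> j, \<s> i])" if ssc: "i \<in> {1..n - 1}" "j \<in> {1..n - 1}" "\<bar>int i - int j\<bar> \<ge> 2" for i j
  proof -
    note f = absd[OF ssc(3)]
    then have f': "j + 2 \<le> i \<or> i + 2 \<le> j" by blast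
    have "act_word [\<s> i, \<s> j] w = [signed i (Suc i), signed j (Suc j)] @ map (relabel (swap i \<circ> swap j)) w"
      using far_sw[OF f] by (simp add: act_gen_def rs R2 del: map_map)
    moreover have "act_word [\<s> j, \<s> i] w = [signed j (Suc j), signed i (Suc i)] @ map (relabel (swap i \<circ> swap j)) w"
      using far_sw[OF f'] by (simp add: act_gen_def rs R2 far[OF f] del: map_map)
    moreover have "([signed i (Suc i), signed j (Suc j)] @ map (relabel (swap i \<circ> swap j)) w,
        [signed j (Suc j), signed i (Suc i)] @ map (relabel (swap i \<circ> swap j)) w) \<in> edge_rel n"
      using ssc(1,2) f
      by (intro pres_rel.append signed_commute W rg idx) auto
    ultimately show ?thesis by (simp only: fst_conv snd_conv)
  qed
  have rrc_ok: "?ok ([\<rho> i, \<rho> j], [\<rho> j, \<rho> i])" if rrc: "i \<in> {1..n - 1}" "j \<in> {1..n - 1}" "\<bar>int i - int j\<bar> \<ge> 2" for i j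
  proof -
    show ?thesis
      using W[OF rg[OF idx[OF rrc(1)] idx[OF rrc(2)]]]
      by (simp add: act_gen_def R2 far[OF absd[OF rrc(3)]] del: map_map)
  qed
  have rsc_ok: "?ok ([\<rho> i, \<s> j], [\<s> j, \<rho> i])" if rsc: "i \<in> {1..n - 1}" "j \<in> {1..n - 1}" "\<bar>int i - int j\<bar> \<ge> 2" for i j
  proof -
    note f = absd[OF rsc(3)]
    have "act_word [\<rho> i, \<s> j] w = signed j (Suc j) # map (relabel (swap i \<circ> swap j)) w"
      using far_sw[OF f] by (simp add: act_gen_def rs R2 del: map_map)
    moreover have "act_word [\<s> j, \<rho> i] w = signed j (Suc j) # map (relabel (swap i \<circ> swap j)) w"
      by (simp add: act_gen_def rs R2 far[OF f] del: map_map)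
    ultimately show ?thesis
      using W[of "[signed j (Suc j)] @ map (relabel (swap i \<circ> swap j)) w"]
        rg[OF idx[OF rsc(1)] idx[OF rsc(2)]] sg[OF idx[OF rsc(2)]] by simp
  qed
  have br_ok: "?ok ([\<rho> i, \<rho> (i + 1), \<rho> i], [\<rho> (i + 1), \<rho> i, \<rho> (i + 1)])" if br: "i \<in> {1..n - 2}" for i
  proof -
    have i: "i \<in> {1..<n}" "Suc i \<in> {1..<n}" using br by auto
    show ?thesis
      using W[OF rg3[OF i(1) i(2) i(1)]] by (simp add: act_gen_def R3 swap_braid del: map_map)
  qed
  have mx_ok: "?ok ([\<rho> i, \<rho> (i + 1), \<s> i], [\<s> (i + 1), \<rho> i, \<rho> (i + 1)])" if mx: "i \<in> {1..n - 2}" for i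
  proof -
    have i: "i \<in> {1..<n}" "Suc i \<in> {1..<n}" using mx by auto
    have "act_word [\<rho> i, \<rho> (i + 1), \<s> i] w = signed (Suc i) (Suc (Suc i)) # map (relabel (swap i \<circ> swap (Suc i) \<circ> swap i)) w"
      by (simp add: act_gen_def rs relabel_signed R3 del: map_map) (simp add: swap_def transpose_def relabel_signed)
    moreover have "act_word [\<s> (i + 1), \<rho> i, \<rho> (i + 1)] w = signed (Suc i) (Suc (Suc i)) # map (relabel (swap i \<circ> swap (Suc i) \<circ> swap i)) w"
      by (simp add: act_gen_def R3 swap_braid del: map_map)
    ultimately show ?thesis
      using W[of "[signed (Suc i) (Suc (Suc i))] @ map (relabel (swap i \<circ> swap (Suc i) \<circ> swap i)) w"]
        rg3[OF i(1) i(2) i(1)] sg[OF i(2)] by simp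
  qed
  have "?ok (u, v)"
    using assms(1) unfolding vt_rels_def
    by (elim UnE CollectE exE conjE)
      (simp_all only: ss_ok rr_ok ssc_ok rrc_ok rsc_ok br_ok mx_ok)
  then show ?thesis by simp
qed

lemma act_word_pres_rel:
  assumes "(u, v) \<in> pres_rel (vt_gens n) (vt_rels n)" "w \<in> gwords (edges n)"
  shows "(act_word u w, act_word v w) \<in> edge_rel n"
  using assms
proof (induction arbitrary: w rule: pres_rel.induct)
  case (refl u)
  then show ?case by (intro pres_rel.refl act_word_gwords)
next
  case (sym u v)
  then show ?case by (blast intro: pres_rel.sym)
next
  case (trans u v z)
  then show ?case by (blast intro: pres_rel.trans)
next
  case (append u u' v v')
  then have gw: "u \<in> gwords (vt_gens n)" "v' \<in> gwords (vt_gens n)" by (auto dest: pres_rel_gwords)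
  have "(act_word u (act_word v w), act_word u (act_word v' w)) \<in> edge_rel n"
    using append gw by (intro act_word_rel) auto
  moreover have "(act_word u (act_word v' w), act_word u' (act_word v' w)) \<in> edge_rel n"
    using append gw by (simp add: act_word_gwords)
  ultimately show ?case by (simp add: pres_rel.trans)
next
  case (cancel x b)
  \<comment> \<open>\<open>act_gen\<close> ignores the sign of a letter, so free cancellation
    becomes the relation that a generator is an involution.\<close>
  obtain i where i: "i \<in> {1..n - 1}" "x = Sgen i \<or> x = Rgen i"
    using cancel(1) by (auto simp: vt_gens_def)
  then have "([(x, True), (x, True)], []) \<in> vt_rels n" unfolding vt_rels_def by blast
  moreover have "act_word [(x, b), (x, \<not> b)] w = act_word [(x, True), (x, True)] w"
    by (simp add: act_gen_def)
  ultimately show ?case using act_word_relation cancel(2) by metis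
next
  case (defining u v)
  then show ?case by (intro act_word_relation)
qed

section \<open>Faithfulness and generation of the kernel\<close>

definition lam :: "edge \<Rightarrow> vt_gen gword set" where "lam e = Lam (fst e) (snd e)"

lemma lam_closed: "e \<in> edges n \<Longrightarrow> lam e \<in> carrier G"
  by (auto simp: lam_def edges_def)

lemma lam_funcset: "lam \<in> edges n \<rightarrow> carrier G"
  using lam_closed by auto

definition letter_val :: "edge \<times> bool \<Rightarrow> vt_gen gword set"
  where "letter_val c = (if snd c then lam (fst c) else inv (lam (fst c)))"

lemma letter_val_signed:
  assumes "i \<in> {1..n}" "j \<in> {1..n}" "i \<noteq> j"
  shows "letter_val (signed i j) = Lam i j"
  using Lam_flip[of j i] assms by (auto simp: letter_val_def signed_def lam_def)

lemma word_eval_lam_Cons: "word_eval G lam (c # w) = letter_val c \<otimes> word_eval G lam w"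
  by (simp add: word_eval_def letter_val_def split_beta)

lemma act_rho_word: 
  assumes "u \<in> lists {1..<n}" "w \<in> gwords (edges n)"
  shows "act_word (map \<rho> u) w = map (relabel (perm u)) w"
  using assms(1)
proof (induction u)
  case Nil
  show ?case
    unfolding perm.simps list.map act_word_simps(1) by (rule relabel_word_id[OF assms(2), symmetric])
next
  case (Cons i u)
  have "perm u permutes {1..n}" using Cons.hyps by (intro perm_permutes)
  then have "inj (perm u)" by (rule permutes_inj)
  have "act_word (map \<rho> (i # u)) w = map (relabel (swap i)) (map (relabel (perm u)) w)"
    by (simp add: act_gen_def Cons.IH del: map_map)
  also have "\<dots> = map (relabel (swap i \<circ> perm u)) w"
    by (rule relabel_word_comp[OF \<open>inj (perm u)\<close> assms(2)])
  finally show ?case by (simp only: perm.simps swap_def)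
qed

text \<open>Relabelling by \<open>rev u\<close>, prefixing the pair 1, 2 and relabelling back by
  \<open>u\<close> amounts to prefixing \<open>c\<close>.\<close>

lemma letter_word:
  assumes "fst c \<in> edges n"
  obtains V where "V \<in> gwords (vt_gens n)" "vt V = letter_val c"
    "\<And>w. w \<in> gwords (edges n) \<Longrightarrow> act_word V w = c # w"
proof -
  obtain i j where ij: "i \<in> {1..n}" "j \<in> {1..n}" "i \<noteq> j" "c = signed i j"
    using signed_cases[OF assms] .
  obtain u where u: "u \<in> lists {1..<n}" "perm u 1 = i" "perm u 2 = j" using perm_extend2[OF ij(1-3)] .
  have ru: "rev u \<in> lists {1..<n}" using u(1) by (simp add: rev_lists)
  define V where "V = map \<rho> u @ [\<s> 1, \<rho> 1] @ map \<rho> (rev u)"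
  have gw: "map \<rho> u \<in> gwords (vt_gens n)" "[\<s> 1, \<rho> 1] \<in> gwords (vt_gens n)" "map \<rho> (rev u) \<in> gwords (vt_gens n)"
    using u(1) by (auto simp: gwords_iff)
  have "vt V = vt (map \<rho> u) \<otimes> (vt [\<s> 1, \<rho> 1] \<otimes> vt (map \<rho> (rev u)))"
    unfolding V_def by (simp only: vt_append gw gwords_append_iff simp_thms)
  also have "\<dots> = rho_word u \<otimes> ((s 1 \<otimes> r 1) \<otimes> inv (rho_word u))"
    unfolding rho_word_vt[OF u(1)] rho_word_vt[OF ru] rho_word_rev[OF u(1)] using vt_word2[of "\<s> 1" "\<rho> 1"]
    by (simp add: s_def r_def)
  also have "\<dots> = rho_word u \<otimes> (s 1 \<otimes> r 1) \<otimes> inv (rho_word u)"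
    using u(1) by (simp add: m_assoc)
  finally have "vt V = rho_word u \<otimes> (s 1 \<otimes> r 1) \<otimes> inv (rho_word u)" .
  then have vtV: "vt V = letter_val c" using Lam_eq[OF u] letter_val_signed ij by simp
  have act: "act_word V w = c # w" if w: "w \<in> gwords (edges n)" for w
  proof -
    have inj: "inj (perm u)" "inj (perm (rev u))"
      using permutes_inj[OF perm_permutes[OF u(1)]] permutes_inj[OF perm_permutes[OF ru]] by auto
    define w' where "w' = map (relabel (perm (rev u))) w"
    have w': "w' \<in> gwords (edges n)"
      unfolding w'_def by (rule relabel_gwords[OF perm_permutes[OF ru] w])
    have sg: "fst (signed 1 2) \<in> edges n" using n_ge_2 by (intro signed_edges) auto
    have "act_word V w = act_word (map \<rho> u) (act_word [\<s> 1, \<rho> 1] w')"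
      unfolding V_def act_word_simps(3) w'_def act_rho_word[OF ru w] ..
    also have "act_word [\<s> 1, \<rho> 1] w' = signed 1 2 # w'"
      using relabel_word_comp[of "swap 1" w' "swap 1"] inj_swap[of 1] w' relabel_word_id[OF w']
      by (simp add: act_gen_def swap_swap numeral_2_eq_2 del: map_map)
    also have "act_word (map \<rho> u) (signed 1 2 # w') = map (relabel (perm u)) (signed 1 2 # w')"
      using sg w' by (intro act_rho_word u(1)) simp
    also have "\<dots> = c # map (relabel (perm u)) w'"
      using u relabel_signed[of 1 2 "perm u"] ij(4) by simp
    also have "map (relabel (perm u)) w' = map (relabel (perm u \<circ> perm (rev u))) w"
      unfolding w'_def by (rule relabel_word_comp[OF inj(2) w])
    also have "perm u \<circ> perm (rev u) = id" by (simp add: fun_eq_iff perm_rev)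
    finally show ?thesis unfolding relabel_word_id[OF w] .
  qed
  show thesis using that[of V] gw vtV act by (simp add: V_def)
qed

lemma edge_word:
  assumes "w \<in> gwords (edges n)"
  obtains V where "V \<in> gwords (vt_gens n)" "vt V = word_eval G lam w" "act_word V [] = w"
proof -
  have "\<exists>V. V \<in> gwords (vt_gens n) \<and> vt V = word_eval G lam w \<and> act_word V [] = w"
    using assms
  proof (induction w)
    case Nil
    show ?case by (intro exI[of _ "[]"]) (simp add: vt_Nil word_eval_def)
  next
    case (Cons c w)
    then obtain V where V: "V \<in> gwords (vt_gens n)" "vt V = word_eval G lam w" "act_word V [] = w" by auto
    obtain U where U: "U \<in> gwords (vt_gens n)" "vt U = letter_val c"
      "\<And>w. w \<in> gwords (edges n) \<Longrightarrow> act_word U w = c # w"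
      using letter_word[of c] Cons.prems by auto
    show ?case using V U Cons.prems
      by (intro exI[of _ "U @ V"]) (simp add: vt_append word_eval_lam_Cons)
  qed
  then show thesis using that by blast
qed

text \<open>The action remembers spellings: some word with the value of \<open>w\<close> takes the
  empty word to \<open>w\<close>. If the value is \<one>, that word acts trivially up to the
  commutations.\<close>

lemma lam_word_faithful:
  assumes "w \<in> gwords (edges n)" "word_eval G lam w = \<one>"
  shows "(w, []) \<in> edge_rel n"
proof -
  obtain V where V: "V \<in> gwords (vt_gens n)" "vt V = word_eval G lam w" "act_word V [] = w"
    using edge_word[OF assms(1)] .
  have "vt V = vt []" using V(2) assms(2) by (simp add: vt_Nil)
  then have "(V, []) \<in> pres_rel (vt_gens n) (vt_rels n)" using V(1) by (subst (asm) vt_eq_iff) auto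
  from act_word_pres_rel[OF this, of "[]"] V(3) show ?thesis by simp
qed

lemma letter_val_conj:
  assumes "fst c \<in> edges n" "i \<in> {1..<n}"
  shows "r i \<otimes> letter_val c = letter_val (relabel (swap i) c) \<otimes> r i"
proof -
  obtain j k where jk: "j \<in> {1..n}" "k \<in> {1..n}" "j \<noteq> k" "c = signed j k"
    using signed_cases[OF assms(1)] .
  have p: "swap i permutes {1..n}" using swap_permutes[OF assms(2)] .
  have ne: "swap i j \<noteq> swap i k" using inj_swap jk(3) by (auto dest: injD)
  have "rho_word [i] \<otimes> Lam j k \<otimes> inv (rho_word [i]) = Lam (swap i j) (swap i k)"
    using Lam_conj[of j k "[i]"] jk assms(2) by (simp add: swap_def)
  then have "r i \<otimes> Lam j k \<otimes> inv (r i) \<otimes> r i = Lam (swap i j) (swap i k) \<otimes> r i"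
    using assms(2) by simp
  then have "r i \<otimes> Lam j k = Lam (swap i j) (swap i k) \<otimes> r i"
    using jk assms(2) by (simp add: m_assoc)
  then show ?thesis
    using jk ne permutes_in_image[OF p] by (simp add: letter_val_signed relabel_signed del: atLeastAtMost_iff)
qed

lemma letter_val_closed: "fst c \<in> edges n \<Longrightarrow> letter_val c \<in> carrier G"
  by (simp add: letter_val_def lam_closed)

lemma word_eval_conj:
  assumes "w \<in> gwords (edges n)" "i \<in> {1..<n}"
  shows "r i \<otimes> word_eval G lam w = word_eval G lam (map (relabel (swap i)) w) \<otimes> r i"
  using assms(1)
proof (induction w)
  case Nil
  then show ?case using assms(2) by (simp add: word_eval_def)
next
  case (Cons c w)
  have c: "fst c \<in> edges n" and w: "w \<in> gwords (edges n)" using Cons.prems by auto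
  have car: "letter_val c \<in> carrier G" "word_eval G lam w \<in> carrier G" "r i \<in> carrier G"
    "letter_val (relabel (swap i) c) \<in> carrier G" "word_eval G lam (map (relabel (swap i)) w) \<in> carrier G"
    using c w assms(2) relabel_edges[OF swap_permutes[OF assms(2)] c]
      relabel_gwords[OF swap_permutes[OF assms(2)] w]
    by (auto simp: letter_val_closed intro: word_eval_closed[OF lam_funcset])
  have "r i \<otimes> word_eval G lam (c # w) = (r i \<otimes> letter_val c) \<otimes> word_eval G lam w"
    using car by (simp add: word_eval_lam_Cons m_assoc)
  also have "\<dots> = letter_val (relabel (swap i) c) \<otimes> (r i \<otimes> word_eval G lam w)"
    unfolding letter_val_conj[OF c assms(2)] using car by (simp add: m_assoc)
  finally show ?case
    unfolding Cons.IH[OF w] using car by (simp add: word_eval_lam_Cons m_assoc)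
qed

text \<open>Semidirect decomposition: each \<open>s i\<close> splits as
  \<open>Lam i (Suc i) \<otimes> r i\<close>, and every \<open>r i\<close> is pushed to the right,
  relabelling the pure letters it passes. This is how the action on the empty word builds the pure
  factor.\<close>

lemma vt_decompose:
  assumes "V \<in> gwords (vt_gens n)"
  shows "vt V = word_eval G lam (act_word V []) \<otimes> rho_word (map (gen_index \<circ> fst) V)"
  using assms
proof (induction V)
  case Nil
  then show ?case by (simp add: vt_Nil word_eval_def)
next
  case (Cons c V)
  have c: "fst c \<in> vt_gens n" and V: "V \<in> gwords (vt_gens n)" using Cons.prems by auto
  define i where "i = gen_index (fst c)"
  have i: "i \<in> {1..<n}" unfolding i_def by (rule gen_index_range[OF c])
  define w where "w = act_word V []"
  define R where "R = rho_word (map (gen_index \<circ> fst) V)"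
  have w: "w \<in> gwords (edges n)" using act_word_gwords[OF V] by (simp add: w_def)
  have l: "map (gen_index \<circ> fst) V \<in> lists {1..<n}"
    by (rule index_lists[OF V])
  have R: "R \<in> carrier G" unfolding R_def by (rule rho_word_closed[OF l])
  have w': "map (relabel (swap i)) w \<in> gwords (edges n)" by (rule relabel_gwords[OF swap_permutes[OF i] w])
  have ew: "word_eval G lam w \<in> carrier G" "word_eval G lam (map (relabel (swap i)) w) \<in> carrier G"
    using word_eval_closed[OF lam_funcset] w w' by auto
  have IH: "vt V = word_eval G lam w \<otimes> R"
    unfolding w_def R_def by (rule Cons.IH[OF V])
  have ri: "r i \<otimes> vt V = word_eval G lam (map (relabel (swap i)) w) \<otimes> (r i \<otimes> R)"
  proof -
    have "r i \<otimes> vt V = (r i \<otimes> word_eval G lam w) \<otimes> R"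
      using ew R i by (simp add: m_assoc IH)
    then show ?thesis unfolding word_eval_conj[OF w i] using ew R i by (simp add: m_assoc)
  qed
  have rwc: "rho_word (map (gen_index \<circ> fst) (c # V)) = r i \<otimes> R"
    unfolding R_def i_def by (simp only: list.map rho_word.simps comp_apply)
  have vc: "vt (c # V) = vt [c] \<otimes> vt V" using vt_append[of "[c]" V] c V by simp
  show ?case
  proof (cases "fst c")
    case (Sgen k)
    then have k: "k = i" by (simp add: i_def)
    have "vt [c] = Lam i (Suc i) \<otimes> r i"
      using vt_letter[OF c] Sgen k i Lam_adjacent[OF i] r_square[OF i] by (simp add: m_assoc)
    then have "vt (c # V) = Lam i (Suc i) \<otimes> (r i \<otimes> vt V)"
      using vc i V by (simp add: m_assoc)
    also have "\<dots> = Lam i (Suc i) \<otimes> word_eval G lam (map (relabel (swap i)) w) \<otimes> (r i \<otimes> R)"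
      unfolding ri using ew R i by (simp add: m_assoc)
    also have "Lam i (Suc i) \<otimes> word_eval G lam (map (relabel (swap i)) w) = word_eval G lam (act_word (c # V) [])"
      using letter_val_signed[of i "Suc i"] i Sgen k
      by (simp add: act_gen_def word_eval_lam_Cons w_def)
    finally show ?thesis unfolding rwc .
  next
    case (Rgen k)
    then have k: "k = i" by (simp add: i_def)
    have "vt [c] = r i" using vt_letter[OF c] Rgen k by simp
    moreover have "act_word (c # V) [] = map (relabel (swap i)) w"
      using Rgen k by (simp add: act_gen_def w_def)
    ultimately show ?thesis unfolding rwc vc using ri by simp
  qed
qed

lemma vt_perm_lam: "w \<in> gwords (edges n) \<Longrightarrow> vt_perm n (word_eval G lam w) = \<one>\<^bsub>sym_group n\<^esub>"
proof (induction w)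
  case (Cons c w)
  then obtain i j where ij: "i \<in> {1..n}" "j \<in> {1..n}" "i \<noteq> j" "c = signed i j"
    using signed_cases[of c n] by auto
  have "vt_perm n (letter_val c) = \<one>\<^bsub>sym_group n\<^esub>"
    using vt_perm_Lam[OF ij(1-3)] letter_val_signed[OF ij(1-3)] ij(4) by (simp add: sym_group_one)
  then show ?case
    using Cons letter_val_closed[of c] word_eval_closed[OF lam_funcset, of w]
    by (simp add: word_eval_lam_Cons)
qed (use \<pi>.hom_one in \<open>simp add: word_eval_def\<close>)

text \<open>For an element of the kernel the right factor in \<open>vt_decompose\<close> has trivial
  permutation and is \<one> by \<open>coxeter_faithful\<close>.\<close>

lemma kernel_generated:
  assumes "g \<in> kernel G (sym_group n) (vt_perm n)"
  obtains w where "w \<in> gwords (edges n)" "word_eval G lam w = g"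
proof -
  have g: "g \<in> carrier G" "vt_perm n g = \<one>\<^bsub>sym_group n\<^esub>" using assms by (auto simp: kernel_def)
  obtain V where V: "V \<in> gwords (vt_gens n)" "g = vt V" using vt_carrierE[OF g(1)] .
  define w where "w = act_word V []"
  define l where "l = map (gen_index \<circ> fst) V"
  have w: "w \<in> gwords (edges n)" using act_word_gwords[OF V(1)] by (simp add: w_def)
  have l: "l \<in> lists {1..<n}"
    unfolding l_def by (rule index_lists[OF V(1)])
  have gd: "g = word_eval G lam w \<otimes> rho_word l" using vt_decompose[OF V(1)] V(2) by (simp add: w_def l_def)
  have ew: "word_eval G lam w \<in> carrier G" by (rule word_eval_closed[OF lam_funcset w])
  have "vt_perm n g = vt_perm n (rho_word l)"
    using vt_perm_lam[OF w] ew rho_word_closed[OF l] unfolding gd by simp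
  then have "perm l = id" using g(2) vt_perm_rho_word[OF l] by (simp add: sym_group_one)
  then have "rho_word l = \<one>" by (intro coxeter_faithful[OF _ l]) simp_all
  then have "word_eval G lam w = g" using gd ew by simp
  with w show thesis using that by blast
qed

lemma word_eval_PVT:
  assumes "w \<in> gwords (edges n)"
  shows "word_eval (PVT n) lam w = word_eval G lam w"
proof -
  have K: "subgroup (kernel G (sym_group n) (vt_perm n)) G" by (rule \<pi>.subgroup_kernel)
  have lamK: "lam e \<in> kernel G (sym_group n) (vt_perm n)" if "e \<in> edges n" for e
    using that lam_closed[OF that] vt_perm_Lam[of "fst e" "snd e"]
    by (auto simp: kernel_def lam_def edges_def sym_group_one)
  have inv: "inv\<^bsub>PVT n\<^esub> lam e = inv (lam e)" if "e \<in> edges n" for e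
    using m_inv_consistent[OF K lamK[OF that]] by (simp add: PVT_def G_def)
  have one_mult: "\<one>\<^bsub>PVT n\<^esub> = \<one>" "mult (PVT n) = mult G" by (simp_all add: PVT_def G_def)
  show ?thesis
    using assms by (induction w) (auto simp: word_eval_def inv one_mult)
qed

lemma PVT_raag: "raag (PVT n) (edges n) disjoint_edges lam"
proof (intro raag.intro raag_axioms.intro group_PVT)
  have car: "carrier (PVT n) = kernel G (sym_group n) (vt_perm n)" and mult: "mult (PVT n) = mult G"
    and one: "\<one>\<^bsub>PVT n\<^esub> = \<one>" by (simp_all add: PVT_def G_def)
  show "disjoint_edges x y \<Longrightarrow> disjoint_edges y x" for x y by (auto simp: disjoint_edges_def)
  show "\<not> disjoint_edges x x" for x by (auto simp: disjoint_edges_def)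
  show "lam \<in> edges n \<rightarrow> carrier (PVT n)"
    using vt_perm_Lam lam_closed by (auto simp: car kernel_def lam_def edges_def sym_group_one)
  show "lam x \<otimes>\<^bsub>PVT n\<^esub> lam y = lam y \<otimes>\<^bsub>PVT n\<^esub> lam x"
    if "x \<in> edges n" "y \<in> edges n" "disjoint_edges x y" for x y
    unfolding mult lam_def using that
    by (intro Lam_commute) (auto simp: edges_def disjoint_edges_def)
  show "\<exists>w\<in>gwords (edges n). word_eval (PVT n) lam w = g" if "g \<in> carrier (PVT n)" for g
    using kernel_generated[of g] that word_eval_PVT unfolding car by metis
  show "(w, []) \<in> edge_rel n" if "w \<in> gwords (edges n)" "word_eval (PVT n) lam w = \<one>\<^bsub>PVT n\<^esub>" for w
    using lam_word_faithful that word_eval_PVT one by simp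
qed

section \<open>The graph of disjoint pairs and the three cases\<close>

interpretation P: raag "PVT n" "edges n" disjoint_edges lam
  by (rule PVT_raag)

lemma mem_st:
  assumes "x \<in> {1..n}" "y \<in> {1..n}" "x \<noteq> y" "z \<in> {1..n}" "t \<in> {1..n}" "z \<noteq> t"
  shows "pr z t \<in> P.st (pr x y) \<longleftrightarrow> pr z t = pr x y \<or> {x, y} \<inter> {z, t} = {}"
  using assms by (simp add: P.st_def P.lk_def pr_edges disjoint_edges_pr del: atLeastAtMost_iff)

lemma mem_lk:
  assumes "x \<in> {1..n}" "y \<in> {1..n}" "x \<noteq> y" "z \<in> {1..n}" "t \<in> {1..n}" "z \<noteq> t"
  shows "pr z t \<in> P.lk (pr x y) \<longleftrightarrow> {x, y} \<inter> {z, t} = {}"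
  using assms by (simp add: P.lk_def pr_edges disjoint_edges_pr del: atLeastAtMost_iff)

lemma star_complement:
  assumes ij: "i \<in> {1..n}" "j \<in> {1..n}" "i \<noteq> j" and b: "b \<in> edges n - P.st (pr i j)"
  obtains k where "k \<in> {1..n} - {i, j}" "b = pr i k \<or> b = pr j k"
proof -
  obtain x y where xy: "x \<in> {1..n}" "y \<in> {1..n}" "x \<noteq> y" "b = pr x y"
    using b edges_pr[of b n] by auto
  then have *: "pr x y \<noteq> pr i j" "{i, j} \<inter> {x, y} \<noteq> {}" using mem_st[OF ij xy(1-3)] b by auto
  have comm: "pr x y = pr y x" by (simp add: pr_eq_iff)
  from * consider "x = i" "y \<notin> {i, j}" | "x = j" "y \<notin> {i, j}" | "y = i" "x \<notin> {i, j}" | "y = j" "x \<notin> {i, j}"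
    using xy(3) by (auto simp: pr_eq_iff)
  then show thesis
    using that[of x] that[of y] xy comm by cases auto
qed

lemma PVT_rigid:
  assumes n: "5 \<le> n"
  shows "rigid_raag (PVT n) (edges n) disjoint_edges lam"
proof (intro rigid_raag.intro rigid_raag_axioms.intro PVT_raag)
  have "edges n \<subseteq> {1..n} \<times> {1..n}" by (auto simp: edges_def)
  then show "finite (edges n)" by (rule finite_subset) simp
next
  fix e f assume ef: "e \<in> edges n" "f \<in> edges n" "e \<noteq> f"
  obtain i j where ij: "i \<in> {1..n}" "j \<in> {1..n}" "i \<noteq> j" "e = pr i j"
    using edges_pr[OF ef(1)] .
  obtain k l where kl: "k \<in> {1..n}" "l \<in> {1..n}" "k \<noteq> l" "f = pr k l"
    using edges_pr[OF ef(2)] .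
  \<comment> \<open>An endpoint of \<open>f\<close> outside \<open>e\<close>, joined to a fresh
    index, gives a pair disjoint from \<open>e\<close> that shares exactly one endpoint with
    \<open>f\<close>.\<close>
  have "pr i j \<noteq> pr k l" using ef(3) ij(4) kl(4) by simp
  then obtain z where z: "z \<in> {k, l}" "z \<notin> {i, j}" using kl(3) by (auto simp: pr_eq_iff)
  obtain t where t: "t \<in> {1..n}" "t \<notin> {i, j, k, l}" using fresh_index[OF n] .
  have zt: "z \<in> {1..n}" "z \<noteq> t" using z t kl by auto
  have "pr z t \<in> P.lk e" using mem_lk[OF ij(1-3) zt(1) t(1) zt(2)] z t ij(4) by auto
  moreover have "pr z t \<notin> P.st f"
    using mem_st[OF kl(1-3) zt(1) t(1) zt(2)] z t kl(4) by (auto simp: pr_eq_iff)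
  ultimately show "\<exists>u\<in>P.lk e. u \<notin> P.st f" by blast
next
  fix v and Q :: "edge \<Rightarrow> bool" and b c
  assume v: "v \<in> edges n" and b: "b \<in> edges n - P.st v" and c: "c \<in> edges n - P.st v"
    and Q: "\<And>b c. b \<in> edges n - P.st v \<Longrightarrow> c \<in> edges n - P.st v \<Longrightarrow> disjoint_edges b c \<Longrightarrow> Q b = Q c"
  obtain i j where ij: "i \<in> {1..n}" "j \<in> {1..n}" "i \<noteq> j" "v = pr i j" using edges_pr[OF v] .
  have compl: "pr i k \<in> edges n - P.st v" "pr j k \<in> edges n - P.st v" if k: "k \<in> {1..n}" "k \<notin> {i, j}" for k
    using k ij mem_st[OF ij(1-3) ij(1) k(1)] mem_st[OF ij(1-3) ij(2) k(1)] pr_edges[of i n k] pr_edges[of j n k]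
    by (auto simp: pr_eq_iff)
  have cross: "Q (pr i k) = Q (pr j l)"
    if k: "k \<in> {1..n}" "k \<notin> {i, j}" and l: "l \<in> {1..n}" "l \<notin> {i, j}" and "k \<noteq> l" for k l
    using that ij(3) by (intro Q compl k l) (subst disjoint_edges_pr, auto)
  have all: "Q (pr i k) = Q (pr i l) \<and> Q (pr i k) = Q (pr j l)"
    if k: "k \<in> {1..n}" "k \<notin> {i, j}" and l: "l \<in> {1..n}" "l \<notin> {i, j}" for k l
  proof -
    \<comment> \<open>Paths through fresh indices: \<open>ik, jt, il\<close> for the first equality
      and \<open>ik, ju, it, jl\<close> for the second, which also covers
      \<open>k = l\<close>.\<close>
    obtain t where t: "t \<in> {1..n}" "t \<notin> {i, j, k, l}" using fresh_index[OF n] .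
    then have t': "t \<notin> {i, j}" "t \<noteq> k" "t \<noteq> l" by auto
    have 1: "Q (pr i k) = Q (pr i l)" using cross[OF k t(1) t'(1)] cross[OF l t(1) t'(1)] t' by simp
    have "Q (pr i t) = Q (pr j l)" using cross[OF t(1) t'(1) l] t' by simp
    moreover obtain u where u: "u \<in> {1..n}" "u \<notin> {i, j, k, t}" using fresh_index[OF n] .
    then have "Q (pr i k) = Q (pr i t)"
      using cross[OF k u(1)] cross[OF t(1) t'(1) u(1)] by auto
    ultimately show ?thesis using 1 by simp
  qed
  obtain k where "k \<in> {1..n} - {i, j}" "b = pr i k \<or> b = pr j k"
    using star_complement[OF ij(1-3) b[unfolded ij(4)]] .
  moreover obtain l where "l \<in> {1..n} - {i, j}" "c = pr i l \<or> c = pr j l"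
    using star_complement[OF ij(1-3) c[unfolded ij(4)]] .
  ultimately show "Q b = Q c" using all[of k k] all[of k l] all[of l l] by auto
next
  fix v assume "v \<in> edges n"
  then obtain i j where ij: "i \<in> {1..n}" "j \<in> {1..n}" "i \<noteq> j" "v = pr i j" by (rule edges_pr)
  obtain k where k: "k \<in> {1..n}" "k \<notin> {i, j, i, j}" using fresh_index[OF n] .
  have "pr i k \<in> edges n - P.st v" "pr j k \<in> edges n - P.st v" "pr i k \<noteq> pr j k"
    using k ij mem_st[OF ij(1-3) ij(1) k(1)] mem_st[OF ij(1-3) ij(2) k(1)] pr_edges[of i n k] pr_edges[of j n k]
    by (auto simp: pr_eq_iff)
  then show "\<exists>b\<in>edges n - P.st v. \<exists>c\<in>edges n - P.st v. b \<noteq> c" by blast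
qed

lemma IA_inner_if_ge_5:
  assumes "5 \<le> n" "\<phi> \<in> IA_auto (PVT n)"
  shows "\<phi> \<in> inner_auto (PVT n)"
proof -
  interpret R: rigid_raag "PVT n" "edges n" disjoint_edges lam by (rule PVT_rigid[OF assms(1)])
  have hom: "\<phi> \<in> hom (PVT n) (PVT n)" and ext: "\<phi> \<in> extensional (carrier (PVT n))"
    using assms(2) by (auto simp: IA_auto_def auto_def Bij_def)
  obtain x where x: "x \<in> carrier (PVT n)"
    "\<And>g. g \<in> carrier (PVT n) \<Longrightarrow> \<phi> g = x \<otimes>\<^bsub>PVT n\<^esub> g \<otimes>\<^bsub>PVT n\<^esub> inv\<^bsub>PVT n\<^esub> x"
    using R.IA_endomorphism_inner[OF hom P.IA_auto_expo[OF assms(2)]] by metis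
  then have "\<phi> = (\<lambda>g\<in>carrier (PVT n). x \<otimes>\<^bsub>PVT n\<^esub> g \<otimes>\<^bsub>PVT n\<^esub> inv\<^bsub>PVT n\<^esub> x)"
    using ext by (intro extensionalityI[of \<phi> "carrier (PVT n)"]) auto
  then show ?thesis unfolding inner_auto_def using x(1) by blast
qed

lemma IA_inner_if_2:
  assumes "n = 2" "\<phi> \<in> IA_auto (PVT n)"
  shows "\<phi> \<in> inner_auto (PVT n)"
proof (rule P.IA_auto_comm[OF _ assms(2)])
  have E: "edges n = {(1, 2)}" using assms(1) by (auto simp: edges_def)
  have pow: "\<exists>k::int. x = lam (1, 2) [^]\<^bsub>PVT n\<^esub> k" if x: "x \<in> carrier (PVT n)" for x
  proof -
    obtain w where w: "w \<in> gwords (edges n)" "word_eval (PVT n) lam w = x" using P.word_exists[OF x] .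
    then have "x \<in> P.par {(1, 2)}" using P.par_ev[of w "{(1, 2)}"] E by auto
    then show ?thesis using P.par_singleton[of "(1, 2)"] E by auto
  qed
  fix x y assume "x \<in> carrier (PVT n)" "y \<in> carrier (PVT n)"
  then obtain k l :: int where "x = lam (1, 2) [^]\<^bsub>PVT n\<^esub> k" "y = lam (1, 2) [^]\<^bsub>PVT n\<^esub> l" using pow by metis
  moreover have "lam (1, 2) \<in> carrier (PVT n)" using E by (intro P.lam_closed) simp
  ultimately show "x \<otimes>\<^bsub>PVT n\<^esub> y = y \<otimes>\<^bsub>PVT n\<^esub> x" by (simp add: add.commute flip: P.int_pow_mult)
qed

lemma IA_not_inner_if_3_4:
  assumes "n = 3 \<or> n = 4"
  shows "\<exists>\<phi>\<in>IA_auto (PVT n). \<phi> \<notin> inner_auto (PVT n)"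
proof -
  \<comment> \<open>Values in the symmetric group on three letters. The disjoint pairs are
    \<open>12, 34\<close>, then \<open>13, 24\<close> and \<open>14, 23\<close>, where the two
    values agree or one is trivial. The values at \<open>12\<close> and \<open>23\<close> coincide
    and do not commute with that at \<open>13\<close>.\<close>
  define b c :: "nat \<Rightarrow> nat" where "b = transpose 1 2" and "c = transpose 2 3"
  define f where "f e = (if e = (1, 3) then b else if e \<in> {(1, 2), (1, 4), (2, 3)} then c else id)" for e :: edge
  have E: "edges n \<subseteq> {(1, 2), (1, 3), (1, 4), (2, 3), (2, 4), (3, 4)}"
  proof
    fix e assume "e \<in> edges n"
    then have "1 \<le> fst e" "fst e < snd e" "snd e \<le> 4" using assms by (auto simp: edges_def)
    then have "fst e \<in> {1, 2, 3}" "snd e \<in> {2, 3, 4}" "fst e < snd e" by auto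
    then show "e \<in> {(1, 2), (1, 3), (1, 4), (2, 3), (2, 4), (3, 4)}" by (cases e) auto
  qed
  have E': "(1, 2) \<in> edges n" "(1, 3) \<in> edges n" "(2, 3) \<in> edges n" using assms by (auto simp: edges_def)
  have "b permutes {1..3}" "c permutes {1..3}" unfolding b_def c_def by (auto intro!: permutes_swap_id)
  then have f: "f \<in> edges n \<rightarrow> carrier (sym_group 3)"
    by (auto simp: f_def sym_group_carrier permutes_id)
  have "(b \<circ> c) 1 \<noteq> (c \<circ> b) 1" by (simp add: b_def c_def transpose_def)
  then have bc: "b \<circ> c \<noteq> c \<circ> b" by metis
  show ?thesis
  proof (rule P.partial_conjugation_not_inner[of "(1, 3)" "{(1, 2), (3, 4)}" "(1, 2)" "(2, 3)" "sym_group 3" f])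
    \<comment> \<open>For n = 3 the pair \<open>(3, 4)\<close> is not a vertex, and the component is
      the isolated point \<open>(1, 2)\<close>.\<close>
    show "y \<in> {(1, 2), (3, 4)}" if "x \<in> edges n" "y \<in> edges n" "disjoint_edges x y" "x \<in> {(1, 2), (3, 4)}" for x y
      using subsetD[OF E that(1)] subsetD[OF E that(2)] that(3,4)
      by (elim insertE emptyE) (simp_all add: disjoint_edges_def)
    show "f x \<otimes>\<^bsub>sym_group 3\<^esub> f y = f y \<otimes>\<^bsub>sym_group 3\<^esub> f x" if "x \<in> edges n" "y \<in> edges n" "disjoint_edges x y" for x y
    proof -
      have "f x = id \<or> f y = id \<or> f x = f y"
        using subsetD[OF E that(1)] subsetD[OF E that(2)] that(3)
        by (elim insertE emptyE) (simp_all add: f_def disjoint_edges_def)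
      then show ?thesis by (auto simp: sym_group_mult)
    qed
    show "f (1, 3) \<otimes>\<^bsub>sym_group 3\<^esub> f (1, 2) \<noteq> f (1, 2) \<otimes>\<^bsub>sym_group 3\<^esub> f (1, 3)"
      using bc by (simp add: f_def sym_group_mult)
  qed (use E' f in \<open>auto simp: f_def sym_group_is_group\<close>)
qed

end

theorem corollary5p14:
  fixes n :: nat
  assumes "n \<ge> 2"
  shows "(\<forall>\<phi> \<in> IA_auto (PVT n). \<phi> \<in> inner_auto (PVT n)) \<longleftrightarrow> n = 2 \<or> n \<ge> 5"
proof -
  interpret virtual_twin n "VT n" by unfold_locales (use assms in auto)
  consider "n = 2" | "n = 3 \<or> n = 4" | "5 \<le> n" using assms by linarith
  then show ?thesis
  proof cases
    case 2
    then show ?thesis using IA_not_inner_if_3_4 by auto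
  qed (use IA_inner_if_2 IA_inner_if_ge_5 in auto)
qed

end
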